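(* Let $(W,S)$ be a finite Coxeter group with $S=\{s_1,\dots,s_n\}$, let $\Phi$ be a $W$-gluing data for abelian categories $(\mathcal{C}_w)_{w\in W}$, fix $s_i\in S$ and let $P_i=\{w\in W:\ell(ws_i)>\ell(w)\}$. The functor $(j^*_{\cdot}):\mathcal{C}(\Phi_{P_i})\to\mathcal{C}_{\mathrm{tot}}$ is an equivalence of categories.
   Context: A $W$-gluing data $\Phi$ consists of right-exact functors $\Phi_w:\mathcal{C}_{w'}\to\mathcal{C}_{ww'}$ for all $w,w'\in W$ (same symbol for all $w'$), with $\Phi_1=\mathrm{Id}$, and morphisms of functors $\nu_{w,w'}:\Phi_w\Phi_{w'}\to\Phi_{ww'}$ (on each $\mathcal{C}_{w''}$) with $\nu_{1,w}=\nu_{w,1}=\mathrm{id}$, satisfying associativity $\nu_{ww',w''}\circ(\nu_{w,w'}\Phi_{w''})=\nu_{w,w'w''}\circ(\Phi_w\nu_{w',w''})$, and such that $\nu_{w,w'}$ is an isomorphism whenever $\ell(ww')=\ell(w)+\ell(w')$. For $P\subset W$, $\mathcal{C}(\Phi_P)$ is the abelian category of collections $(A_w,w\in P;\alpha_{w,w'})$ with $A_w\in\mathcal{C}_w$ and morphisms $\alpha_{w,w'}:\Phi_wA_{w'}\to A_{ww'}$ for $w',ww'\in P$, with $\alpha_{1,w'}=\mathrm{id}$ and $\alpha_{w_1,w_2w'}\circ\Phi_{w_1}(\alpha_{w_2,w'})=\alpha_{w_1w_2,w'}\circ\nu_{w_1,w_2}$; morphisms are componentwise and compatible with $\alpha$.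 For $P\subset P'$ there is an obvious restriction functor $\mathcal{C}(\Phi_{P'})\to\mathcal{C}(\Phi_P)$. Identify $S$ with $[1,n]$; for $J\subset S$ let $W_J$ be the subgroup generated by $J$, and $W^{(j)}=W_{[1,n]-\{j\}}$. For nonempty $J\subset[1,n]$ put $\mathcal{C}_J=\bigoplus\mathcal{C}(\Phi_{W_{S-J}x})$, the sum over cosets $W_{S-J}x\in W_{S-J}\backslash W$ such that $W^{(j)}x\subset P_i$ for every $j\in J$. For nonempty $J\subset K\subset[1,n]$ there are restriction functors $j^*_{J,K}:\mathcal{C}_J\to\mathcal{C}_K$ (the component at $W_{S-K}x$ is the restriction from the component at $W_{S-J}x\supset W_{S-K}x$). $\mathcal{C}_{\mathrm{tot}}$ is the category of cocartesian sections: objects are collections of objects $A_J\in\mathcal{C}_J$ ($J\subset[1,n]$ nonempty) and isomorphisms $\alpha_{J,K}:A_K\xrightarrow{\sim}j^*_{J,K}A_J$ for $J\subset K$ such that $\alpha_{J,L}=j^*_{K,L}(\alpha_{J,K})\circ\alpha_{K,L}$ for $J\subset K\subset L$; morphisms are collections of morphisms $A_J\to A'_J$ compatible with the $\alpha_{J,K}$. The functor $(j^*_{\cdot})$ sends $A\in\mathcal{C}(\Phi_{P_i})$ to the collection $(j_J^*A)_J$, where $j_J^*:\mathcal{C}(\Phi_{P_i})\to\mathcal{C}_J$ is restriction to all the cosets in question, with the canonical identifications. *)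

theory Defs
  imports "HOL-Algebra.Multiplicative_Group" "HOL-Algebra.Generated_Groups"
begin

section \<open>Categories, functors and equivalences\<close>

text \<open>
  Composition \<open>Comp C g f\<close> means ``first \<open>f\<close>, then \<open>g\<close>''.  Only the values of the
  operations on objects and on composable arrows matter.
\<close>

record ('o, 'm) cat =
  Obj :: "'o set"
  Arr :: "'m set"
  Dom :: "'m \<Rightarrow> 'o"
  Cod :: "'m \<Rightarrow> 'o"
  Ident :: "'o \<Rightarrow> 'm"
  Comp :: "'m \<Rightarrow> 'm \<Rightarrow> 'm"

definition Hom :: "('o, 'm, 'z) cat_scheme \<Rightarrow> 'o \<Rightarrow> 'o \<Rightarrow> 'm set" where
  "Hom C A B = {f \<in> Arr C. Dom C f = A \<and> Cod C f = B}"

locale category =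
  fixes C :: "('o, 'm, 'z) cat_scheme"
  assumes Dom_closed: "f \<in> Arr C \<Longrightarrow> Dom C f \<in> Obj C"
    and Cod_closed: "f \<in> Arr C \<Longrightarrow> Cod C f \<in> Obj C"
    and Ident_closed: "A \<in> Obj C \<Longrightarrow> Ident C A \<in> Hom C A A"
    and Comp_closed: "f \<in> Hom C A B \<Longrightarrow> g \<in> Hom C B D \<Longrightarrow> Comp C g f \<in> Hom C A D"
    and Ident_left: "f \<in> Hom C A B \<Longrightarrow> Comp C (Ident C B) f = f"
    and Ident_right: "f \<in> Hom C A B \<Longrightarrow> Comp C f (Ident C A) = f"
    and Comp_assoc: "f \<in> Hom C A B \<Longrightarrow> g \<in> Hom C B D \<Longrightarrow> h \<in> Hom C D E \<Longrightarrow>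
      Comp C (Comp C h g) f = Comp C h (Comp C g f)"

definition is_iso :: "('o, 'm, 'z) cat_scheme \<Rightarrow> 'm \<Rightarrow> bool" where
  "is_iso C f \<longleftrightarrow> f \<in> Arr C \<and>
    (\<exists>g \<in> Hom C (Cod C f) (Dom C f).
       Comp C g f = Ident C (Dom C f) \<and> Comp C f g = Ident C (Cod C f))"

record ('o, 'm, 'p, 'q) func =
  omap :: "'o \<Rightarrow> 'p"
  amap :: "'m \<Rightarrow> 'q"

definition is_functor ::
  "('o, 'm, 'y) cat_scheme \<Rightarrow> ('p, 'q, 'z) cat_scheme \<Rightarrow> ('o, 'm, 'p, 'q) func \<Rightarrow> bool" where
  "is_functor C D F \<longleftrightarrow> category C \<and> category D \<and>
    (\<forall>A \<in> Obj C. omap F A \<in> Obj D) \<and>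
    (\<forall>A \<in> Obj C. \<forall>B \<in> Obj C. \<forall>f \<in> Hom C A B. amap F f \<in> Hom D (omap F A) (omap F B)) \<and>
    (\<forall>A \<in> Obj C. amap F (Ident C A) = Ident D (omap F A)) \<and>
    (\<forall>f \<in> Arr C. \<forall>g \<in> Arr C. Dom C g = Cod C f \<longrightarrow>
       amap F (Comp C g f) = Comp D (amap F g) (amap F f))"

definition id_func :: "('o, 'm, 'o, 'm) func" where
  "id_func = \<lparr>omap = (\<lambda>A. A), amap = (\<lambda>f. f)\<rparr>"

definition comp_func ::
  "('p, 'q, 'r, 's) func \<Rightarrow> ('o, 'm, 'p, 'q) func \<Rightarrow> ('o, 'm, 'r, 's) func" where
  "comp_func G F = \<lparr>omap = (\<lambda>A. omap G (omap F A)), amap = (\<lambda>f. amap G (amap F f))\<rparr>"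

definition is_nat_trans ::
  "('o, 'm, 'y) cat_scheme \<Rightarrow> ('p, 'q, 'z) cat_scheme \<Rightarrow>
   ('o, 'm, 'p, 'q) func \<Rightarrow> ('o, 'm, 'p, 'q) func \<Rightarrow> ('o \<Rightarrow> 'q) \<Rightarrow> bool" where
  "is_nat_trans C D F G \<eta> \<longleftrightarrow> is_functor C D F \<and> is_functor C D G \<and>
    (\<forall>A \<in> Obj C. \<eta> A \<in> Hom D (omap F A) (omap G A)) \<and>
    (\<forall>f \<in> Arr C. Comp D (\<eta> (Cod C f)) (amap F f) = Comp D (amap G f) (\<eta> (Dom C f)))"

definition is_nat_iso ::
  "('o, 'm, 'y) cat_scheme \<Rightarrow> ('p, 'q, 'z) cat_scheme \<Rightarrow>
   ('o, 'm, 'p, 'q) func \<Rightarrow> ('o, 'm, 'p, 'q) func \<Rightarrow> ('o \<Rightarrow> 'q) \<Rightarrow> bool" where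
  "is_nat_iso C D F G \<eta> \<longleftrightarrow> is_nat_trans C D F G \<eta> \<and> (\<forall>A \<in> Obj C. is_iso D (\<eta> A))"

definition is_equivalence ::
  "('o, 'm, 'y) cat_scheme \<Rightarrow> ('p, 'q, 'z) cat_scheme \<Rightarrow> ('o, 'm, 'p, 'q) func \<Rightarrow> bool" where
  "is_equivalence C D F \<longleftrightarrow> is_functor C D F \<and>
    (\<exists>G. is_functor D C G \<and>
      (\<exists>\<eta>. is_nat_iso C C id_func (comp_func G F) \<eta>) \<and>
      (\<exists>\<epsilon>. is_nat_iso D D (comp_func F G) id_func \<epsilon>))"


section \<open>Abelian categories and right-exact functors\<close>

record ('o, 'm) abcat = "('o, 'm) cat" +
  Add :: "'m \<Rightarrow> 'm \<Rightarrow> 'm"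
  Zero :: "'o \<Rightarrow> 'o \<Rightarrow> 'm"

definition hom_group :: "('o, 'm, 'z) abcat_scheme \<Rightarrow> 'o \<Rightarrow> 'o \<Rightarrow> 'm monoid" where
  "hom_group C A B = \<lparr>carrier = Hom C A B, monoid.mult = Add C, one = Zero C A B\<rparr>"

definition is_monic :: "('o, 'm, 'z) cat_scheme \<Rightarrow> 'm \<Rightarrow> bool" where
  "is_monic C f \<longleftrightarrow> f \<in> Arr C \<and>
    (\<forall>g \<in> Arr C. \<forall>h \<in> Arr C. Cod C g = Dom C f \<longrightarrow> Cod C h = Dom C f \<longrightarrow> Dom C g = Dom C h \<longrightarrow>
       Comp C f g = Comp C f h \<longrightarrow> g = h)"

definition is_epic :: "('o, 'm, 'z) cat_scheme \<Rightarrow> 'm \<Rightarrow> bool" where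
  "is_epic C f \<longleftrightarrow> f \<in> Arr C \<and>
    (\<forall>g \<in> Arr C. \<forall>h \<in> Arr C. Dom C g = Cod C f \<longrightarrow> Dom C h = Cod C f \<longrightarrow> Cod C g = Cod C h \<longrightarrow>
       Comp C g f = Comp C h f \<longrightarrow> g = h)"

definition is_kernel :: "('o, 'm, 'z) abcat_scheme \<Rightarrow> 'm \<Rightarrow> 'm \<Rightarrow> bool" where
  "is_kernel C f k \<longleftrightarrow> f \<in> Arr C \<and> k \<in> Arr C \<and> Cod C k = Dom C f \<and>
    Comp C f k = Zero C (Dom C k) (Cod C f) \<and>
    (\<forall>h \<in> Arr C. Cod C h = Dom C f \<longrightarrow> Comp C f h = Zero C (Dom C h) (Cod C f) \<longrightarrow>
       (\<exists>!u. u \<in> Hom C (Dom C h) (Dom C k) \<and> Comp C k u = h))"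

definition is_cokernel :: "('o, 'm, 'z) abcat_scheme \<Rightarrow> 'm \<Rightarrow> 'm \<Rightarrow> bool" where
  "is_cokernel C f q \<longleftrightarrow> f \<in> Arr C \<and> q \<in> Arr C \<and> Dom C q = Cod C f \<and>
    Comp C q f = Zero C (Dom C f) (Cod C q) \<and>
    (\<forall>h \<in> Arr C. Dom C h = Cod C f \<longrightarrow> Comp C h f = Zero C (Dom C f) (Cod C h) \<longrightarrow>
       (\<exists>!u. u \<in> Hom C (Cod C q) (Cod C h) \<and> Comp C u q = h))"

definition is_zero_object :: "('o, 'm, 'z) cat_scheme \<Rightarrow> 'o \<Rightarrow> bool" where
  "is_zero_object C Z \<longleftrightarrow> Z \<in> Obj C \<and>
    (\<forall>A \<in> Obj C. (\<exists>!f. f \<in> Hom C Z A) \<and> (\<exists>!f. f \<in> Hom C A Z))"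

definition is_product ::
  "('o, 'm, 'z) cat_scheme \<Rightarrow> 'o \<Rightarrow> 'o \<Rightarrow> 'o \<Rightarrow> 'm \<Rightarrow> 'm \<Rightarrow> bool" where
  "is_product C A B R p q \<longleftrightarrow> p \<in> Hom C R A \<and> q \<in> Hom C R B \<and>
    (\<forall>X \<in> Obj C. \<forall>f \<in> Hom C X A. \<forall>g \<in> Hom C X B.
       \<exists>!u. u \<in> Hom C X R \<and> Comp C p u = f \<and> Comp C q u = g)"

locale abelian_category = category C
  for C :: "('o, 'm, 'z) abcat_scheme" +
  assumes hom_comm_group:
      "A \<in> Obj C \<Longrightarrow> B \<in> Obj C \<Longrightarrow> comm_group (hom_group C A B)"
    and Comp_Add_left:
      "f \<in> Hom C A B \<Longrightarrow> g \<in> Hom C B D \<Longrightarrow> g' \<in> Hom C B D \<Longrightarrow>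
       Comp C (Add C g g') f = Add C (Comp C g f) (Comp C g' f)"
    and Comp_Add_right:
      "f \<in> Hom C A B \<Longrightarrow> f' \<in> Hom C A B \<Longrightarrow> g \<in> Hom C B D \<Longrightarrow>
       Comp C g (Add C f f') = Add C (Comp C g f) (Comp C g f')"
    and zero_object_exists: "\<exists>Z. is_zero_object C Z"
    and products_exist: "A \<in> Obj C \<Longrightarrow> B \<in> Obj C \<Longrightarrow> \<exists>R p q. is_product C A B R p q"
    and kernels_exist: "f \<in> Arr C \<Longrightarrow> \<exists>k. is_kernel C f k"
    and cokernels_exist: "f \<in> Arr C \<Longrightarrow> \<exists>q. is_cokernel C f q"
    and monic_is_kernel: "is_monic C m \<Longrightarrow> \<exists>f. is_kernel C f m"
    and epic_is_cokernel: "is_epic C e \<Longrightarrow> \<exists>f. is_cokernel C f e"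

text \<open>
  A sequence \<open>A \<rightarrow> B \<rightarrow> Q \<rightarrow> 0\<close> in an abelian category is exact iff \<open>B \<rightarrow> Q\<close> is a cokernel of
  \<open>A \<rightarrow> B\<close>; a right-exact functor is an additive functor that preserves such sequences.
\<close>

definition right_exact ::
  "('o, 'm, 'y) abcat_scheme \<Rightarrow> ('p, 'q, 'z) abcat_scheme \<Rightarrow> ('o, 'm, 'p, 'q) func \<Rightarrow> bool" where
  "right_exact C D F \<longleftrightarrow> is_functor C D F \<and>
    (\<forall>A \<in> Obj C. \<forall>B \<in> Obj C. \<forall>f \<in> Hom C A B. \<forall>g \<in> Hom C A B.
       amap F (Add C f g) = Add D (amap F f) (amap F g)) \<and>
    (\<forall>f q. is_cokernel C f q \<longrightarrow> is_cokernel D (amap F f) (amap F q))"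


section \<open>Coxeter groups\<close>

definition word_prod :: "('w, 'z) monoid_scheme \<Rightarrow> 'w list \<Rightarrow> 'w" where
  "word_prod W ws = foldr (\<lambda>s x. s \<otimes>\<^bsub>W\<^esub> x) ws \<one>\<^bsub>W\<^esub>"

text \<open>
  The congruence on words in \<open>S\<close> generated by the relators \<open>(s t)\<^sup>m\<close>, where \<open>m\<close> is the order of
  \<open>s t\<close> in \<open>W\<close>.  If \<open>s t\<close> has infinite order then \<open>ord\<close> is \<open>0\<close> and the relator is the empty
  word.  The case \<open>s = t\<close> gives \<open>s s \<sim> 1\<close>, so formal inverses of the generators are not needed
  to express the group presentation.
\<close>

inductive coxeter_equiv :: "('w, 'z) monoid_scheme \<Rightarrow> 'w set \<Rightarrow> 'w list \<Rightarrow> 'w list \<Rightarrow> bool"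
  for W :: "('w, 'z) monoid_scheme" and S :: "'w set" where
  relator: "s \<in> S \<Longrightarrow> t \<in> S \<Longrightarrow>
    coxeter_equiv W S (u @ concat (replicate (group.ord W (s \<otimes>\<^bsub>W\<^esub> t)) [s, t]) @ v) (u @ v)"
| refl: "coxeter_equiv W S u u"
| sym: "coxeter_equiv W S u v \<Longrightarrow> coxeter_equiv W S v u"
| trans: "coxeter_equiv W S u v \<Longrightarrow> coxeter_equiv W S v w \<Longrightarrow> coxeter_equiv W S u w"

locale coxeter_system = group W
  for W :: "('w, 'z) monoid_scheme" and S :: "'w set" +
  assumes gens_closed: "S \<subseteq> carrier W"
    and gens_order: "s \<in> S \<Longrightarrow> ord s = 2"
    and gens_generate: "generate W S = carrier W"
    and presentation: "set u \<subseteq> S \<Longrightarrow> set v \<subseteq> S \<Longrightarrow> word_prod W u = word_prod W v \<Longrightarrow>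
      coxeter_equiv W S u v"

definition cox_length :: "('w, 'z) monoid_scheme \<Rightarrow> 'w set \<Rightarrow> 'w \<Rightarrow> nat" where
  "cox_length W S w = (LEAST k. \<exists>ws. set ws \<subseteq> S \<and> length ws = k \<and> word_prod W ws = w)"

text \<open>The set \<open>P\<^sub>i\<close>, for \<open>s = s\<^sub>i\<close>.\<close>

definition non_descent_set :: "('w, 'z) monoid_scheme \<Rightarrow> 'w set \<Rightarrow> 'w \<Rightarrow> 'w set" where
  "non_descent_set W S s = {w \<in> carrier W. cox_length W S (w \<otimes>\<^bsub>W\<^esub> s) > cox_length W S w}"


section \<open>Gluing data\<close>

text \<open>
  \<open>\<Phi> w w'\<close> is the functor \<open>\<Phi>\<^sub>w : C\<^sub>w\<^sub>' \<rightarrow> C\<^sub>w\<^sub>w\<^sub>'\<close>, and \<open>\<nu> w w' w'' A\<close> is the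
  component at \<open>A\<close> in \<open>C\<^sub>w\<^sub>'\<^sub>'\<close> of \<open>\<nu>\<^sub>w\<^sub>,\<^sub>w\<^sub>' : \<Phi>\<^sub>w \<Phi>\<^sub>w\<^sub>' \<rightarrow> \<Phi>\<^sub>w\<^sub>w\<^sub>'\<close>.
\<close>

locale gluing_data =
  fixes W :: "('w, 'z) monoid_scheme" and S :: "'w set"
    and C :: "'w \<Rightarrow> ('o, 'm, 'y) abcat_scheme"
    and \<Phi> :: "'w \<Rightarrow> 'w \<Rightarrow> ('o, 'm, 'o, 'm) func"
    and \<nu> :: "'w \<Rightarrow> 'w \<Rightarrow> 'w \<Rightarrow> 'o \<Rightarrow> 'm"
  assumes Phi_right_exact:
      "w \<in> carrier W \<Longrightarrow> w' \<in> carrier W \<Longrightarrow> right_exact (C w') (C (w \<otimes>\<^bsub>W\<^esub> w')) (\<Phi> w w')"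
    and Phi_one_obj: "w \<in> carrier W \<Longrightarrow> A \<in> Obj (C w) \<Longrightarrow> omap (\<Phi> \<one>\<^bsub>W\<^esub> w) A = A"
    and Phi_one_arr: "w \<in> carrier W \<Longrightarrow> f \<in> Arr (C w) \<Longrightarrow> amap (\<Phi> \<one>\<^bsub>W\<^esub> w) f = f"
    and nu_nat_trans:
      "w \<in> carrier W \<Longrightarrow> w' \<in> carrier W \<Longrightarrow> w'' \<in> carrier W \<Longrightarrow>
       is_nat_trans (C w'') (C (w \<otimes>\<^bsub>W\<^esub> w' \<otimes>\<^bsub>W\<^esub> w''))
         (comp_func (\<Phi> w (w' \<otimes>\<^bsub>W\<^esub> w'')) (\<Phi> w' w'')) (\<Phi> (w \<otimes>\<^bsub>W\<^esub> w') w'') (\<nu> w w' w'')"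
    and nu_one_left:
      "w \<in> carrier W \<Longrightarrow> w'' \<in> carrier W \<Longrightarrow> A \<in> Obj (C w'') \<Longrightarrow>
       \<nu> \<one>\<^bsub>W\<^esub> w w'' A = Ident (C (w \<otimes>\<^bsub>W\<^esub> w'')) (omap (\<Phi> w w'') A)"
    and nu_one_right:
      "w \<in> carrier W \<Longrightarrow> w'' \<in> carrier W \<Longrightarrow> A \<in> Obj (C w'') \<Longrightarrow>
       \<nu> w \<one>\<^bsub>W\<^esub> w'' A = Ident (C (w \<otimes>\<^bsub>W\<^esub> w'')) (omap (\<Phi> w w'') A)"
    and nu_assoc:
      "w \<in> carrier W \<Longrightarrow> w' \<in> carrier W \<Longrightarrow> w'' \<in> carrier W \<Longrightarrow> x \<in> carrier W \<Longrightarrow>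
       A \<in> Obj (C x) \<Longrightarrow>
       Comp (C (w \<otimes>\<^bsub>W\<^esub> w' \<otimes>\<^bsub>W\<^esub> w'' \<otimes>\<^bsub>W\<^esub> x))
         (\<nu> (w \<otimes>\<^bsub>W\<^esub> w') w'' x A) (\<nu> w w' (w'' \<otimes>\<^bsub>W\<^esub> x) (omap (\<Phi> w'' x) A)) =
       Comp (C (w \<otimes>\<^bsub>W\<^esub> w' \<otimes>\<^bsub>W\<^esub> w'' \<otimes>\<^bsub>W\<^esub> x))
         (\<nu> w (w' \<otimes>\<^bsub>W\<^esub> w'') x A) (amap (\<Phi> w (w' \<otimes>\<^bsub>W\<^esub> w'' \<otimes>\<^bsub>W\<^esub> x)) (\<nu> w' w'' x A))"
    and nu_iso:
      "w \<in> carrier W \<Longrightarrow> w' \<in> carrier W \<Longrightarrow> w'' \<in> carrier W \<Longrightarrow>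
       cox_length W S (w \<otimes>\<^bsub>W\<^esub> w') = cox_length W S w + cox_length W S w' \<Longrightarrow>
       is_nat_iso (C w'') (C (w \<otimes>\<^bsub>W\<^esub> w' \<otimes>\<^bsub>W\<^esub> w''))
         (comp_func (\<Phi> w (w' \<otimes>\<^bsub>W\<^esub> w'')) (\<Phi> w' w'')) (\<Phi> (w \<otimes>\<^bsub>W\<^esub> w') w'') (\<nu> w w' w'')"


section \<open>The category of glued objects over a subset of the group\<close>

text \<open>
  Objects are pairs \<open>(A, \<alpha>)\<close>.  All families are extensional functions on their index sets, so
  that equality of objects and of morphisms is the intended one.
\<close>

definition glue_pairs :: "('w, 'z) monoid_scheme \<Rightarrow> 'w set \<Rightarrow> ('w \<times> 'w) set" where
  "glue_pairs W P = {(w, w'). w \<in> carrier W \<and> w' \<in> P \<and> w \<otimes>\<^bsub>W\<^esub> w' \<in> P}"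

type_synonym ('w, 'o, 'm) glue_obj = "('w \<Rightarrow> 'o) \<times> ('w \<times> 'w \<Rightarrow> 'm)"
type_synonym ('w, 'o, 'm) glue_arr =
  "('w, 'o, 'm) glue_obj \<times> ('w, 'o, 'm) glue_obj \<times> ('w \<Rightarrow> 'm)"

definition glue_objs ::
  "('w, 'z) monoid_scheme \<Rightarrow> ('w \<Rightarrow> ('o, 'm, 'y) abcat_scheme) \<Rightarrow>
   ('w \<Rightarrow> 'w \<Rightarrow> ('o, 'm, 'o, 'm) func) \<Rightarrow> ('w \<Rightarrow> 'w \<Rightarrow> 'w \<Rightarrow> 'o \<Rightarrow> 'm) \<Rightarrow> 'w set \<Rightarrow>
   ('w, 'o, 'm) glue_obj set" where
  "glue_objs W C \<Phi> \<nu> P = {(A, \<alpha>).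
     A \<in> (\<Pi>\<^sub>E w \<in> P. Obj (C w)) \<and>
     \<alpha> \<in> (\<Pi>\<^sub>E (w, w') \<in> glue_pairs W P.
           Hom (C (w \<otimes>\<^bsub>W\<^esub> w')) (omap (\<Phi> w w') (A w')) (A (w \<otimes>\<^bsub>W\<^esub> w'))) \<and>
     (\<forall>w' \<in> P. \<alpha> (\<one>\<^bsub>W\<^esub>, w') = Ident (C w') (A w')) \<and>
     (\<forall>w\<^sub>1 \<in> carrier W. \<forall>w\<^sub>2 \<in> carrier W. \<forall>w' \<in> P.
        w\<^sub>2 \<otimes>\<^bsub>W\<^esub> w' \<in> P \<longrightarrow> w\<^sub>1 \<otimes>\<^bsub>W\<^esub> w\<^sub>2 \<otimes>\<^bsub>W\<^esub> w' \<in> P \<longrightarrow>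
        Comp (C (w\<^sub>1 \<otimes>\<^bsub>W\<^esub> w\<^sub>2 \<otimes>\<^bsub>W\<^esub> w'))
          (\<alpha> (w\<^sub>1, w\<^sub>2 \<otimes>\<^bsub>W\<^esub> w')) (amap (\<Phi> w\<^sub>1 (w\<^sub>2 \<otimes>\<^bsub>W\<^esub> w')) (\<alpha> (w\<^sub>2, w'))) =
        Comp (C (w\<^sub>1 \<otimes>\<^bsub>W\<^esub> w\<^sub>2 \<otimes>\<^bsub>W\<^esub> w'))
          (\<alpha> (w\<^sub>1 \<otimes>\<^bsub>W\<^esub> w\<^sub>2, w')) (\<nu> w\<^sub>1 w\<^sub>2 w' (A w')))}"

definition glue_homs ::
  "('w, 'z) monoid_scheme \<Rightarrow> ('w \<Rightarrow> ('o, 'm, 'y) abcat_scheme) \<Rightarrow>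
   ('w \<Rightarrow> 'w \<Rightarrow> ('o, 'm, 'o, 'm) func) \<Rightarrow> 'w set \<Rightarrow>
   ('w, 'o, 'm) glue_obj \<Rightarrow> ('w, 'o, 'm) glue_obj \<Rightarrow> ('w \<Rightarrow> 'm) set" where
  "glue_homs W C \<Phi> P X Y = {f.
     f \<in> (\<Pi>\<^sub>E w \<in> P. Hom (C w) (fst X w) (fst Y w)) \<and>
     (\<forall>(w, w') \<in> glue_pairs W P.
        Comp (C (w \<otimes>\<^bsub>W\<^esub> w')) (f (w \<otimes>\<^bsub>W\<^esub> w')) (snd X (w, w')) =
        Comp (C (w \<otimes>\<^bsub>W\<^esub> w')) (snd Y (w, w')) (amap (\<Phi> w w') (f w')))}"

definition glue_cat ::
  "('w, 'z) monoid_scheme \<Rightarrow> ('w \<Rightarrow> ('o, 'm, 'y) abcat_scheme) \<Rightarrow>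
   ('w \<Rightarrow> 'w \<Rightarrow> ('o, 'm, 'o, 'm) func) \<Rightarrow> ('w \<Rightarrow> 'w \<Rightarrow> 'w \<Rightarrow> 'o \<Rightarrow> 'm) \<Rightarrow> 'w set \<Rightarrow>
   (('w, 'o, 'm) glue_obj, ('w, 'o, 'm) glue_arr) cat" where
  "glue_cat W C \<Phi> \<nu> P = \<lparr>
     Obj = glue_objs W C \<Phi> \<nu> P,
     Arr = {(X, Y, f). X \<in> glue_objs W C \<Phi> \<nu> P \<and> Y \<in> glue_objs W C \<Phi> \<nu> P \<and>
              f \<in> glue_homs W C \<Phi> P X Y},
     Dom = (\<lambda>(X, Y, f). X),
     Cod = (\<lambda>(X, Y, f). Y),
     Ident = (\<lambda>X. (X, X, \<lambda>w \<in> P. Ident (C w) (fst X w))),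
     Comp = (\<lambda>(Y, Z, g) (X, Y', f). (X, Z, \<lambda>w \<in> P. Comp (C w) (g w) (f w)))\<rparr>"

text \<open>Restriction from any larger subset to \<open>P\<close>.\<close>

definition glue_restr_obj ::
  "('w, 'z) monoid_scheme \<Rightarrow> 'w set \<Rightarrow> ('w, 'o, 'm) glue_obj \<Rightarrow> ('w, 'o, 'm) glue_obj" where
  "glue_restr_obj W P X = (restrict (fst X) P, restrict (snd X) (glue_pairs W P))"

definition glue_restr ::
  "('w, 'z) monoid_scheme \<Rightarrow> 'w set \<Rightarrow>
   (('w, 'o, 'm) glue_obj, ('w, 'o, 'm) glue_arr, ('w, 'o, 'm) glue_obj, ('w, 'o, 'm) glue_arr) func"
  where
  "glue_restr W P = \<lparr>
     omap = glue_restr_obj W P,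
     amap = (\<lambda>(X, Y, f). (glue_restr_obj W P X, glue_restr_obj W P Y, restrict f P))\<rparr>"


section \<open>Direct sums of categories and cocartesian sections\<close>

text \<open>
  The index sets below are finite, so the direct sum of categories is their product; over the
  empty index set it is the category with one object and one arrow.
\<close>

definition sum_cat ::
  "'i set \<Rightarrow> ('i \<Rightarrow> ('o, 'm, 'z) cat_scheme) \<Rightarrow> ('i \<Rightarrow> 'o, 'i \<Rightarrow> 'm) cat" where
  "sum_cat I C = \<lparr>
     Obj = (\<Pi>\<^sub>E i \<in> I. Obj (C i)),
     Arr = (\<Pi>\<^sub>E i \<in> I. Arr (C i)),
     Dom = (\<lambda>f. \<lambda>i \<in> I. Dom (C i) (f i)),
     Cod = (\<lambda>f. \<lambda>i \<in> I. Cod (C i) (f i)),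
     Ident = (\<lambda>A. \<lambda>i \<in> I. Ident (C i) (A i)),
     Comp = (\<lambda>g f. \<lambda>i \<in> I. Comp (C i) (g i) (f i))\<rparr>"

text \<open>
  In the next definitions \<open>I\<close> is a set of sets ordered by inclusion, \<open>D J\<close> is a category for
  each \<open>J \<in> I\<close>, and \<open>R J K : D J \<rightarrow> D K\<close> is a functor for each \<open>J \<subseteq> K\<close>.
\<close>

definition incl_pairs :: "'i set set \<Rightarrow> ('i set \<times> 'i set) set" where
  "incl_pairs I = {(J, K). J \<in> I \<and> K \<in> I \<and> J \<subseteq> K}"

type_synonym ('i, 'o, 'm) section_obj = "('i set \<Rightarrow> 'o) \<times> ('i set \<times> 'i set \<Rightarrow> 'm)"
type_synonym ('i, 'o, 'm) section_arr =
  "('i, 'o, 'm) section_obj \<times> ('i, 'o, 'm) section_obj \<times> ('i set \<Rightarrow> 'm)"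

definition section_objs ::
  "'i set set \<Rightarrow> ('i set \<Rightarrow> ('o, 'm, 'z) cat_scheme) \<Rightarrow>
   ('i set \<Rightarrow> 'i set \<Rightarrow> ('o, 'm, 'o, 'm) func) \<Rightarrow> ('i, 'o, 'm) section_obj set" where
  "section_objs I D R = {(A, \<alpha>).
     A \<in> (\<Pi>\<^sub>E J \<in> I. Obj (D J)) \<and>
     \<alpha> \<in> (\<Pi>\<^sub>E (J, K) \<in> incl_pairs I. Hom (D K) (A K) (omap (R J K) (A J))) \<and>
     (\<forall>(J, K) \<in> incl_pairs I. is_iso (D K) (\<alpha> (J, K))) \<and>
     (\<forall>J \<in> I. \<forall>K \<in> I. \<forall>L \<in> I. J \<subseteq> K \<longrightarrow> K \<subseteq> L \<longrightarrow>
        \<alpha> (J, L) = Comp (D L) (amap (R K L) (\<alpha> (J, K))) (\<alpha> (K, L)))}"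

definition section_homs ::
  "'i set set \<Rightarrow> ('i set \<Rightarrow> ('o, 'm, 'z) cat_scheme) \<Rightarrow>
   ('i set \<Rightarrow> 'i set \<Rightarrow> ('o, 'm, 'o, 'm) func) \<Rightarrow>
   ('i, 'o, 'm) section_obj \<Rightarrow> ('i, 'o, 'm) section_obj \<Rightarrow> ('i set \<Rightarrow> 'm) set" where
  "section_homs I D R X Y = {f.
     f \<in> (\<Pi>\<^sub>E J \<in> I. Hom (D J) (fst X J) (fst Y J)) \<and>
     (\<forall>(J, K) \<in> incl_pairs I.
        Comp (D K) (snd Y (J, K)) (f K) = Comp (D K) (amap (R J K) (f J)) (snd X (J, K)))}"

definition section_cat ::
  "'i set set \<Rightarrow> ('i set \<Rightarrow> ('o, 'm, 'z) cat_scheme) \<Rightarrow>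
   ('i set \<Rightarrow> 'i set \<Rightarrow> ('o, 'm, 'o, 'm) func) \<Rightarrow>
   (('i, 'o, 'm) section_obj, ('i, 'o, 'm) section_arr) cat" where
  "section_cat I D R = \<lparr>
     Obj = section_objs I D R,
     Arr = {(X, Y, f). X \<in> section_objs I D R \<and> Y \<in> section_objs I D R \<and>
              f \<in> section_homs I D R X Y},
     Dom = (\<lambda>(X, Y, f). X),
     Cod = (\<lambda>(X, Y, f). Y),
     Ident = (\<lambda>X. (X, X, \<lambda>J \<in> I. Ident (D J) (fst X J))),
     Comp = (\<lambda>(Y, Z, g) (X, Y', f). (X, Z, \<lambda>J \<in> I. Comp (D J) (g J) (f J)))\<rparr>"


section \<open>The categories \<open>C\<^sub>J\<close> and \<open>C\<^sub>t\<^sub>o\<^sub>t\<close>\<close>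

text \<open>
  Subsets of \<open>[1, n]\<close> are represented by subsets of \<open>S\<close>.  The set \<open>P\<close> is kept as a parameter;
  it is instantiated to \<open>non_descent_set W S s\<close>.  Here \<open>generate W (S - {j})\<close> is \<open>W\<^sup>(\<^sup>j\<^sup>)\<close>.
\<close>

definition adm_cosets ::
  "('w, 'z) monoid_scheme \<Rightarrow> 'w set \<Rightarrow> 'w set \<Rightarrow> 'w set \<Rightarrow> 'w set set" where
  "adm_cosets W S P J = {generate W (S - J) #>\<^bsub>W\<^esub> x | x.
     x \<in> carrier W \<and> (\<forall>j \<in> J. generate W (S - {j}) #>\<^bsub>W\<^esub> x \<subseteq> P)}"

definition C_sub ::
  "('w, 'z) monoid_scheme \<Rightarrow> 'w set \<Rightarrow> ('w \<Rightarrow> ('o, 'm, 'y) abcat_scheme) \<Rightarrow>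
   ('w \<Rightarrow> 'w \<Rightarrow> ('o, 'm, 'o, 'm) func) \<Rightarrow> ('w \<Rightarrow> 'w \<Rightarrow> 'w \<Rightarrow> 'o \<Rightarrow> 'm) \<Rightarrow> 'w set \<Rightarrow> 'w set \<Rightarrow>
   ('w set \<Rightarrow> ('w, 'o, 'm) glue_obj, 'w set \<Rightarrow> ('w, 'o, 'm) glue_arr) cat" where
  "C_sub W S C \<Phi> \<nu> P J = sum_cat (adm_cosets W S P J) (glue_cat W C \<Phi> \<nu>)"

text \<open>
  For \<open>J \<subseteq> K\<close>, the coset of \<open>W\<^bsub>S - J\<^esub>\<close> containing a coset \<open>E\<close> of \<open>W\<^bsub>S - K\<^esub>\<close> is the setwise
  product \<open>W\<^bsub>S - J\<^esub> E\<close>.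
\<close>

definition restr_JK ::
  "('w, 'z) monoid_scheme \<Rightarrow> 'w set \<Rightarrow> 'w set \<Rightarrow> 'w set \<Rightarrow> 'w set \<Rightarrow>
   ('w set \<Rightarrow> ('w, 'o, 'm) glue_obj, 'w set \<Rightarrow> ('w, 'o, 'm) glue_arr,
    'w set \<Rightarrow> ('w, 'o, 'm) glue_obj, 'w set \<Rightarrow> ('w, 'o, 'm) glue_arr) func" where
  "restr_JK W S P J K = \<lparr>
     omap = (\<lambda>A. \<lambda>E \<in> adm_cosets W S P K.
               omap (glue_restr W E) (A (generate W (S - J) <#>\<^bsub>W\<^esub> E))),
     amap = (\<lambda>f. \<lambda>E \<in> adm_cosets W S P K.
               amap (glue_restr W E) (f (generate W (S - J) <#>\<^bsub>W\<^esub> E)))\<rparr>"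

definition restr_J ::
  "('w, 'z) monoid_scheme \<Rightarrow> 'w set \<Rightarrow> 'w set \<Rightarrow> 'w set \<Rightarrow>
   (('w, 'o, 'm) glue_obj, ('w, 'o, 'm) glue_arr,
    'w set \<Rightarrow> ('w, 'o, 'm) glue_obj, 'w set \<Rightarrow> ('w, 'o, 'm) glue_arr) func" where
  "restr_J W S P J = \<lparr>
     omap = (\<lambda>A. \<lambda>E \<in> adm_cosets W S P J. omap (glue_restr W E) A),
     amap = (\<lambda>f. \<lambda>E \<in> adm_cosets W S P J. amap (glue_restr W E) f)\<rparr>"

definition nonempty_subsets :: "'w set \<Rightarrow> 'w set set" where
  "nonempty_subsets S = {J. J \<subseteq> S \<and> J \<noteq> {}}"

definition C_tot ::
  "('w, 'z) monoid_scheme \<Rightarrow> 'w set \<Rightarrow> ('w \<Rightarrow> ('o, 'm, 'y) abcat_scheme) \<Rightarrow>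
   ('w \<Rightarrow> 'w \<Rightarrow> ('o, 'm, 'o, 'm) func) \<Rightarrow> ('w \<Rightarrow> 'w \<Rightarrow> 'w \<Rightarrow> 'o \<Rightarrow> 'm) \<Rightarrow> 'w set \<Rightarrow>
   (('w, 'w set \<Rightarrow> ('w, 'o, 'm) glue_obj, 'w set \<Rightarrow> ('w, 'o, 'm) glue_arr) section_obj,
    ('w, 'w set \<Rightarrow> ('w, 'o, 'm) glue_obj, 'w set \<Rightarrow> ('w, 'o, 'm) glue_arr) section_arr) cat" where
  "C_tot W S C \<Phi> \<nu> P = section_cat (nonempty_subsets S) (C_sub W S C \<Phi> \<nu> P) (restr_JK W S P)"

text \<open>
  Since restricting in two steps is literally the same as restricting once, the canonical
  identifications \<open>j\<^sub>K\<^sup>* A \<cong> j\<^sub>J\<^sub>,\<^sub>K\<^sup>* j\<^sub>J\<^sup>* A\<close> are identity arrows.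
\<close>

definition restr_tot_obj ::
  "('w, 'z) monoid_scheme \<Rightarrow> 'w set \<Rightarrow> ('w \<Rightarrow> ('o, 'm, 'y) abcat_scheme) \<Rightarrow>
   ('w \<Rightarrow> 'w \<Rightarrow> ('o, 'm, 'o, 'm) func) \<Rightarrow> ('w \<Rightarrow> 'w \<Rightarrow> 'w \<Rightarrow> 'o \<Rightarrow> 'm) \<Rightarrow> 'w set \<Rightarrow>
   ('w, 'o, 'm) glue_obj \<Rightarrow>
   ('w, 'w set \<Rightarrow> ('w, 'o, 'm) glue_obj, 'w set \<Rightarrow> ('w, 'o, 'm) glue_arr) section_obj" where
  "restr_tot_obj W S C \<Phi> \<nu> P A =
     (\<lambda>J \<in> nonempty_subsets S. omap (restr_J W S P J) A,
      \<lambda>(J, K) \<in> incl_pairs (nonempty_subsets S).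
        Ident (C_sub W S C \<Phi> \<nu> P K) (omap (restr_J W S P K) A))"

definition restr_tot ::
  "('w, 'z) monoid_scheme \<Rightarrow> 'w set \<Rightarrow> ('w \<Rightarrow> ('o, 'm, 'y) abcat_scheme) \<Rightarrow>
   ('w \<Rightarrow> 'w \<Rightarrow> ('o, 'm, 'o, 'm) func) \<Rightarrow> ('w \<Rightarrow> 'w \<Rightarrow> 'w \<Rightarrow> 'o \<Rightarrow> 'm) \<Rightarrow> 'w set \<Rightarrow>
   (('w, 'o, 'm) glue_obj, ('w, 'o, 'm) glue_arr,
    ('w, 'w set \<Rightarrow> ('w, 'o, 'm) glue_obj, 'w set \<Rightarrow> ('w, 'o, 'm) glue_arr) section_obj,
    ('w, 'w set \<Rightarrow> ('w, 'o, 'm) glue_obj, 'w set \<Rightarrow> ('w, 'o, 'm) glue_arr) section_arr) func" where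
  "restr_tot W S C \<Phi> \<nu> P = \<lparr>
     omap = restr_tot_obj W S C \<Phi> \<nu> P,
     amap = (\<lambda>(X, Y, f).
       (restr_tot_obj W S C \<Phi> \<nu> P X, restr_tot_obj W S C \<Phi> \<nu> P Y,
        \<lambda>J \<in> nonempty_subsets S. amap (restr_J W S P J) (X, Y, f)))\<rparr>"

end

theory Submission
  imports Defs
begin

text \<open>
  Read the elements of \<open>W\<close> as the chambers of the Coxeter complex, \<open>u\<close> and \<open>k u\<close> being adjacent for
  every generator \<open>k\<close>.  Then \<open>P\<^sub>i\<close> is the set of chambers on one side of a wall, a half-space; the
  coset \<open>W\<^sub>S\<^sub>-\<^sub>J u\<close> is the set of chambers around the face of \<open>u\<close> whose vertices have the types in \<open>J\<close>; and
  the cosets that occur in \<open>C\<^sub>J\<close> are the faces all of whose vertices are interior, that is, have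
  their whole star inside the half-space.  An object of \<open>C\<^sub>t\<^sub>o\<^sub>t\<close> is therefore a glued object on the
  star of each interior vertex, with compatible comparisons on the stars of the interior faces, and
  the theorem says that it comes from a glued object on the half-space, unique up to isomorphism.

  Every chamber of the half-space has an interior vertex (\<open>chamber_vertex\<close>), and its interior
  vertices span one face.  This gives the object \<open>A\<^sub>u\<close>, and by transport along the comparisons it
  gives the maps \<open>\<Phi>\<^sub>w A\<^sub>u \<rightarrow> A\<^sub>w\<^sub>u\<close> for which \<open>u\<close> and \<open>w u\<close> share an interior vertex; their independence of
  that vertex uses \<open>W\<^sup>(\<^sup>i\<^sup>) \<inter> W\<^sup>(\<^sup>j\<^sup>) = W\<^bsub>S - {i, j}\<^esub>\<close> (\<open>transported_vertex_independent\<close>).  It remains to extend such a local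
  structure to all pairs \<open>u\<close>, \<open>w u\<close> of chambers of the half-space, and this is forced.  A reduced word
  \<open>k\<^sub>1 \<dots> k\<^sub>n\<close> of \<open>w\<close> is a minimal gallery from \<open>u\<close> to \<open>w u\<close>; it stays in the half-space
  (\<open>half_space_convex\<close>) and each panel that it crosses has an interior vertex (\<open>panel_vertex\<close>), so the
  local structure maps of the \<open>k\<^sub>i\<close> are available, and since \<open>\<nu>\<close> is invertible on reduced products they
  compose to a map \<open>\<Phi>\<^sub>w A\<^sub>u \<rightarrow> A\<^sub>w\<^sub>u\<close>.

  The composite must not depend on the reduced word.  If two reduced words of \<open>w\<close> begin with \<open>k\<close> and
  with \<open>l\<close>, then \<open>w = x c\<close> with lengths adding up, where \<open>x\<close> is the longest element of \<open>W\<^bsub>{k, l}\<^esub>\<close>.  The whole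
  residue \<open>W\<^bsub>{k, l}\<^esub> w u\<close> lies on minimal galleries from \<open>u\<close> to \<open>w u\<close>, hence in the half-space, and therefore
  its face has an interior vertex (\<open>braid_vertex\<close>).  In the star of that vertex both words give the
  structure map of \<open>x\<close>, and induction on the length finishes the argument
  (\<open>word_map_well_defined\<close>).  Associativity now holds for reduced products by construction; the
  remaining case is \<open>k \<cdot> k = 1\<close>, which again takes place in the star of a vertex
  (\<open>glued_map_assoc_gen\<close>).  This yields essential surjectivity.  For morphisms it suffices to check
  compatibility with the structure maps of generators (\<open>glue_homs_from_generators\<close>), which is a
  condition in the stars of interior vertices; so the functor is full and faithful.

  The facts on Coxeter groups that are needed here (exchange, parabolic subgroups, half-spaces) are
  derived from the presentation by counting, modulo 2, how often a gallery crosses each wall.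
\<close>

section \<open>Words, reflections and the exchange property\<close>

text \<open>
  The point of this copy of \<open>coxeter_system\<close> is that \<open>W\<close> becomes the implicit structure, so that the
  group operations need no index.
\<close>

locale coxeter = coxeter_system W S for W :: "('w, 'z) monoid_scheme" (structure) and S
begin

abbreviation len :: "'w \<Rightarrow> nat" where "len \<equiv> cox_length W S"

abbreviation wprod :: "'w list \<Rightarrow> 'w" where "wprod \<equiv> word_prod W"

abbreviation parabolic :: "'w set \<Rightarrow> 'w set" where "parabolic \<equiv> generate W"

lemma wprod_Nil [simp]: "wprod [] = \<one>"
  and wprod_Cons [simp]: "wprod (x # xs) = x \<otimes> wprod xs"
  by (simp_all add: word_prod_def)

lemma gen_in_carrier [simp]: "s \<in> S \<Longrightarrow> s \<in> carrier W"
  using gens_closed by blast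

lemma wprod_closed [simp]: "set ws \<subseteq> S \<Longrightarrow> wprod ws \<in> carrier W"
  by (induction ws) auto

lemma wprod_append: "set us \<subseteq> S \<Longrightarrow> set vs \<subseteq> S \<Longrightarrow> wprod (us @ vs) = wprod us \<otimes> wprod vs"
  by (induction us) (auto simp: m_assoc)

lemma gen_square [simp]: "s \<in> S \<Longrightarrow> s \<otimes> s = \<one>"
  using pow_ord_eq_1[of s] gens_order[of s] by (simp add: numeral_2_eq_2)

lemma gen_inv [simp]: "s \<in> S \<Longrightarrow> inv s = s"
  by (rule inv_equality) auto

lemma gen_cancel [simp]: "s \<in> S \<Longrightarrow> x \<in> carrier W \<Longrightarrow> s \<otimes> (s \<otimes> x) = x"
  by (simp add: m_assoc[symmetric])

lemma mult_inv_cancel [simp]: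
  assumes "g \<in> carrier W" "x \<in> carrier W"
  shows "g \<otimes> (inv g \<otimes> x) = x" and "inv g \<otimes> (g \<otimes> x) = x"
  using assms by (simp_all add: m_assoc[symmetric])

lemma inv_wprod: "set ws \<subseteq> S \<Longrightarrow> inv (wprod ws) = wprod (rev ws)"
  by (induction ws) (auto simp: wprod_append inv_mult_group)

lemma parabolic_eq_words:
  assumes "K \<subseteq> S"
  shows "parabolic K = wprod ` lists K"
proof
  have "wprod ws \<in> parabolic K" if "ws \<in> lists K" for ws
    using that by (induction ws) (auto intro: generate.intros)
  then show "wprod ` lists K \<subseteq> parabolic K" by blast
  show "parabolic K \<subseteq> wprod ` lists K"
  proof
    fix x assume "x \<in> parabolic K"
    then show "x \<in> wprod ` lists K"
    proof (induction x rule: generate.induct)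
      case one
      then show ?case by (auto intro!: image_eqI[of _ _ "[]"])
    next
      case (incl h)
      then show ?case using assms by (auto intro!: image_eqI[of _ _ "[h]"])
    next
      case (inv h)
      then show ?case using assms by (auto intro!: image_eqI[of _ _ "[h]"])
    next
      case (eng h1 h2)
      then obtain us vs where "set us \<subseteq> K" "h1 = wprod us" "set vs \<subseteq> K" "h2 = wprod vs"
        by (auto simp: in_lists_conv_set)
      then show ?case using assms
        by (intro image_eqI[of _ _ "us @ vs"]) (auto simp: wprod_append)
    qed
  qed
qed

lemma word_exists: "w \<in> carrier W \<Longrightarrow> \<exists>ws. set ws \<subseteq> S \<and> wprod ws = w"
  using parabolic_eq_words[of S] gens_generate by (auto simp: in_lists_conv_set subset_iff)

lemma len_wprod_le: "set ws \<subseteq> S \<Longrightarrow> len (wprod ws) \<le> length ws"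
  unfolding cox_length_def by (rule Least_le) blast

lemma reduced_word_exists:
  assumes "w \<in> carrier W"
  shows "\<exists>ws. set ws \<subseteq> S \<and> length ws = len w \<and> wprod ws = w"
  unfolding cox_length_def using word_exists[OF assms]
  by (intro LeastI_ex[of "\<lambda>k. \<exists>ws. set ws \<subseteq> S \<and> length ws = k \<and> wprod ws = w"]) blast

lemma len_one [simp]: "len \<one> = 0"
  using len_wprod_le[of "[]"] by simp

lemma len_eq_0: "w \<in> carrier W \<Longrightarrow> len w = 0 \<Longrightarrow> w = \<one>"
  using reduced_word_exists[of w] by auto

lemma len_mult_le: "a \<in> carrier W \<Longrightarrow> b \<in> carrier W \<Longrightarrow> len (a \<otimes> b) \<le> len a + len b"
proof -
  assume "a \<in> carrier W" "b \<in> carrier W"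
  then obtain us vs where "set us \<subseteq> S" "length us = len a" "wprod us = a"
    "set vs \<subseteq> S" "length vs = len b" "wprod vs = b"
    using reduced_word_exists by meson
  then show ?thesis using len_wprod_le[of "us @ vs"] by (simp add: wprod_append)
qed

lemma len_gen_mult_le: "s \<in> S \<Longrightarrow> w \<in> carrier W \<Longrightarrow> len (s \<otimes> w) \<le> Suc (len w)"
  using len_mult_le[of s w] len_wprod_le[of "[s]"] by simp

lemma len_inv: 
  assumes "w \<in> carrier W"
  shows "len (inv w) = len w"
proof -
  have le: "len (inv v) \<le> len v" if v: "v \<in> carrier W" for v
  proof -
    obtain vs where "set vs \<subseteq> S" "length vs = len v" "wprod vs = v"
      using reduced_word_exists[OF v] by blast
    then show ?thesis using len_wprod_le[of "rev vs"] inv_wprod[of vs] by simp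
  qed
  from le[OF assms] le[of "inv w"] assms show ?thesis by simp
qed

text \<open>
  The word \<open>s\<^sub>1 \<dots> s\<^sub>n\<close> is read as a gallery; its entries \<open>s\<^sub>1 \<dots> s\<^sub>i\<^sub>-\<^sub>1 s\<^sub>i s\<^sub>i\<^sub>-\<^sub>1 \<dots> s\<^sub>1\<close> are the reflections in the walls
  that the gallery crosses.
\<close>

fun refls :: "'w list \<Rightarrow> 'w list" where
  "refls [] = []"
| "refls (s # ws) = s # map (\<lambda>t. s \<otimes> t \<otimes> inv s) (refls ws)"

lemma refls_closed: "set ws \<subseteq> S \<Longrightarrow> set (refls ws) \<subseteq> carrier W"
  by (induction ws) auto

lemma refls_append:
  assumes "set us \<subseteq> S" "set vs \<subseteq> S"
  shows "refls (us @ vs) = refls us @ map (\<lambda>t. wprod us \<otimes> t \<otimes> inv (wprod us)) (refls vs)"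
  using assms
proof (induction us)
  case Nil
  then show ?case using refls_closed[of vs] by (auto intro!: map_idI[symmetric])
next
  case (Cons s us)
  then show ?case using refls_closed[of vs] by (auto simp: inv_mult_group m_assoc)
qed

text \<open>
  Multiplication by the reflection of the \<open>i\<close>-th crossing folds the rest of the gallery back, which
  cancels the \<open>i\<close>-th letter.
\<close>

lemma refls_deletion:
  assumes "set ws \<subseteq> S" "t \<in> set (refls ws)"
  shows "\<exists>us x vs. ws = us @ x # vs \<and> t \<otimes> wprod ws = wprod (us @ vs)"
  using assms
proof (induction ws arbitrary: t)
  case (Cons s ws)
  show ?case
  proof (cases "t = s")
    case True
    then show ?thesis using Cons.prems by (auto intro!: exI[of _ "[]"])
  next
    case False
    then obtain t' where t': "t' \<in> set (refls ws)" "t = s \<otimes> t' \<otimes> inv s" using Cons.prems by auto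
    obtain us x vs where u: "ws = us @ x # vs" "t' \<otimes> wprod ws = wprod (us @ vs)"
      using Cons.IH[OF _ t'(1)] Cons.prems by auto
    have "t' \<in> carrier W" using t' refls_closed[of ws] Cons.prems by auto
    then have "t \<otimes> wprod (s # ws) = s \<otimes> (t' \<otimes> wprod ws)"
      using t' Cons.prems by (simp add: m_assoc)
    then have "t \<otimes> wprod (s # ws) = wprod ((s # us) @ vs)" using u by simp
    then show ?thesis using u by (metis append_Cons)
  qed
qed auto

text \<open>
  An odd number of crossings means that the wall of the reflection \<open>t\<close> separates the chamber \<open>1\<close> from
  the end of the gallery.
\<close>

definition refl_parity :: "'w list \<Rightarrow> 'w \<Rightarrow> bool" where
  "refl_parity ws t \<longleftrightarrow> odd (count_list (refls ws) t)"

lemma count_list_conj: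
  assumes "g \<in> carrier W" "t \<in> carrier W" "set xs \<subseteq> carrier W"
  shows "count_list (map (\<lambda>x. g \<otimes> x \<otimes> inv g) xs) t = count_list xs (inv g \<otimes> t \<otimes> g)"
  using assms(3)
proof (induction xs)
  case (Cons x xs)
  have "g \<otimes> x \<otimes> inv g = t \<longleftrightarrow> x = inv g \<otimes> t \<otimes> g"
  proof
    assume "g \<otimes> x \<otimes> inv g = t"
    then show "x = inv g \<otimes> t \<otimes> g" using assms(1) Cons.prems by (auto simp: m_assoc inv_solve_left)
  next
    assume "x = inv g \<otimes> t \<otimes> g"
    then show "g \<otimes> x \<otimes> inv g = t" using assms by (simp add: m_assoc)
  qed
  then show ?case using Cons by auto
qed simp

lemma refl_parity_append:
  assumes "set us \<subseteq> S" "set vs \<subseteq> S" "t \<in> carrier W"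
  shows "refl_parity (us @ vs) t \<longleftrightarrow>
    (refl_parity us t \<noteq> refl_parity vs (inv (wprod us) \<otimes> t \<otimes> wprod us))"
  using assms refls_closed[of vs]
  by (auto simp: refl_parity_def refls_append count_list_conj)

text \<open>
  The \<open>i\<close>-th reflection depends on \<open>i\<close> only modulo the order of \<open>s t\<close>.  A relator has twice that many
  letters, so each of its reflections occurs an even number of times.
\<close>

lemma refls_alternating:
  assumes "s \<in> S" "t \<in> S"
  shows "refls (concat (replicate m [s, t])) = map (\<lambda>i. (s \<otimes> t) [^] i \<otimes> s) [0..<2 * m]"
proof (induction m)
  case (Suc m)
  define g where "g = s \<otimes> t"
  have g: "g \<in> carrier W" "inv g = t \<otimes> s" using assms by (auto simp: g_def inv_mult_group)
  have step: "s \<otimes> (t \<otimes> (g [^] i \<otimes> s) \<otimes> t) \<otimes> s = g [^] (Suc (Suc i)) \<otimes> s" for i :: nat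
  proof -
    have c: "g [^] i \<otimes> g = g \<otimes> g [^] i"
      using g by (metis nat_pow_Suc nat_pow_Suc2)
    have "s \<otimes> (t \<otimes> (g [^] i \<otimes> s) \<otimes> t) \<otimes> s = g \<otimes> g [^] i \<otimes> g \<otimes> s"
      using assms g(1) by (simp add: m_assoc g_def)
    also have "\<dots> = g [^] (Suc (Suc i)) \<otimes> s" using g(1) c by (simp)
    finally show ?thesis .
  qed
  have "[0..<2 * Suc m] = 0 # 1 # map (\<lambda>i. Suc (Suc i)) [0..<2 * m]"
    using map_add_upt[of 2 "2 * m"] by (simp add: upt_conv_Cons numeral_2_eq_2)
  then show ?case
    using Suc assms step g(1) by (auto simp: g_def[symmetric] m_assoc)
qed simp

lemma refl_parity_relator:
  assumes "s \<in> S" "t \<in> S"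
  shows "\<not> refl_parity (concat (replicate (ord (s \<otimes> t)) [s, t])) r"
    and "wprod (concat (replicate (ord (s \<otimes> t)) [s, t])) = \<one>"
proof -
  define m where "m = ord (s \<otimes> t)"
  have m: "(s \<otimes> t) [^] m = \<one>" using assms by (simp add: m_def pow_ord_eq_1)
  have "[0..<2 * m] = [0..<m] @ map (\<lambda>i. i + m) [0..<m]"
    using upt_add_eq_append[of 0 m m] map_add_upt[of m m] by (simp add: mult_2)
  moreover have "(s \<otimes> t) [^] (i + m) = (s \<otimes> t) [^] i" for i
    using m assms by (simp flip: nat_pow_mult)
  ultimately have "refls (concat (replicate m [s, t])) =
      map (\<lambda>i. (s \<otimes> t) [^] i \<otimes> s) [0..<m] @ map (\<lambda>i. (s \<otimes> t) [^] i \<otimes> s) [0..<m]"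
    using assms by (simp add: refls_alternating)
  then show "\<not> refl_parity (concat (replicate (ord (s \<otimes> t)) [s, t])) r"
    by (simp add: refl_parity_def m_def)
  have "wprod (concat (replicate k [s, t])) = (s \<otimes> t) [^] k" for k
  proof (induction k)
    case (Suc k)
    have "(s \<otimes> t) [^] Suc k = s \<otimes> t \<otimes> (s \<otimes> t) [^] k" using assms by (intro nat_pow_Suc2) simp
    then show ?case using Suc assms by (simp add: m_assoc)
  qed simp
  then show "wprod (concat (replicate (ord (s \<otimes> t)) [s, t])) = \<one>" using m by (simp add: m_def)
qed

text \<open>
  The first conjunct makes transitivity usable: \<open>coxeter_equiv\<close> also relates words with letters
  outside \<open>S\<close>, but never to words in \<open>S\<close>.
\<close>

lemma coxeter_equiv_refl_parity:
  assumes "coxeter_equiv W S us vs"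
  shows "(set us \<subseteq> S \<longleftrightarrow> set vs \<subseteq> S) \<and>
    (set us \<subseteq> S \<longrightarrow> (\<forall>t \<in> carrier W. refl_parity us t = refl_parity vs t))"
  using assms
proof (induction rule: coxeter_equiv.induct)
  case (relator s t u v)
  let ?r = "concat (replicate (ord (s \<otimes> t)) [s, t])"
  have r: "set ?r \<subseteq> S" using relator by auto
  have "refl_parity (u @ ?r @ v) x = refl_parity (u @ v) x"
    if "set u \<subseteq> S" "set v \<subseteq> S" "x \<in> carrier W" for x
    using that r refl_parity_relator[OF relator]
    by (simp add: refl_parity_append)
  then show ?case using r by auto
qed auto

lemma refl_parity_well_defined:
  assumes "set us \<subseteq> S" "set vs \<subseteq> S" "wprod us = wprod vs" "t \<in> carrier W"
  shows "refl_parity us t = refl_parity vs t"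
  using coxeter_equiv_refl_parity[OF presentation] assms by blast

lemma refl_parity_deletion:
  assumes "set ws \<subseteq> S" "refl_parity ws t"
  shows "\<exists>us x vs. ws = us @ x # vs \<and> t \<otimes> wprod ws = wprod (us @ vs)"
proof -
  have "count_list (refls ws) t \<noteq> 0" using assms(2) by (metis even_zero refl_parity_def)
  then show ?thesis using refls_deletion[OF assms(1)] by (simp add: count_list_0_iff)
qed

lemma refl_parity_gen_iff:
  assumes "s \<in> S" "set ws \<subseteq> S"
  shows "refl_parity (s # ws) s \<longleftrightarrow> \<not> refl_parity ws s"
  using refl_parity_append[of "[s]" ws s] assms by (simp add: refl_parity_def)

lemma refl_parity_len:
  assumes "s \<in> S" "set ws \<subseteq> S" "refl_parity ws s"
  shows "len (s \<otimes> wprod ws) < len (wprod ws)"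
proof -
  obtain vs where vs: "set vs \<subseteq> S" "length vs = len (wprod ws)" "wprod vs = wprod ws"
    using reduced_word_exists[of "wprod ws"] assms by auto
  then have "refl_parity vs s" using assms refl_parity_well_defined[of vs ws s] by simp
  then obtain xs y ys where "vs = xs @ y # ys" "s \<otimes> wprod vs = wprod (xs @ ys)"
    using refl_parity_deletion vs by blast
  then show ?thesis using vs len_wprod_le[of "xs @ ys"] by simp
qed

text \<open>
  Prefixing \<open>s\<close> to a word flips the parity of the reflection \<open>s\<close>.  So exactly one of \<open>w\<close> and \<open>s w\<close> has
  odd parity, and by deletion that one is the longer of the two.
\<close>

lemma refl_parity_iff_descent:
  assumes "s \<in> S" "set ws \<subseteq> S"
  shows "refl_parity ws s \<longleftrightarrow> len (s \<otimes> wprod ws) < len (wprod ws)"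
  using refl_parity_len[of s ws] refl_parity_len[of s "s # ws"] refl_parity_gen_iff[of s ws] assms
  by auto

lemma left_exchange:
  assumes "s \<in> S" "set ws \<subseteq> S" "len (s \<otimes> wprod ws) < len (wprod ws)"
  shows "\<exists>us x vs. ws = us @ x # vs \<and> s \<otimes> wprod ws = wprod (us @ vs)"
  using refl_parity_deletion refl_parity_iff_descent assms by blast

lemma len_gen_mult_neq: "s \<in> S \<Longrightarrow> w \<in> carrier W \<Longrightarrow> len (s \<otimes> w) \<noteq> len w"
proof -
  assume sw: "s \<in> S" "w \<in> carrier W"
  then obtain ws where ws: "set ws \<subseteq> S" "wprod ws = w" using word_exists by blast
  then show ?thesis
    using refl_parity_iff_descent[of s ws] refl_parity_iff_descent[of s "s # ws"]
      refl_parity_gen_iff[of s ws] sw by auto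
qed

lemma len_gen_mult_cases:
  assumes "s \<in> S" "w \<in> carrier W"
  obtains "len (s \<otimes> w) = Suc (len w)" | "len w = Suc (len (s \<otimes> w))"
  using len_gen_mult_neq[OF assms] len_gen_mult_le[OF assms] len_gen_mult_le[of s "s \<otimes> w"] assms
  by fastforce

lemma len_gen: "s \<in> S \<Longrightarrow> len s = 1"
  using len_gen_mult_cases[of s \<one>] by simp

lemma mult_inv_word: 
  assumes "a \<in> carrier W" "b \<in> carrier W"
  shows "len (inv a \<otimes> b) \<le> len a + len b"
  using len_mult_le[of "inv a" b] assms by (simp add: len_inv)

lemma right_exchange:
  assumes "s \<in> S" "set ws \<subseteq> S" "len (wprod ws \<otimes> s) < len (wprod ws)"
  shows "\<exists>us x vs. ws = us @ x # vs \<and> wprod ws \<otimes> s = wprod (us @ vs)"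
proof -
  \<comment> \<open>inversion reverses words and turns right descents into left descents\<close>
  have i: "inv (wprod ws \<otimes> s) = s \<otimes> wprod (rev ws)"
    using assms by (simp add: inv_mult_group inv_wprod)
  have "len (s \<otimes> wprod (rev ws)) < len (wprod (rev ws))"
    using assms len_inv[of "wprod ws \<otimes> s"] len_inv[of "wprod ws"] by (simp add: i inv_wprod)
  then obtain us x vs where u: "rev ws = us @ x # vs" "s \<otimes> wprod (rev ws) = wprod (us @ vs)"
    using left_exchange[of s "rev ws"] assms by auto
  then have w: "ws = rev vs @ x # rev us" by (simp add: rev_eq_append_conv)
  have "set (us @ vs) \<subseteq> S" using assms(2) w by auto
  moreover have "wprod ws \<otimes> s = inv (wprod (us @ vs))"
    using inv_inv[of "wprod ws \<otimes> s"] i u assms by simp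
  ultimately have "wprod ws \<otimes> s = wprod (rev vs @ rev us)" by (simp add: inv_wprod)
  then show ?thesis using w by blast
qed

end

section \<open>Parabolic subgroups and half-spaces\<close>

context coxeter
begin

lemma parabolic_subgroup: "K \<subseteq> S \<Longrightarrow> subgroup (parabolic K) W"
  using gens_closed by (intro generate_is_subgroup) auto

lemma parabolic_closed [simp]: "K \<subseteq> S \<Longrightarrow> x \<in> parabolic K \<Longrightarrow> x \<in> carrier W"
  using subgroup.mem_carrier[OF parabolic_subgroup] .

lemma parabolic_mult: "K \<subseteq> S \<Longrightarrow> x \<in> parabolic K \<Longrightarrow> y \<in> parabolic K \<Longrightarrow> x \<otimes> y \<in> parabolic K"
  using subgroup.m_closed[OF parabolic_subgroup] .

lemma parabolic_inv: "K \<subseteq> S \<Longrightarrow> x \<in> parabolic K \<Longrightarrow> inv x \<in> parabolic K"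
  using subgroup.m_inv_closed[OF parabolic_subgroup] .

lemma parabolic_gens: "k \<in> K \<Longrightarrow> k \<in> parabolic K"
  by (rule generate.incl)

lemma wprod_parabolic: "K \<subseteq> S \<Longrightarrow> set ws \<subseteq> K \<Longrightarrow> wprod ws \<in> parabolic K"
  using parabolic_eq_words by blast

lemma parabolic_mono: "K \<subseteq> L \<Longrightarrow> parabolic K \<subseteq> parabolic L"
  by (rule mono_generate)

lemma coset_shift:
  assumes "K \<subseteq> S" "x \<in> parabolic K" "u \<in> carrier W"
  shows "parabolic K #> (x \<otimes> u) = parabolic K #> u"
proof -
  have "x \<otimes> u \<in> parabolic K #> u" using assms by (auto simp: r_coset_def)
  then show ?thesis using repr_independence[of "x \<otimes> u" "parabolic K" u] parabolic_subgroup assms by blast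
qed

text \<open>
  Exchange only deletes letters, so a word in \<open>K\<close> can be shortened to a reduced one without leaving \<open>K\<close>.
\<close>

lemma reduced_word_in_parabolic:
  assumes "K \<subseteq> S" "x \<in> parabolic K"
  shows "\<exists>ws. set ws \<subseteq> K \<and> length ws = len x \<and> wprod ws = x"
proof -
  have "\<exists>vs. set vs \<subseteq> K \<and> length vs = len (wprod ws) \<and> wprod vs = wprod ws"
    if "set ws \<subseteq> K" for ws
    using that
  proof (induction ws)
    case (Cons s ws)
    then obtain vs where vs: "set vs \<subseteq> K" "length vs = len (wprod ws)" "wprod vs = wprod ws" by auto
    have s: "s \<in> S" "s \<in> K" and ws: "wprod ws \<in> carrier W" using Cons.prems assms(1) by auto
    show ?case
    proof (rule len_gen_mult_cases[OF s(1) ws])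
      assume "len (s \<otimes> wprod ws) = Suc (len (wprod ws))"
      then show ?thesis using vs s by (intro exI[of _ "s # vs"]) auto
    next
      assume l: "len (wprod ws) = Suc (len (s \<otimes> wprod ws))"
      then obtain us y ys where "vs = us @ y # ys" "s \<otimes> wprod vs = wprod (us @ ys)"
        using left_exchange[of s vs] vs s subset_trans[OF vs(1) assms(1)] by auto
      then show ?thesis using vs l by (intro exI[of _ "us @ ys"]) auto
    qed
  qed (auto intro: exI[of _ "[]"])
  then show ?thesis using assms by (auto simp: parabolic_eq_words in_lists_conv_set subset_iff)
qed

lemma parabolic_gen_iff: "K \<subseteq> S \<Longrightarrow> s \<in> S \<Longrightarrow> s \<in> parabolic K \<longleftrightarrow> s \<in> K"
proof
  assume a: "K \<subseteq> S" "s \<in> S" "s \<in> parabolic K"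
  then obtain ws where "set ws \<subseteq> K" "length ws = 1" "wprod ws = s"
    using reduced_word_in_parabolic[of K s] len_gen[of s] by auto
  then show "s \<in> K" using a(1) by (auto simp: length_Suc_conv)
qed (rule parabolic_gens)

text \<open>
  The first letter of a reduced word is a left descent.  Exchanging it against a word in \<open>K\<close> puts it
  into the subgroup generated by \<open>K\<close>, hence into \<open>K\<close>, and the rest of the word is shorter.
\<close>

lemma reduced_word_letters:
  assumes "K \<subseteq> S" "set ws \<subseteq> S" "wprod ws \<in> parabolic K" "length ws = len (wprod ws)"
  shows "set ws \<subseteq> K"
  using assms(2-4)
proof (induction ws)
  case (Cons s ws)
  define x where "x = wprod (s # ws)"
  have s: "s \<in> S" "s \<otimes> x = wprod ws" and x: "x \<in> parabolic K" "x \<in> carrier W"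
    using Cons.prems by (auto simp: x_def)
  have l: "len (wprod ws) < len x" using len_wprod_le[of ws] Cons.prems by (simp add: x_def)
  obtain vs where vs: "set vs \<subseteq> K" "wprod vs = x"
    using reduced_word_in_parabolic[OF assms(1) x(1)] by blast
  then obtain us y ys where u: "vs = us @ y # ys" "s \<otimes> x = wprod (us @ ys)"
    using left_exchange[of s vs] s l subset_trans[OF vs(1) assms(1)] by auto
  have ws: "wprod ws \<in> parabolic K" using wprod_parabolic[OF assms(1), of "us @ ys"] u vs s by simp
  moreover have "s = wprod ws \<otimes> inv x" using s x by (simp add: s(2)[symmetric] m_assoc)
  ultimately have "s \<in> parabolic K" using parabolic_mult parabolic_inv x assms(1) by simp
  moreover have "length ws = len (wprod ws)"
    using len_gen_mult_le[of s "wprod ws"] len_wprod_le[of ws] Cons.prems by auto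
  ultimately show ?case using Cons ws parabolic_gen_iff s assms(1) by auto
qed simp

text \<open>
  By \<open>reduced_word_letters\<close> one reduced word of \<open>x\<close> avoids all the letters in \<open>J\<close> at once.
\<close>

lemma parabolic_Inter:
  assumes "J \<subseteq> S" "x \<in> carrier W" "\<And>j. j \<in> J \<Longrightarrow> x \<in> parabolic (S - {j})"
  shows "x \<in> parabolic (S - J)"
proof -
  obtain ws where ws: "set ws \<subseteq> S" "length ws = len x" "wprod ws = x"
    using reduced_word_exists[OF assms(2)] by blast
  have "set ws \<subseteq> S - {j}" if "j \<in> J" for j
    using reduced_word_letters[of "S - {j}" ws] ws assms(3)[OF that] by auto
  then have "set ws \<subseteq> S - J" using ws by blast
  then show ?thesis using wprod_parabolic[of "S - J" ws] ws by auto
qed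

lemma parabolic_peel:
  assumes "K \<subseteq> S" "b \<in> parabolic K" "b \<noteq> \<one>"
  obtains k b' where "k \<in> K" "b' \<in> parabolic K" "b = k \<otimes> b'" "len b = Suc (len b')"
proof -
  obtain ws where ws: "set ws \<subseteq> K" "length ws = len b" "wprod ws = b"
    using reduced_word_in_parabolic[OF assms(1,2)] by blast
  then obtain k vs where v: "ws = k # vs" using assms(3) by (cases ws) auto
  have "k \<in> S" "set vs \<subseteq> S" using ws v assms(1) by auto
  then have "len b = Suc (len (wprod vs))"
    using ws v len_wprod_le[of vs] len_gen_mult_le[of k "wprod vs"] assms(1) by auto
  then show ?thesis using that[of k "wprod vs"] ws v wprod_parabolic[OF assms(1), of vs] by auto
qed

lemma parabolic_S: "parabolic S = carrier W"
  by (rule gens_generate)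

lemma peel:
  assumes "b \<in> carrier W" "b \<noteq> \<one>"
  obtains k b' where "k \<in> S" "b' \<in> carrier W" "b = k \<otimes> b'" "len b = Suc (len b')"
  using parabolic_peel[of S b] assms parabolic_S by auto

text \<open>
  If a reduced word of \<open>w\<close> starts with a reduced word of \<open>x'\<close> and \<open>k x'\<close> is longer than \<open>x'\<close>, then the
  letter exchanged for the descent \<open>k\<close> cannot belong to \<open>x'\<close>; so \<open>w\<close> also has a reduced word that
  starts with \<open>k x'\<close>.
\<close>

lemma descents_prefix:
  assumes "K \<subseteq> S" "w \<in> carrier W" "\<And>k. k \<in> K \<Longrightarrow> len (k \<otimes> w) < len w" "x \<in> parabolic K"
  shows "\<exists>c \<in> carrier W. w = x \<otimes> c \<and> len w = len x + len c"
  using assms(4)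
proof (induction "len x" arbitrary: x)
  case 0
  then show ?case using assms(1,2) len_eq_0[of x] by auto
next
  case (Suc n)
  then obtain k x' where k: "k \<in> K" "x' \<in> parabolic K" "x = k \<otimes> x'" "len x = Suc (len x')"
    using parabolic_peel[OF assms(1) Suc.prems] by (metis Zero_not_Suc len_one)
  then obtain c where c: "c \<in> carrier W" "w = x' \<otimes> c" "len w = len x' + len c"
    using Suc.hyps(1)[of x'] Suc.hyps(2) by auto
  obtain xs where xs: "set xs \<subseteq> K" "length xs = len x'" "wprod xs = x'"
    using reduced_word_in_parabolic[OF assms(1) k(2)] by blast
  obtain cs where cs: "set cs \<subseteq> S" "length cs = len c" "wprod cs = c"
    using reduced_word_exists[OF c(1)] by blast
  have xS: "set xs \<subseteq> S" "k \<in> S" "x' \<in> carrier W" using xs assms(1) k by auto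
  have w: "wprod (xs @ cs) = w" using xs cs c xS by (simp add: wprod_append)
  then obtain us y vs where u: "xs @ cs = us @ y # vs" "k \<otimes> w = wprod (us @ vs)"
    using left_exchange[of k "xs @ cs"] xS cs assms(3)[OF k(1)] by auto
  obtain ys where "xs = us @ ys \<and> ys @ cs = y # vs \<or> us = xs @ ys \<and> cs = ys @ y # vs"
    using u(1) by (auto simp: append_eq_append_conv2)
  then consider zs where "xs = us @ y # zs" "vs = zs @ cs" | zs where "us = xs @ zs" "cs = zs @ y # vs"
    by (cases ys) fastforce+
  then show ?case
  proof cases
    case 1
    \<comment> \<open>the deleted letter would shorten \<open>x\<close> itself\<close>
    then have "k \<otimes> x' \<otimes> c = wprod (us @ zs) \<otimes> c"
      using u(2) cs xS c by (simp add: wprod_append m_assoc)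
    then have "k \<otimes> x' = wprod (us @ zs)" using 1 xS c by (auto simp: wprod_append)
    then show ?thesis using len_wprod_le[of "us @ zs"] 1 xs xS k by simp
  next
    case 2
    define d where "d = wprod (zs @ vs)"
    have d: "d \<in> carrier W" "len d < len c" using len_wprod_le[of "zs @ vs"] 2 cs by (auto simp: d_def)
    have "k \<otimes> w = x' \<otimes> d" using u(2) 2 xs xS cs by (simp add: d_def wprod_append m_assoc)
    then have "k \<otimes> (k \<otimes> w) = x \<otimes> d" using xS d k by (simp add: m_assoc)
    then have "w = x \<otimes> d" using xS assms(2) by simp
    moreover have "len w \<le> len x + len d" using calculation len_mult_le[of x d] d k xS by simp
    ultimately show ?thesis using d c k by (intro bexI[of _ d]) auto
  qed
qed

end

locale coxeter_half_space = coxeter W S for W :: "('w, 'z) monoid_scheme" (structure) and S +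
  fixes s
  assumes s_in_S: "s \<in> S"
begin

definition P :: "'w set" where "P = non_descent_set W S s"

lemma P_iff: "v \<in> P \<longleftrightarrow> v \<in> carrier W \<and> len v < len (v \<otimes> s)"
  by (auto simp: P_def non_descent_set_def)

lemma P_closed [simp]: "v \<in> P \<Longrightarrow> v \<in> carrier W"
  by (simp add: P_iff)

lemma len_mult_s:
  assumes "v \<in> carrier W"
  shows "len (v \<otimes> s) = Suc (len v) \<or> len v = Suc (len (v \<otimes> s))"
proof -
  have eq: "len (v \<otimes> s) = len (s \<otimes> inv v)"
    using len_inv[of "v \<otimes> s"] assms s_in_S by (simp add: inv_mult_group)
  show ?thesis
    by (rule len_gen_mult_cases[OF s_in_S inv_closed[OF assms]]) (use assms eq in \<open>auto simp: len_inv\<close>)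
qed

lemma mult_s_in_P_iff: "v \<in> carrier W \<Longrightarrow> v \<otimes> s \<in> P \<longleftrightarrow> v \<notin> P"
  using s_in_S len_mult_s[of v] by (auto simp: P_iff m_assoc)

text \<open>
  A chamber inside the half-space has at most one neighbour outside, its mirror image \<open>v s\<close> in the
  bounding wall.  In algebraic terms: exchange applied to \<open>k v\<close> and its right descent \<open>s\<close> must delete
  the letter \<open>k\<close>, since deleting a letter of \<open>v\<close> would make \<open>v s\<close> shorter than \<open>v\<close>.
\<close>

lemma fold_gen:
  assumes "v \<in> P" "k \<in> S" "k \<otimes> v \<notin> P"
  shows "k \<otimes> v = v \<otimes> s"
proof -
  have v: "v \<in> carrier W" using assms by simp
  have 1: "len (v \<otimes> s) = Suc (len v)" using assms(1) len_mult_s[OF v] by (auto simp: P_iff)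
  have 2: "len (k \<otimes> v) = Suc (len (k \<otimes> v \<otimes> s))"
    using assms v len_mult_s[of "k \<otimes> v"] by (auto simp: P_iff)
  have 3: "len (k \<otimes> v \<otimes> s) = len v"
    using 1 2 len_gen_mult_le[OF assms(2) v] len_gen_mult_le[OF assms(2), of "k \<otimes> v \<otimes> s"]
      assms(2) v s_in_S by (simp add: m_assoc)
  obtain vs where vs: "set vs \<subseteq> S" "length vs = len v" "wprod vs = v"
    using reduced_word_exists[OF v] by blast
  obtain us y ys where u: "k # vs = us @ y # ys" "k \<otimes> v \<otimes> s = wprod (us @ ys)"
    using right_exchange[of s "k # vs"] vs assms(2) s_in_S 2 by auto
  have "us = []"
  proof (rule ccontr)
    assume "us \<noteq> []"
    then obtain zs where z: "us = k # zs" "vs = zs @ y # ys" using u(1) by (auto simp: Cons_eq_append_conv)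
    then have "k \<otimes> (v \<otimes> s) = k \<otimes> wprod (zs @ ys)" using u(2) v assms(2) s_in_S by (simp add: m_assoc)
    then have "v \<otimes> s = wprod (zs @ ys)" using z vs v assms(2) s_in_S by simp
    then show False using len_wprod_le[of "zs @ ys"] 1 vs z by simp
  qed
  then have "k \<otimes> v \<otimes> s = v" using u vs by simp
  then have "k \<otimes> v \<otimes> s \<otimes> s = v \<otimes> s" by simp
  then show ?thesis using v assms(2) s_in_S by (simp add: m_assoc)
qed

text \<open>
  A gallery that leaves the half-space is reflected in the bounding wall from the first crossing on;
  this saves at least one step.  The reflected gallery still has its letters in \<open>K\<close>.
\<close>

lemma fold_gallery:
  assumes "K \<subseteq> S" "u \<in> P" "b \<in> parabolic K" "b \<otimes> u \<notin> P"
  shows "\<exists>b' \<in> parabolic K. len b' < len b \<and> b \<otimes> u = b' \<otimes> u \<otimes> s"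
  using assms(3,4)
proof (induction "len b" arbitrary: b rule: less_induct)
  case less
  have "b \<noteq> \<one>" using less.prems assms(2) by auto
  then obtain k c where k: "k \<in> K" "c \<in> parabolic K" "b = k \<otimes> c" "len b = Suc (len c)"
    using parabolic_peel[OF assms(1) less.prems(1)] by blast
  have cl: "k \<in> S" "c \<in> carrier W" "u \<in> carrier W" using k assms by auto
  show ?case
  proof (cases "c \<otimes> u \<in> P")
    case True
    then have "k \<otimes> (c \<otimes> u) = c \<otimes> u \<otimes> s" using fold_gen k cl less.prems by (simp add: m_assoc)
    then show ?thesis using k cl by (auto simp: m_assoc)
  next
    case False
    then obtain c' where c': "c' \<in> parabolic K" "len c' < len c" "c \<otimes> u = c' \<otimes> u \<otimes> s"
      using less.hyps[of c] k by auto
    then have "b \<otimes> u = k \<otimes> c' \<otimes> u \<otimes> s" using k cl assms(1) s_in_S by (simp add: m_assoc)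
    moreover have "k \<otimes> c' \<in> parabolic K"
      using parabolic_mult[OF assms(1)] parabolic_gens k c' by blast
    moreover have "len (k \<otimes> c') < len b"
      using len_gen_mult_le[of k c'] cl c' assms(1) k by simp
    ultimately show ?thesis by blast
  qed
qed

text \<open>
  If the middle chamber of a minimal gallery were outside, both halves could be shortened by
  reflection, and since the reflection is an involution the shortened halves would fit together.
\<close>

lemma half_space_convex:
  assumes "u \<in> P" "a \<in> carrier W" "b \<in> carrier W" "a \<otimes> b \<otimes> u \<in> P" "len (a \<otimes> b) = len a + len b"
  shows "b \<otimes> u \<in> P"
proof (rule ccontr)
  assume n: "b \<otimes> u \<notin> P"
  have u: "u \<in> carrier W" using assms by simp
  obtain b' where b': "b' \<in> carrier W" "len b' < len b" "b \<otimes> u = b' \<otimes> u \<otimes> s"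
    using fold_gallery[of S u b] assms n parabolic_S by auto
  have "inv a \<otimes> (a \<otimes> b \<otimes> u) = b \<otimes> u" using assms u by (simp add: m_assoc)
  then obtain a' where a': "a' \<in> carrier W" "len a' < len a" "b \<otimes> u = a' \<otimes> (a \<otimes> b \<otimes> u) \<otimes> s"
    using fold_gallery[of S "a \<otimes> b \<otimes> u" "inv a"] assms n parabolic_S by (auto simp: len_inv)
  have "b' \<otimes> u \<otimes> s = a' \<otimes> (a \<otimes> b \<otimes> u) \<otimes> s" using a'(3) b'(3) by simp
  then have "b' \<otimes> (u \<otimes> s) = a' \<otimes> (a \<otimes> b) \<otimes> (u \<otimes> s)"
    using a'(1) b'(1) assms(2,3) u s_in_S by (simp add: m_assoc)
  then have "b' = a' \<otimes> (a \<otimes> b)" using a'(1) b'(1) assms(2,3) u s_in_S by simp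
  then have "inv a' \<otimes> b' = a \<otimes> b" using a' assms by simp
  then show False using mult_inv_word[of a' b'] a' b' assms(5) by simp
qed

text \<open>
  The reflection \<open>t = u s u\<^sup>-\<^sup>1\<close> in the bounding wall fixes a face of \<open>u\<close> iff it lies in the parabolic
  subgroup of that face.  A face with all its chambers inside is not fixed by \<open>t\<close>, so by
  \<open>parabolic_Inter\<close> one of its vertices is not fixed either; and by \<open>fold_gallery\<close> a vertex that
  \<open>t\<close> moves has its whole star inside.
\<close>

lemma coset_in_half_space_vertex:
  assumes "K \<subseteq> S" "u \<in> carrier W" "parabolic K #> u \<subseteq> P"
  shows "\<exists>j \<in> S - K. parabolic (S - {j}) #> u \<subseteq> P"
proof -
  define t where "t = u \<otimes> s \<otimes> inv u"
  have t: "t \<in> carrier W" "t \<otimes> u = u \<otimes> s" using assms(2) s_in_S by (auto simp: t_def m_assoc)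
  have "\<one> \<otimes> u \<in> parabolic K #> u" unfolding r_coset_def using generate.one by blast
  then have u: "u \<in> P" using assms(2,3) by auto
  have "t \<notin> parabolic K"
    using assms(3) mult_s_in_P_iff[OF assms(2)] u t(2) by (auto simp: r_coset_def)
  then obtain j where j: "j \<in> S - K" "t \<notin> parabolic (S - {j})"
    using parabolic_Inter[of "S - K" t] t(1) assms(1) by (auto simp: double_diff)
  have "x \<otimes> u \<in> P" if x: "x \<in> parabolic (S - {j})" for x
  proof (rule ccontr)
    assume "x \<otimes> u \<notin> P"
    then obtain b where b: "b \<in> parabolic (S - {j})" "x \<otimes> u = b \<otimes> u \<otimes> s"
      using fold_gallery[OF _ u x] by blast
    have cl: "b \<in> carrier W" "x \<in> carrier W" using b x by (auto intro: parabolic_closed[of "S - {j}"])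
    have "x \<otimes> u = b \<otimes> t \<otimes> u" using b cl t assms(2) s_in_S by (simp add: m_assoc)
    then have "inv b \<otimes> x = t" using cl t(1) assms(2) by simp
    then show False using parabolic_mult[of "S - {j}" "inv b" x] parabolic_inv[of "S - {j}" b] b x j by auto
  qed
  then show ?thesis using j(1) by (auto simp: r_coset_def)
qed

lemma chamber_vertex:
  assumes "u \<in> P"
  shows "\<exists>j \<in> S. parabolic (S - {j}) #> u \<subseteq> P"
  using coset_in_half_space_vertex[of "{}" u] assms by (auto simp: generate_empty r_coset_def)

lemma panel_vertex:
  assumes "k \<in> S" "u \<in> P" "k \<otimes> u \<in> P"
  shows "\<exists>j \<in> S - {k}. parabolic (S - {j}) #> u \<subseteq> P"
proof -
  have "wprod ws \<in> {\<one>, k}" if "set ws \<subseteq> {k}" for ws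
    using that assms(1) by (induction ws) auto
  then have "parabolic {k} \<subseteq> {\<one>, k}"
    using assms(1) by (auto simp: parabolic_eq_words in_lists_conv_set subset_iff)
  then have "parabolic {k} #> u \<subseteq> P" using assms by (force simp: r_coset_def)
  then show ?thesis
    using coset_in_half_space_vertex[of "{k}" u] assms by simp
qed

end

locale finite_coxeter_half_space = coxeter_half_space W S s
  for W :: "('w, 'z) monoid_scheme" (structure) and S s +
  assumes finite_W: "finite (carrier W)"
begin

text \<open>
  The witness \<open>x\<close> is a longest element of the parabolic subgroup.  By \<open>descents_prefix\<close> every chamber of the
  residue of \<open>w u\<close> lies on a minimal gallery from \<open>u\<close> to \<open>w u\<close>, so convexity puts the residue into the
  half-space.
\<close>

lemma braid_vertex:
  assumes "K \<subseteq> S" "w \<in> carrier W" "\<And>k. k \<in> K \<Longrightarrow> len (k \<otimes> w) < len w" "u \<in> P" "w \<otimes> u \<in> P"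
  obtains x c j where "x \<in> parabolic K" "c \<in> carrier W" "w = x \<otimes> c" "len w = len x + len c"
    "\<And>k. k \<in> K \<Longrightarrow> len (k \<otimes> x) < len x" "j \<in> S - K" "parabolic (S - {j}) #> (c \<otimes> u) \<subseteq> P"
proof -
  have "finite (parabolic K)" using finite_W parabolic_closed[OF assms(1)] by (meson finite_subset subsetI)
  moreover have "parabolic K \<noteq> {}" using generate.one[of W K] by blast
  ultimately have m: "Max (len ` parabolic K) \<in> len ` parabolic K"
    "\<And>y. y \<in> parabolic K \<Longrightarrow> len y \<le> Max (len ` parabolic K)" by simp_all
  then obtain x where x: "x \<in> parabolic K" "\<And>y. y \<in> parabolic K \<Longrightarrow> len y \<le> len x"
    by auto
  have prefix: "\<exists>c \<in> carrier W. w = y \<otimes> c \<and> len w = len y + len c" if "y \<in> parabolic K" for y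
    using descents_prefix[OF assms(1-3) that] .
  obtain c where c: "c \<in> carrier W" "w = x \<otimes> c" "len w = len x + len c" using prefix[OF x(1)] by blast
  have cl: "u \<in> carrier W" "x \<in> carrier W" using assms x(1) by auto
  have d: "len (k \<otimes> x) < len x" if "k \<in> K" for k
  proof -
    have "k \<otimes> x \<in> parabolic K" using that x(1) parabolic_mult[OF assms(1)] parabolic_gens by blast
    then show ?thesis
      using x(2) len_gen_mult_neq[of k x] that assms(1) cl by (auto simp: le_neq_implies_less subset_iff)
  qed
  have "y \<otimes> (w \<otimes> u) \<in> P" if y: "y \<in> parabolic K" for y
  proof -
    have yc: "y \<in> carrier W" using y assms(1) by simp
    obtain e where e: "e \<in> carrier W" "w = inv y \<otimes> e" "len w = len (inv y) + len e"
      using prefix[of "inv y"] parabolic_inv[OF assms(1) y] by blast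
    then have "e \<otimes> u \<in> P" using half_space_convex[of u "inv y" e] assms yc by auto
    then show ?thesis using e yc cl by (simp add: m_assoc)
  qed
  then obtain j where j: "j \<in> S - K" "parabolic (S - {j}) #> (w \<otimes> u) \<subseteq> P"
    using coset_in_half_space_vertex[OF assms(1), of "w \<otimes> u"] assms(5) by (auto simp: r_coset_def)
  have "x \<in> parabolic (S - {j})" using x(1) parabolic_mono[of K "S - {j}"] j(1) assms(1) by blast
  then have "parabolic (S - {j}) #> (w \<otimes> u) = parabolic (S - {j}) #> (c \<otimes> u)"
    using coset_shift[of "S - {j}" x "c \<otimes> u"] c cl by (auto simp: m_assoc)
  then show ?thesis using that x c d j by metis
qed

end

section \<open>Isomorphisms, functors and gluing data\<close>

context category
begin

lemma Hom_Obj: "f \<in> Hom C A B \<Longrightarrow> A \<in> Obj C \<and> B \<in> Obj C"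
  using Dom_closed Cod_closed by (auto simp: Hom_def)

lemma is_isoE:
  assumes "is_iso C f" "f \<in> Hom C A B"
  obtains g where "g \<in> Hom C B A" "Comp C g f = Ident C A" "Comp C f g = Ident C B"
  using assms by (auto simp: is_iso_def Hom_def)

lemma is_isoI:
  assumes "f \<in> Hom C A B" "g \<in> Hom C B A" "Comp C g f = Ident C A" "Comp C f g = Ident C B"
  shows "is_iso C f"
  using assms by (auto simp: is_iso_def Hom_def)

lemma is_iso_Ident: "A \<in> Obj C \<Longrightarrow> is_iso C (Ident C A)"
  using is_isoI[OF Ident_closed Ident_closed] Ident_left[OF Ident_closed] by blast

lemma iso_cancel_right:
  assumes "is_iso C e" "e \<in> Hom C A B" "f \<in> Hom C B D" "g \<in> Hom C B D"
    "Comp C f e = Comp C g e"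
  shows "f = g"
proof -
  obtain i where i: "i \<in> Hom C B A" "Comp C e i = Ident C B" using is_isoE[OF assms(1,2)] by metis
  have "Comp C f (Comp C e i) = Comp C g (Comp C e i)"
    using Comp_assoc[OF i(1) assms(2) assms(3)] Comp_assoc[OF i(1) assms(2) assms(4)] assms(5) by simp
  then show ?thesis using Ident_right[OF assms(3)] Ident_right[OF assms(4)] by (simp add: i(2))
qed

lemma iso_cancel_left:
  assumes "is_iso C e" "e \<in> Hom C B D" "f \<in> Hom C A B" "g \<in> Hom C A B"
    "Comp C e f = Comp C e g"
  shows "f = g"
proof -
  obtain i where i: "i \<in> Hom C D B" "Comp C i e = Ident C B" using is_isoE[OF assms(1,2)] by metis
  have "Comp C (Comp C i e) f = Comp C (Comp C i e) g"
    using Comp_assoc[OF assms(3) assms(2) i(1)] Comp_assoc[OF assms(4) assms(2) i(1)] assms(5) by simp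
  then show ?thesis using Ident_left[OF assms(3)] Ident_left[OF assms(4)] by (simp add: i(2))
qed

end

text \<open>
  Only meaningful for isomorphisms; otherwise an arbitrary arrow.
\<close>

definition inv_arr :: "('o, 'm, 'z) cat_scheme \<Rightarrow> 'm \<Rightarrow> 'm" where
  "inv_arr C f = (SOME g. g \<in> Hom C (Cod C f) (Dom C f) \<and>
     Comp C g f = Ident C (Dom C f) \<and> Comp C f g = Ident C (Cod C f))"

lemma inv_arr:
  assumes "is_iso C f" "f \<in> Hom C A B"
  shows "inv_arr C f \<in> Hom C B A" "Comp C (inv_arr C f) f = Ident C A"
    "Comp C f (inv_arr C f) = Ident C B"
proof -
  have "\<exists>g. g \<in> Hom C (Cod C f) (Dom C f) \<and>
     Comp C g f = Ident C (Dom C f) \<and> Comp C f g = Ident C (Cod C f)"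
    using assms(1) by (auto simp: is_iso_def)
  from someI_ex[OF this] assms(2)
  show "inv_arr C f \<in> Hom C B A" "Comp C (inv_arr C f) f = Ident C A"
    "Comp C f (inv_arr C f) = Ident C B"
    by (auto simp: inv_arr_def Hom_def)
qed

lemma functor_Hom: "is_functor C D F \<Longrightarrow> f \<in> Hom C A B \<Longrightarrow> amap F f \<in> Hom D (omap F A) (omap F B)"
  by (auto simp: is_functor_def dest: category.Hom_Obj)

lemma functor_Obj: "is_functor C D F \<Longrightarrow> A \<in> Obj C \<Longrightarrow> omap F A \<in> Obj D"
  by (auto simp: is_functor_def)

lemma functor_Ident: "is_functor C D F \<Longrightarrow> A \<in> Obj C \<Longrightarrow> amap F (Ident C A) = Ident D (omap F A)"
  by (auto simp: is_functor_def)

lemma functor_Comp: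
  "is_functor C D F \<Longrightarrow> f \<in> Hom C A B \<Longrightarrow> g \<in> Hom C B E \<Longrightarrow>
    amap F (Comp C g f) = Comp D (amap F g) (amap F f)"
  by (auto simp: is_functor_def Hom_def)

lemma functor_iso:
  assumes "is_functor C D F" "is_iso C f" "f \<in> Hom C A B"
  shows "is_iso D (amap F f)"
proof -
  interpret C: category C using assms(1) by (simp add: is_functor_def)
  interpret D: category D using assms(1) by (simp add: is_functor_def)
  obtain g where g: "g \<in> Hom C B A" "Comp C g f = Ident C A" "Comp C f g = Ident C B"
    using C.is_isoE assms by metis
  show ?thesis
    using functor_Hom[OF assms(1)] functor_Comp[OF assms(1) assms(3) g(1)]
      functor_Comp[OF assms(1) g(1) assms(3)] functor_Ident[OF assms(1)] g C.Hom_Obj[OF g(1)] assms(3)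
    by (intro D.is_isoI[of "amap F f" _ _ "amap F g"]) auto
qed

locale coxeter_gluing = coxeter W S + gluing_data W S C \<Phi> \<nu>
  for W :: "('w, 'z) monoid_scheme" (structure) and S
    and C :: "'w \<Rightarrow> ('o, 'm, 'y) abcat_scheme" and \<Phi> \<nu>
begin

abbreviation cmp :: "'m \<Rightarrow> 'w \<Rightarrow> 'm \<Rightarrow> 'm" ("(_ \<cdot>[_]/ _)" [56, 0, 55] 55) where
  "g \<cdot>[x] f \<equiv> Comp (C x) g f"

abbreviation \<Phi>o :: "'w \<Rightarrow> 'w \<Rightarrow> 'o \<Rightarrow> 'o" where "\<Phi>o w u \<equiv> omap (\<Phi> w u)"

abbreviation \<Phi>a :: "'w \<Rightarrow> 'w \<Rightarrow> 'm \<Rightarrow> 'm" where "\<Phi>a w u \<equiv> amap (\<Phi> w u)"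

lemma Phi_functor: "w \<in> carrier W \<Longrightarrow> u \<in> carrier W \<Longrightarrow> is_functor (C u) (C (w \<otimes> u)) (\<Phi> w u)"
  using Phi_right_exact by (simp add: right_exact_def)

lemma cat: "u \<in> carrier W \<Longrightarrow> category (C u)"
  using Phi_functor[of \<one> u] by (simp add: is_functor_def)

lemmas comp_hom = category.Comp_closed[OF cat]
  and comp_assoc = category.Comp_assoc[OF cat]
  and id_left = category.Ident_left[OF cat]
  and id_right = category.Ident_right[OF cat]
  and id_hom = category.Ident_closed[OF cat]
  and Phi_obj = functor_Obj[OF Phi_functor]
  and Phi_hom = functor_Hom[OF Phi_functor]
  and Phi_comp = functor_Comp[OF Phi_functor]
  and Phi_ident = functor_Ident[OF Phi_functor]

text \<open>
  The facts about \<open>\<nu>\<close> are restated with products bracketed to the right, so that iterated structure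
  maps have literally equal targets.
\<close>

lemma nu_hom:
  assumes "w \<in> carrier W" "w' \<in> carrier W" "x \<in> carrier W" "A \<in> Obj (C x)"
  shows "\<nu> w w' x A \<in> Hom (C (w \<otimes> (w' \<otimes> x))) (\<Phi>o w (w' \<otimes> x) (\<Phi>o w' x A)) (\<Phi>o (w \<otimes> w') x A)"
  using nu_nat_trans[of w w' x] assms by (simp add: is_nat_trans_def comp_func_def m_assoc)

lemma nu_natural:
  assumes "w \<in> carrier W" "w' \<in> carrier W" "x \<in> carrier W" "f \<in> Hom (C x) A B"
  shows "\<nu> w w' x B \<cdot>[w \<otimes> (w' \<otimes> x)] \<Phi>a w (w' \<otimes> x) (\<Phi>a w' x f) =
    \<Phi>a (w \<otimes> w') x f \<cdot>[w \<otimes> (w' \<otimes> x)] \<nu> w w' x A"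
  using nu_nat_trans[of w w' x] assms by (auto simp: is_nat_trans_def comp_func_def m_assoc Hom_def)

lemma nu_associative:
  assumes "w \<in> carrier W" "w' \<in> carrier W" "w'' \<in> carrier W" "x \<in> carrier W" "A \<in> Obj (C x)"
  shows "\<nu> (w \<otimes> w') w'' x A \<cdot>[w \<otimes> (w' \<otimes> (w'' \<otimes> x))] \<nu> w w' (w'' \<otimes> x) (\<Phi>o w'' x A) =
    \<nu> w (w' \<otimes> w'') x A \<cdot>[w \<otimes> (w' \<otimes> (w'' \<otimes> x))] \<Phi>a w (w' \<otimes> (w'' \<otimes> x)) (\<nu> w' w'' x A)"
  using nu_assoc[OF assms] assms by (simp add: m_assoc)

lemma nu_is_iso:
  assumes "w \<in> carrier W" "w' \<in> carrier W" "x \<in> carrier W" "A \<in> Obj (C x)"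
    "len (w \<otimes> w') = len w + len w'"
  shows "is_iso (C (w \<otimes> (w' \<otimes> x))) (\<nu> w w' x A)"
  using nu_iso[of w w' x] assms by (simp add: is_nat_iso_def m_assoc)

lemma nu_cancel:
  assumes "w \<in> carrier W" "w' \<in> carrier W" "x \<in> carrier W" "A \<in> Obj (C x)"
    "len (w \<otimes> w') = len w + len w'"
    "f \<in> Hom (C (w \<otimes> (w' \<otimes> x))) (\<Phi>o (w \<otimes> w') x A) D" "g \<in> Hom (C (w \<otimes> (w' \<otimes> x))) (\<Phi>o (w \<otimes> w') x A) D"
    "f \<cdot>[w \<otimes> (w' \<otimes> x)] \<nu> w w' x A = g \<cdot>[w \<otimes> (w' \<otimes> x)] \<nu> w w' x A"
  shows "f = g"
  using category.iso_cancel_right[OF cat nu_is_iso nu_hom] assms by simp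

text \<open>
  The step in inductions on the length of \<open>k x\<close>: a relation between maps out of \<open>\<Phi>\<^sub>x \<Phi>\<^sub>b\<close> is carried
  over to \<open>\<Phi>\<^sub>k\<^sub>x \<Phi>\<^sub>b\<close> when all maps involved factor through one map \<open>q\<close> of the generator \<open>k\<close>.  Both sides
  are compared after precomposition with the isomorphism \<open>\<nu> k x\<close>, where associativity and
  naturality of \<open>\<nu>\<close> reduce the claim to the given relation.
\<close>

lemma factor_through_generator:
  assumes cl: "k \<in> carrier W" "x \<in> carrier W" "b \<in> carrier W" "u \<in> carrier W" and A: "A \<in> Obj (C u)"
    and len: "len (k \<otimes> x) = len k + len x"
    and z: "z = k \<otimes> (x \<otimes> (b \<otimes> u))"
    and hL: "L \<in> Hom (C z) (\<Phi>o (k \<otimes> (x \<otimes> b)) u A) D"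
    and hL': "L' \<in> Hom (C (x \<otimes> (b \<otimes> u))) (\<Phi>o (x \<otimes> b) u A) E"
    and hR: "R \<in> Hom (C z) (\<Phi>o (k \<otimes> x) (b \<otimes> u) A') D"
    and hR': "R' \<in> Hom (C (x \<otimes> (b \<otimes> u))) (\<Phi>o x (b \<otimes> u) A') E"
    and hr: "r \<in> Hom (C (b \<otimes> u)) (\<Phi>o b u A) A'"
    and hq: "q \<in> Hom (C z) (\<Phi>o k (x \<otimes> (b \<otimes> u)) E) D"
    and eL: "L \<cdot>[z] \<nu> k (x \<otimes> b) u A = q \<cdot>[z] \<Phi>a k (x \<otimes> (b \<otimes> u)) L'"
    and eR: "R \<cdot>[z] \<nu> k x (b \<otimes> u) A' = q \<cdot>[z] \<Phi>a k (x \<otimes> (b \<otimes> u)) R'"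
    and e: "L' \<cdot>[x \<otimes> (b \<otimes> u)] \<nu> x b u A = R' \<cdot>[x \<otimes> (b \<otimes> u)] \<Phi>a x (b \<otimes> u) r"
  shows "L \<cdot>[z] \<nu> (k \<otimes> x) b u A = R \<cdot>[z] \<Phi>a (k \<otimes> x) (b \<otimes> u) r"
proof -
  have bu: "b \<otimes> u \<in> carrier W" using cl by simp
  define y where "y = x \<otimes> (b \<otimes> u)"
  note hL' = hL'[folded y_def] and hR' = hR'[folded y_def] and hq = hq[folded y_def]
    and eL = eL[folded y_def] and eR = eR[folded y_def] and e = e[folded y_def]
  have zy: "z = k \<otimes> y" "k \<otimes> x \<otimes> (b \<otimes> u) = z" "y \<in> carrier W" "z \<in> carrier W" "k \<otimes> x \<in> carrier W"
    using cl z by (simp_all add: y_def m_assoc)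
  have A': "A' \<in> Obj (C (b \<otimes> u))" using category.Hom_Obj[OF cat[OF bu] hr] by blast
  define n1 where "n1 = \<nu> k x (b \<otimes> u) (\<Phi>o b u A)"
  define n2 where "n2 = \<nu> (k \<otimes> x) b u A"
  define n3 where "n3 = \<nu> x b u A"
  define n4 where "n4 = \<nu> k (x \<otimes> b) u A"
  define n5 where "n5 = \<nu> k x (b \<otimes> u) A'"
  have h1: "n1 \<in> Hom (C z) (\<Phi>o k y (\<Phi>o x (b \<otimes> u) (\<Phi>o b u A))) (\<Phi>o (k \<otimes> x) (b \<otimes> u) (\<Phi>o b u A))"
    using nu_hom[OF cl(1,2) bu Phi_obj[OF cl(3,4) A]] by (simp add: n1_def zy y_def)
  have h2: "n2 \<in> Hom (C z) (\<Phi>o (k \<otimes> x) (b \<otimes> u) (\<Phi>o b u A)) (\<Phi>o (k \<otimes> (x \<otimes> b)) u A)"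
    using cl A nu_hom[of "k \<otimes> x" b u A] by (simp add: n2_def z m_assoc)
  have h3: "n3 \<in> Hom (C y) (\<Phi>o x (b \<otimes> u) (\<Phi>o b u A)) (\<Phi>o (x \<otimes> b) u A)"
    using nu_hom[OF cl(2,3,4) A] by (simp add: n3_def y_def)
  have h4: "n4 \<in> Hom (C z) (\<Phi>o k y (\<Phi>o (x \<otimes> b) u A)) (\<Phi>o (k \<otimes> (x \<otimes> b)) u A)"
    using cl A nu_hom[of k "x \<otimes> b" u A] by (simp add: n4_def z y_def m_assoc)
  have h5: "n5 \<in> Hom (C z) (\<Phi>o k y (\<Phi>o x (b \<otimes> u) A')) (\<Phi>o (k \<otimes> x) (b \<otimes> u) A')"
    using nu_hom[OF cl(1,2) bu A'] by (simp add: n5_def zy y_def)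
  have pk: "\<Phi>a k y f \<in> Hom (C z) (\<Phi>o k y F) (\<Phi>o k y G)" if "f \<in> Hom (C y) F G" for f F G
    using Phi_hom[OF cl(1) zy(3) that] by (simp add: zy(1))
  have hkx: "\<Phi>a (k \<otimes> x) (b \<otimes> u) r \<in> Hom (C z) (\<Phi>o (k \<otimes> x) (b \<otimes> u) (\<Phi>o b u A)) (\<Phi>o (k \<otimes> x) (b \<otimes> u) A')"
    using Phi_hom[OF zy(5) bu hr] zy(2) by simp
  have hx: "\<Phi>a x (b \<otimes> u) r \<in> Hom (C y) (\<Phi>o x (b \<otimes> u) (\<Phi>o b u A)) (\<Phi>o x (b \<otimes> u) A')"
    using Phi_hom[OF cl(2) bu hr] by (simp add: y_def)
  have assoc: "n2 \<cdot>[z] n1 = n4 \<cdot>[z] \<Phi>a k y n3"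
    using nu_associative[OF cl A] by (simp add: n1_def n2_def n3_def n4_def z y_def)
  have nat: "\<Phi>a (k \<otimes> x) (b \<otimes> u) r \<cdot>[z] n1 = n5 \<cdot>[z] \<Phi>a k y (\<Phi>a x (b \<otimes> u) r)"
    using nu_natural[OF cl(1,2) bu hr] by (simp add: n1_def n5_def z y_def)
  have "(L \<cdot>[z] n2) \<cdot>[z] n1 = (L \<cdot>[z] n4) \<cdot>[z] \<Phi>a k y n3"
    using comp_assoc[OF zy(4) h1 h2 hL] comp_assoc[OF zy(4) pk[OF h3] h4 hL] assoc by simp
  also have "\<dots> = q \<cdot>[z] \<Phi>a k y (L' \<cdot>[y] n3)"
    using eL comp_assoc[OF zy(4) pk[OF h3] pk[OF hL'] hq] Phi_comp[OF cl(1) zy(3) h3 hL']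
    by (simp add: zy(1)[symmetric] n4_def)
  also have "\<dots> = q \<cdot>[z] \<Phi>a k y (R' \<cdot>[y] \<Phi>a x (b \<otimes> u) r)"
    using e by (simp add: n3_def)
  also have "\<dots> = (R \<cdot>[z] n5) \<cdot>[z] \<Phi>a k y (\<Phi>a x (b \<otimes> u) r)"
    using eR comp_assoc[OF zy(4) pk[OF hx] pk[OF hR'] hq] Phi_comp[OF cl(1) zy(3) hx hR']
    by (simp add: zy(1)[symmetric] n5_def)
  also have "\<dots> = (R \<cdot>[z] \<Phi>a (k \<otimes> x) (b \<otimes> u) r) \<cdot>[z] n1"
    using comp_assoc[OF zy(4) h1 hkx hR] comp_assoc[OF zy(4) pk[OF hx] h5 hR] nat by simp
  finally have "L \<cdot>[z] n2 = R \<cdot>[z] \<Phi>a (k \<otimes> x) (b \<otimes> u) r"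
    using nu_cancel[OF cl(1,2) bu Phi_obj[OF cl(3,4) A] len,
        of "L \<cdot>[z] n2" D "R \<cdot>[z] \<Phi>a (k \<otimes> x) (b \<otimes> u) r"]
      comp_hom[OF zy(4) h2 hL] comp_hom[OF zy(4) hkx hR]
    by (simp add: n1_def z[symmetric])
  then show ?thesis by (simp add: n2_def)
qed

end

section \<open>Extending structure maps from the stars of interior vertices\<close>

locale glued_half_space = coxeter_gluing W S C \<Phi> \<nu> + finite_coxeter_half_space W S s
  for W :: "('w, 'z) monoid_scheme" (structure) and S s
    and C :: "'w \<Rightarrow> ('o, 'm, 'y) abcat_scheme" and \<Phi> \<nu>
begin

text \<open>
  The pairs \<open>(w, u)\<close> for which \<open>u\<close> and \<open>w u\<close> lie in the star of a common interior vertex.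
\<close>

definition local_pair :: "'w \<Rightarrow> 'w \<Rightarrow> bool" where
  "local_pair w u \<longleftrightarrow> u \<in> carrier W \<and>
    (\<exists>j \<in> S. w \<in> parabolic (S - {j}) \<and> parabolic (S - {j}) #> u \<subseteq> P)"

lemma coset_memberD:
  "parabolic K #> u \<subseteq> P \<Longrightarrow> w \<in> parabolic K \<Longrightarrow> w \<otimes> u \<in> P"
  by (auto simp: r_coset_def)

lemma coset_base: "u \<in> carrier W \<Longrightarrow> parabolic K #> u \<subseteq> P \<Longrightarrow> u \<in> P"
  using coset_memberD[of K u \<one>] generate.one by force

lemma local_pairD:
  assumes "local_pair w u"
  shows "w \<in> carrier W" "u \<in> P" "w \<otimes> u \<in> P"
proof -
  obtain j where j: "j \<in> S" "w \<in> parabolic (S - {j})" "parabolic (S - {j}) #> u \<subseteq> P" "u \<in> carrier W"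
    using assms by (auto simp: local_pair_def)
  show "w \<in> carrier W" using j parabolic_closed[of "S - {j}" w] by auto
  show "u \<in> P" using coset_base j by blast
  show "w \<otimes> u \<in> P" using coset_memberD j by blast
qed

lemma local_pair_gen:
  assumes "k \<in> S" "u \<in> P" "k \<otimes> u \<in> P"
  shows "local_pair k u"
proof -
  obtain j where "j \<in> S - {k}" "parabolic (S - {j}) #> u \<subseteq> P" using panel_vertex[OF assms] by blast
  then show ?thesis using parabolic_gens[of k "S - {j}"] assms by (auto simp: local_pair_def)
qed

end

text \<open>
  A family of objects on the half-space whose structure maps are known, and associative, in the star
  of every interior vertex.
\<close>

locale local_gluing = glued_half_space W S s C \<Phi> \<nu>
  for W :: "('w, 'z) monoid_scheme" (structure) and S s
    and C :: "'w \<Rightarrow> ('o, 'm, 'y) abcat_scheme" and \<Phi> \<nu> +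
  fixes B :: "'w \<Rightarrow> 'o" and \<beta> :: "'w \<Rightarrow> 'w \<Rightarrow> 'm"
  assumes B_obj: "u \<in> P \<Longrightarrow> B u \<in> Obj (C u)"
    and beta_hom: "local_pair w u \<Longrightarrow> \<beta> w u \<in> Hom (C (w \<otimes> u)) (\<Phi>o w u (B u)) (B (w \<otimes> u))"
    and beta_one: "u \<in> P \<Longrightarrow> \<beta> \<one> u = Ident (C u) (B u)"
    and beta_assoc: "j \<in> S \<Longrightarrow> u \<in> carrier W \<Longrightarrow> parabolic (S - {j}) #> u \<subseteq> P \<Longrightarrow>
      w \<in> parabolic (S - {j}) \<Longrightarrow> w' \<in> parabolic (S - {j}) \<Longrightarrow>
      \<beta> w (w' \<otimes> u) \<cdot>[w \<otimes> (w' \<otimes> u)] \<Phi>a w (w' \<otimes> u) (\<beta> w' u) =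
      \<beta> (w \<otimes> w') u \<cdot>[w \<otimes> (w' \<otimes> u)] \<nu> w w' u (B u)"
begin

text \<open>
  The composite of the structure maps of the letters along the gallery.  The identification of
  \<open>\<Phi>\<^sub>k \<Phi>\<^sub>w\<close> with \<open>\<Phi>\<^sub>k\<^sub>w\<close> by \<open>\<nu>\<close> has to be inverted, which is why words are required to be reduced below.
\<close>

fun word_map :: "'w list \<Rightarrow> 'w \<Rightarrow> 'm" where
  "word_map [] u = Ident (C u) (B u)"
| "word_map (k # ws) u =
    (\<beta> k (wprod ws \<otimes> u) \<cdot>[k \<otimes> (wprod ws \<otimes> u)] \<Phi>a k (wprod ws \<otimes> u) (word_map ws u))
      \<cdot>[k \<otimes> (wprod ws \<otimes> u)] inv_arr (C (k \<otimes> (wprod ws \<otimes> u))) (\<nu> k (wprod ws) u (B u))"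

text \<open>
  Minimal galleries between two chambers of the half-space.
\<close>

definition adm :: "'w list \<Rightarrow> 'w \<Rightarrow> bool" where
  "adm ws u \<longleftrightarrow> set ws \<subseteq> S \<and> len (wprod ws) = length ws \<and> u \<in> P \<and> wprod ws \<otimes> u \<in> P"

lemma admD: "adm ws u \<Longrightarrow> set ws \<subseteq> S \<and> wprod ws \<in> carrier W \<and> u \<in> P \<and> u \<in> carrier W \<and>
    wprod ws \<otimes> u \<in> P \<and> B u \<in> Obj (C u) \<and> len (wprod ws) = length ws"
  by (auto simp: adm_def B_obj)

lemma adm_append:
  assumes "adm (xs @ ys) u"
  shows "adm ys u" "adm xs (wprod ys \<otimes> u)"
    "len (wprod xs \<otimes> wprod ys) = len (wprod xs) + len (wprod ys)"
proof -
  have a: "set xs \<subseteq> S" "set ys \<subseteq> S" "u \<in> P" "u \<in> carrier W"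
    "wprod (xs @ ys) = wprod xs \<otimes> wprod ys" "len (wprod xs \<otimes> wprod ys) = length xs + length ys"
    "wprod xs \<otimes> wprod ys \<otimes> u \<in> P"
    using assms by (auto simp: adm_def wprod_append)
  have l: "len (wprod xs) = length xs" "len (wprod ys) = length ys"
    using a len_mult_le[of "wprod xs" "wprod ys"] len_wprod_le[of xs] len_wprod_le[of ys] by auto
  then have y: "wprod ys \<otimes> u \<in> P"
    using half_space_convex[of u "wprod xs" "wprod ys"] a by auto
  show "adm ys u" "adm xs (wprod ys \<otimes> u)"
    "len (wprod xs \<otimes> wprod ys) = len (wprod xs) + len (wprod ys)"
    using a l y by (auto simp: adm_def m_assoc)
qed

lemma adm_Cons:
  assumes "adm (k # ws) u"
  shows "k \<in> S" "adm ws u" "local_pair k (wprod ws \<otimes> u)" "len (k \<otimes> wprod ws) = len k + len (wprod ws)"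
proof -
  have "adm ([k] @ ws) u" using assms by simp
  from adm_append[OF this] show "k \<in> S" "adm ws u" "local_pair k (wprod ws \<otimes> u)"
    "len (k \<otimes> wprod ws) = len k + len (wprod ws)"
    using local_pair_gen by (auto simp: adm_def)
qed

lemma word_map_hom:
  assumes "adm ws u"
  shows "word_map ws u \<in> Hom (C (wprod ws \<otimes> u)) (\<Phi>o (wprod ws) u (B u)) (B (wprod ws \<otimes> u))"
  using assms
proof (induction ws)
  case Nil
  then show ?case using admD[OF Nil] by (simp add: Phi_one_obj id_hom)
next
  case (Cons k ws)
  note a = adm_Cons[OF Cons.prems]
  note d = admD[OF a(2)]
  have "\<beta> k (wprod ws \<otimes> u) \<cdot>[k \<otimes> (wprod ws \<otimes> u)] \<Phi>a k (wprod ws \<otimes> u) (word_map ws u) \<in>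
     Hom (C (k \<otimes> (wprod ws \<otimes> u))) (\<Phi>o k (wprod ws \<otimes> u) (\<Phi>o (wprod ws) u (B u))) (B (k \<otimes> (wprod ws \<otimes> u)))"
    using a d comp_hom[OF _ Phi_hom[OF _ _ Cons.IH[OF a(2)]] beta_hom[OF a(3)]] by simp
  moreover have "inv_arr (C (k \<otimes> (wprod ws \<otimes> u))) (\<nu> k (wprod ws) u (B u)) \<in>
     Hom (C (k \<otimes> (wprod ws \<otimes> u))) (\<Phi>o (k \<otimes> wprod ws) u (B u)) (\<Phi>o k (wprod ws \<otimes> u) (\<Phi>o (wprod ws) u (B u)))"
    using a d by (intro inv_arr nu_is_iso nu_hom) auto
  ultimately show ?case using a d by (simp add: m_assoc comp_hom)
qed

lemma word_map_Cons_nu: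
  assumes "adm (k # ws) u"
  shows "word_map (k # ws) u \<cdot>[k \<otimes> (wprod ws \<otimes> u)] \<nu> k (wprod ws) u (B u) =
    \<beta> k (wprod ws \<otimes> u) \<cdot>[k \<otimes> (wprod ws \<otimes> u)] \<Phi>a k (wprod ws \<otimes> u) (word_map ws u)"
proof -
  note a = adm_Cons[OF assms]
  note d = admD[OF a(2)]
  define z where "z = k \<otimes> (wprod ws \<otimes> u)"
  have z: "z \<in> carrier W" using a d by (simp add: z_def)
  have n: "\<nu> k (wprod ws) u (B u) \<in>
     Hom (C z) (\<Phi>o k (wprod ws \<otimes> u) (\<Phi>o (wprod ws) u (B u))) (\<Phi>o (k \<otimes> wprod ws) u (B u))"
    using a d by (simp add: z_def nu_hom)
  have i: "is_iso (C z) (\<nu> k (wprod ws) u (B u))" using a d by (simp add: z_def nu_is_iso)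
  have b: "\<beta> k (wprod ws \<otimes> u) \<cdot>[z] \<Phi>a k (wprod ws \<otimes> u) (word_map ws u) \<in>
     Hom (C z) (\<Phi>o k (wprod ws \<otimes> u) (\<Phi>o (wprod ws) u (B u))) (B z)"
    unfolding z_def
    using a d comp_hom[OF _ Phi_hom[OF _ _ word_map_hom[OF a(2)]] beta_hom[OF a(3)]] by simp
  show ?thesis
    using comp_assoc[OF z n inv_arr(1)[OF i n] b] inv_arr(2)[OF i n] id_right[OF z b]
    by (simp add: z_def[symmetric])
qed

text \<open>
  With \<open>word_map_local\<close> this contracts an initial part of the gallery that lies in one star.
\<close>

lemma word_map_append_nu:
  assumes "adm (xs @ ys) u"
  shows "word_map (xs @ ys) u \<cdot>[wprod xs \<otimes> (wprod ys \<otimes> u)] \<nu> (wprod xs) (wprod ys) u (B u) =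
    word_map xs (wprod ys \<otimes> u) \<cdot>[wprod xs \<otimes> (wprod ys \<otimes> u)]
      \<Phi>a (wprod xs) (wprod ys \<otimes> u) (word_map ys u)"
  using assms
proof (induction xs)
  case Nil
  then have a: "adm ys u" by simp
  note d = admD[OF a] and h = word_map_hom[OF a]
  have o: "wprod ys \<otimes> u \<in> carrier W" using d by simp
  show ?case
    using d h nu_one_left[of "wprod ys" u "B u"] id_right[OF o h] id_left[OF o h]
      Phi_one_arr[OF o, of "word_map ys u"] by (simp add: Hom_def)
next
  case (Cons k xs)
  have ad: "adm (k # (xs @ ys)) u" "adm ((k # xs) @ ys) u" using Cons.prems by auto
  note a = adm_Cons[OF ad(1)] and a' = adm_append[OF ad(2)]
  note a'' = adm_append[OF a(2)]
  note d = admD[OF a(2)] admD[OF a'(1)] admD[OF a'(2)]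
  define x b z where "x = wprod xs" and "b = wprod ys" and "z = k \<otimes> (x \<otimes> (b \<otimes> u))"
  have xb: "wprod (xs @ ys) = x \<otimes> b" using d by (simp add: x_def b_def wprod_append)
  have cl: "k \<in> carrier W" "x \<in> carrier W" "b \<in> carrier W" "u \<in> carrier W" and Bu: "B u \<in> Obj (C u)"
    using a d by (auto simp: x_def b_def)
  have len: "len (k \<otimes> x) = len k + len x" using adm_Cons(4)[OF a'(2)] by (simp add: x_def)
  have hL: "word_map (k # xs @ ys) u \<in> Hom (C z) (\<Phi>o (k \<otimes> (x \<otimes> b)) u (B u)) (B z)"
    using word_map_hom[OF ad(1)] xb cl by (simp add: z_def m_assoc)
  have hL': "word_map (xs @ ys) u \<in> Hom (C (x \<otimes> (b \<otimes> u))) (\<Phi>o (x \<otimes> b) u (B u)) (B (x \<otimes> (b \<otimes> u)))"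
    using word_map_hom[OF a(2)] xb cl by (simp add: m_assoc)
  have hR: "word_map (k # xs) (b \<otimes> u) \<in> Hom (C z) (\<Phi>o (k \<otimes> x) (b \<otimes> u) (B (b \<otimes> u))) (B z)"
    using word_map_hom[OF a'(2)] cl by (simp add: z_def x_def b_def m_assoc)
  have hR': "word_map xs (b \<otimes> u) \<in> Hom (C (x \<otimes> (b \<otimes> u))) (\<Phi>o x (b \<otimes> u) (B (b \<otimes> u))) (B (x \<otimes> (b \<otimes> u)))"
    using word_map_hom[OF a''(2)] by (simp add: x_def b_def)
  have hr: "word_map ys u \<in> Hom (C (b \<otimes> u)) (\<Phi>o b u (B u)) (B (b \<otimes> u))"
    using word_map_hom[OF a'(1)] by (simp add: b_def)
  have hq: "\<beta> k (x \<otimes> (b \<otimes> u)) \<in> Hom (C z) (\<Phi>o k (x \<otimes> (b \<otimes> u)) (B (x \<otimes> (b \<otimes> u)))) (B z)"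
    using beta_hom[OF a(3)] xb cl by (simp add: z_def m_assoc)
  have "word_map (k # xs @ ys) u \<cdot>[z] \<nu> (k \<otimes> x) b u (B u) =
      word_map (k # xs) (b \<otimes> u) \<cdot>[z] \<Phi>a (k \<otimes> x) (b \<otimes> u) (word_map ys u)"
  proof (rule factor_through_generator[OF cl Bu len z_def hL hL' hR hR' hr hq])
    show "word_map (k # xs @ ys) u \<cdot>[z] \<nu> k (x \<otimes> b) u (B u) =
        \<beta> k (x \<otimes> (b \<otimes> u)) \<cdot>[z] \<Phi>a k (x \<otimes> (b \<otimes> u)) (word_map (xs @ ys) u)"
      using word_map_Cons_nu[OF ad(1)] xb cl unfolding z_def by (simp add: m_assoc)
    show "word_map (k # xs) (b \<otimes> u) \<cdot>[z] \<nu> k x (b \<otimes> u) (B (b \<otimes> u)) =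
        \<beta> k (x \<otimes> (b \<otimes> u)) \<cdot>[z] \<Phi>a k (x \<otimes> (b \<otimes> u)) (word_map xs (b \<otimes> u))"
      using word_map_Cons_nu[OF a'(2)] unfolding z_def x_def b_def .
    show "word_map (xs @ ys) u \<cdot>[x \<otimes> (b \<otimes> u)] \<nu> x b u (B u) =
        word_map xs (b \<otimes> u) \<cdot>[x \<otimes> (b \<otimes> u)] \<Phi>a x (b \<otimes> u) (word_map ys u)"
      using Cons.IH[OF a(2)] by (simp add: x_def b_def)
  qed
  moreover have "k \<otimes> x \<otimes> (b \<otimes> u) = z" using cl by (simp add: z_def m_assoc)
  ultimately show ?case by (simp add: x_def b_def)
qed


text \<open>
  In the star of one vertex the associativity of \<open>\<beta>\<close> collapses the composite.
\<close>

lemma word_map_local: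
  assumes "j \<in> S" "parabolic (S - {j}) #> u \<subseteq> P" "set ws \<subseteq> S - {j}" "adm ws u"
  shows "word_map ws u = \<beta> (wprod ws) u"
  using assms(3,4)
proof (induction ws)
  case Nil
  then show ?case using admD[OF Nil(2)] by (simp add: beta_one)
next
  case (Cons k ws)
  note a = adm_Cons[OF Cons.prems(2)]
  note d = admD[OF a(2)]
  have K: "k \<in> parabolic (S - {j})" "wprod ws \<in> parabolic (S - {j})"
    using Cons.prems wprod_parabolic[of "S - {j}" ws] parabolic_gens[of k] by auto
  then have "k \<otimes> wprod ws \<in> parabolic (S - {j})" using parabolic_mult[of "S - {j}"] by auto
  then have "local_pair (k \<otimes> wprod ws) u" using assms(1,2) d by (auto simp: local_pair_def)
  then have h: "\<beta> (k \<otimes> wprod ws) u \<in>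
      Hom (C (k \<otimes> (wprod ws \<otimes> u))) (\<Phi>o (k \<otimes> wprod ws) u (B u)) (B (k \<otimes> (wprod ws \<otimes> u)))"
    using beta_hom[of "k \<otimes> wprod ws" u] a d by (simp add: m_assoc)
  have h': "word_map (k # ws) u \<in>
      Hom (C (k \<otimes> (wprod ws \<otimes> u))) (\<Phi>o (k \<otimes> wprod ws) u (B u)) (B (k \<otimes> (wprod ws \<otimes> u)))"
    using word_map_hom[OF Cons.prems(2)] a d by (simp add: m_assoc)
  have "word_map (k # ws) u \<cdot>[k \<otimes> (wprod ws \<otimes> u)] \<nu> k (wprod ws) u (B u) =
      \<beta> (k \<otimes> wprod ws) u \<cdot>[k \<otimes> (wprod ws \<otimes> u)] \<nu> k (wprod ws) u (B u)"
    using word_map_Cons_nu[OF Cons.prems(2)] beta_assoc[OF assms(1) _ assms(2) K] Cons.IH[OF _ a(2)]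
      Cons.prems d by simp
  then show ?case using nu_cancel[OF _ _ _ _ a(4) h' h] a(1) d by simp
qed

text \<open>
  This is the argument behind Matsumoto's theorem.  By induction each of the two words may be replaced
  by one that begins with a reduced word of the same element \<open>x\<close> of a rank two parabolic subgroup and
  then continues identically; \<open>braid_vertex\<close> places both words of \<open>x\<close> in the star of an interior vertex,
  where they have the same composite.
\<close>

lemma word_map_well_defined:
  assumes "adm ws u" "adm ws' u" "wprod ws = wprod ws'"
  shows "word_map ws u = word_map ws' u"
  using assms
proof (induction "length ws" arbitrary: ws ws' rule: less_induct)
  case less
  note d = admD[OF less.prems(1)] admD[OF less.prems(2)]
  have leq: "length ws = length ws'" using d less.prems(3) by metis
  show ?case
  proof (cases ws)
    case Nil
    then show ?thesis using leq by simp
  next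
    case (Cons k v)
    then obtain l v' where v': "ws' = l # v'" using leq by (cases ws') auto
    define w where "w = wprod ws"
    have w: "w \<in> carrier W" "w \<otimes> u \<in> P" "u \<in> P" "u \<in> carrier W" using d by (auto simp: w_def)
    have kl: "{k, l} \<subseteq> S" "set v \<subseteq> S" "set v' \<subseteq> S" using d Cons v' by auto
    have "w = k \<otimes> wprod v" by (simp add: w_def Cons)
    then have kv1: "k \<otimes> w = wprod v" using kl by simp
    have "w = l \<otimes> wprod v'" by (simp add: w_def less.prems(3) v')
    then have kv2: "l \<otimes> w = wprod v'" using kl by simp
    note kv = kv1 kv2
    have "len (t \<otimes> w) < len w" if "t \<in> {k, l}" for t
      using that kv len_wprod_le[of v] len_wprod_le[of v'] kl d Cons v' leq by (auto simp: w_def)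
    then obtain x c j where x: "x \<in> parabolic {k, l}" and c: "c \<in> carrier W" "w = x \<otimes> c"
      and lw: "len w = len x + len c"
      and desc: "\<And>t. t \<in> {k, l} \<Longrightarrow> len (t \<otimes> x) < len x"
      and j: "j \<in> S - {k, l}" "parabolic (S - {j}) #> (c \<otimes> u) \<subseteq> P"
      using braid_vertex[OF kl(1) w(1) _ w(3) w(2)] by blast
    have xc: "x \<in> carrier W" using parabolic_closed[OF kl(1) x] .
    obtain cs where cs: "set cs \<subseteq> S" "length cs = len c" "wprod cs = c"
      using reduced_word_exists[OF c(1)] by blast
    \<comment> \<open>the value of \<open>word_map\<close> on both words, expressed by \<open>x\<close> and \<open>c\<close> alone\<close>
    have key: "word_map (t # y) u \<cdot>[x \<otimes> (c \<otimes> u)] \<nu> x c u (B u) =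
        \<beta> x (c \<otimes> u) \<cdot>[x \<otimes> (c \<otimes> u)] \<Phi>a x (c \<otimes> u) (word_map cs u)"
      if t: "t \<in> {k, l}" and y: "adm (t # y) u" "t \<otimes> w = wprod y" "length y < length ws" for t y
    proof -
      have tS: "t \<in> S" using t kl by blast
      have tx: "t \<otimes> x \<in> parabolic {k, l}" using parabolic_mult[OF kl(1)] parabolic_gens[OF t] x by blast
      obtain xs where xs: "set xs \<subseteq> {k, l}" "length xs = len (t \<otimes> x)" "wprod xs = t \<otimes> x"
        using reduced_word_in_parabolic[OF kl(1) tx] by blast
      have xsS: "set xs \<subseteq> S" using xs kl by blast
      have lx: "Suc (length xs) = len x"
        using desc[OF t] xs(2) len_gen_mult_le[OF tS, of "t \<otimes> x"] tS xc by simp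
      have px: "wprod (t # xs) = x" using xs tS xc by simp
      have pxc: "wprod (xs @ cs) = wprod y"
        using y(2) c xs cs xsS xc tS by (simp add: wprod_append m_assoc)
      have lxc: "len w = length ((t # xs) @ cs)" using lw lx cs by simp
      have pw: "wprod ((t # xs) @ cs) = w"
        using px c cs tS xsS wprod_append[of "t # xs" cs] by simp
      have ad: "adm ((t # xs) @ cs) u"
        using pw lxc w xsS cs tS by (simp add: adm_def)
      then have "adm (xs @ cs) u" using adm_Cons(2) by simp
      then have e: "word_map y u = word_map (xs @ cs) u"
        using less.hyps[OF y(3) adm_Cons(2)[OF y(1)]] pxc by simp
      then have e': "word_map (t # y) u = word_map ((t # xs) @ cs) u" using pxc by simp
      have "set (t # xs) \<subseteq> S - {j}" using xs t j kl by auto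
      then have "word_map (t # xs) (c \<otimes> u) = \<beta> x (c \<otimes> u)"
        using word_map_local[of j "c \<otimes> u" "t # xs"] j adm_append(2)[OF ad] px cs by auto
      then show ?thesis using word_map_append_nu[OF ad] e' px cs by simp
    qed
    have "word_map ws u \<cdot>[x \<otimes> (c \<otimes> u)] \<nu> x c u (B u) = word_map ws' u \<cdot>[x \<otimes> (c \<otimes> u)] \<nu> x c u (B u)"
      using key[of k v] key[of l v'] less.prems kv Cons v' leq by simp
    moreover have pw: "wprod ws = x \<otimes> c" "wprod ws' = x \<otimes> c" and xcu: "x \<otimes> c \<otimes> u = x \<otimes> (c \<otimes> u)"
      using c xc w(4) less.prems(3) by (simp_all add: w_def m_assoc)
    then have "word_map ws u \<in> Hom (C (x \<otimes> (c \<otimes> u))) (\<Phi>o (x \<otimes> c) u (B u)) (B (x \<otimes> (c \<otimes> u)))"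
      "word_map ws' u \<in> Hom (C (x \<otimes> (c \<otimes> u))) (\<Phi>o (x \<otimes> c) u (B u)) (B (x \<otimes> (c \<otimes> u)))"
      using word_map_hom[OF less.prems(1)] word_map_hom[OF less.prems(2)] pw xcu by simp_all
    ultimately show ?thesis
      using nu_cancel[OF xc c(1) w(4), of "B u"] lw c(2) d by simp
  qed
qed

definition glued_map :: "'w \<Rightarrow> 'w \<Rightarrow> 'm" where
  "glued_map w u = word_map (SOME ws. set ws \<subseteq> S \<and> length ws = len w \<and> wprod ws = w) u"

lemma glued_map_word:
  assumes "adm ws u"
  shows "glued_map (wprod ws) u = word_map ws u"
proof -
  let ?vs = "SOME vs. set vs \<subseteq> S \<and> length vs = len (wprod ws) \<and> wprod vs = wprod ws"
  have "\<exists>vs. set vs \<subseteq> S \<and> length vs = len (wprod ws) \<and> wprod vs = wprod ws"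
    using reduced_word_exists admD[OF assms] by blast
  from someI_ex[OF this] have vs: "set ?vs \<subseteq> S" "length ?vs = len (wprod ws)" "wprod ?vs = wprod ws"
    by blast+
  then have "adm ?vs u" using admD[OF assms] unfolding adm_def by metis
  then show ?thesis unfolding glued_map_def
    using word_map_well_defined[OF _ assms vs(3)] by blast
qed

lemma adm_word_exists:
  assumes "w \<in> carrier W" "u \<in> P" "w \<otimes> u \<in> P"
  shows "\<exists>ws. adm ws u \<and> wprod ws = w"
  using reduced_word_exists[OF assms(1)] assms by (auto simp: adm_def)

lemma glued_map_hom:
  assumes "w \<in> carrier W" "u \<in> P" "w \<otimes> u \<in> P"
  shows "glued_map w u \<in> Hom (C (w \<otimes> u)) (\<Phi>o w u (B u)) (B (w \<otimes> u))"
  using adm_word_exists[OF assms] glued_map_word word_map_hom by metis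

lemma glued_map_one: "u \<in> P \<Longrightarrow> glued_map \<one> u = Ident (C u) (B u)"
  using glued_map_word[of "[]" u] by (simp add: adm_def)

lemma glued_map_local:
  assumes "local_pair w u"
  shows "glued_map w u = \<beta> w u"
proof -
  obtain j where j: "j \<in> S" "w \<in> parabolic (S - {j})" "parabolic (S - {j}) #> u \<subseteq> P"
    using assms by (auto simp: local_pair_def)
  obtain ws where ws: "set ws \<subseteq> S - {j}" "length ws = len w" "wprod ws = w"
    using reduced_word_in_parabolic[OF _ j(2)] by blast
  then have "adm ws u" using local_pairD[OF assms] by (auto simp: adm_def)
  then show ?thesis using glued_map_word word_map_local[OF j(1,3) ws(1)] ws by auto
qed

lemma glued_map_factor:
  assumes "a \<in> carrier W" "b \<in> carrier W" "u \<in> P" "a \<otimes> (b \<otimes> u) \<in> P" "len (a \<otimes> b) = len a + len b"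
  shows "glued_map (a \<otimes> b) u \<cdot>[a \<otimes> (b \<otimes> u)] \<nu> a b u (B u) =
    glued_map a (b \<otimes> u) \<cdot>[a \<otimes> (b \<otimes> u)] \<Phi>a a (b \<otimes> u) (glued_map b u)"
proof -
  have u: "u \<in> carrier W" using assms by simp
  obtain xs ys where x: "set xs \<subseteq> S" "length xs = len a" "wprod xs = a"
    and y: "set ys \<subseteq> S" "length ys = len b" "wprod ys = b"
    using reduced_word_exists assms(1,2) by meson
  have p: "wprod (xs @ ys) = a \<otimes> b" using x y by (simp add: wprod_append)
  then have ad: "adm (xs @ ys) u" using x y assms u by (simp add: adm_def m_assoc)
  show ?thesis
    using word_map_append_nu[OF ad] glued_map_word[OF ad] glued_map_word[OF adm_append(1)[OF ad]]
      glued_map_word[OF adm_append(2)[OF ad]] x y p by simp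
qed

text \<open>
  If \<open>k b\<close> is longer than \<open>b\<close> this is the factorization above.  Otherwise \<open>b = k c\<close> is a reduced product
  and the gallery crosses the panel between \<open>c u\<close> and \<open>k c u\<close> back and forth; in the star of a vertex of
  that panel this amounts to associativity for \<open>k \<cdot> k = 1\<close>.
\<close>

lemma glued_map_assoc_gen:
  assumes "k \<in> S" "b \<in> carrier W" "u \<in> P" "b \<otimes> u \<in> P" "k \<otimes> (b \<otimes> u) \<in> P"
  shows "glued_map k (b \<otimes> u) \<cdot>[k \<otimes> (b \<otimes> u)] \<Phi>a k (b \<otimes> u) (glued_map b u) =
    glued_map (k \<otimes> b) u \<cdot>[k \<otimes> (b \<otimes> u)] \<nu> k b u (B u)"
proof (rule len_gen_mult_cases[OF assms(1,2)])
  assume "len (k \<otimes> b) = Suc (len b)"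
  then show ?thesis using glued_map_factor[of k b u] assms len_gen by simp
next
  assume l: "len b = Suc (len (k \<otimes> b))"
  define c where "c = k \<otimes> b"
  have kc: "k \<in> carrier W" "c \<in> carrier W" "u \<in> carrier W" "b = k \<otimes> c" using assms by (auto simp: c_def)
  have Bu: "B u \<in> Obj (C u)" using assms by (simp add: B_obj)
  have cuP: "c \<otimes> u \<in> P" "k \<otimes> (c \<otimes> u) \<in> P" using assms by (simp_all add: c_def m_assoc)
  have cl: "c \<otimes> u \<in> carrier W" "k \<otimes> (c \<otimes> u) \<in> carrier W" "b \<otimes> u = k \<otimes> (c \<otimes> u)" "k \<otimes> (b \<otimes> u) = c \<otimes> u"
    using kc cuP assms by (simp_all add: m_assoc)
  have len: "len (k \<otimes> c) = len k + len c" using l len_gen[OF assms(1)] assms by (simp add: c_def)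
  define n where "n = \<nu> k c u (B u)"
  define m where "m = \<nu> k k (c \<otimes> u) (\<Phi>o c u (B u))"
  define m' where "m' = \<nu> k k (c \<otimes> u) (B (c \<otimes> u))"
  define p where "p = \<nu> k b u (B u)"
  define f where "f = glued_map k (b \<otimes> u)"
  define g where "g = glued_map b u"
  define h where "h = glued_map k (c \<otimes> u)"
  define e where "e = glued_map c u"
  let ?F = "\<Phi>a k (b \<otimes> u)"
  let ?G = "\<Phi>a k (c \<otimes> u)"
  let ?z = "c \<otimes> u"
  have hn: "n \<in> Hom (C (b \<otimes> u)) (\<Phi>o k (c \<otimes> u) (\<Phi>o c u (B u))) (\<Phi>o b u (B u))"
    using nu_hom[OF kc(1-3) Bu] cl by (simp add: n_def kc(4)[symmetric])
  have hm: "m \<in> Hom (C ?z) (\<Phi>o k (b \<otimes> u) (\<Phi>o k (c \<otimes> u) (\<Phi>o c u (B u)))) (\<Phi>o c u (B u))"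
    using nu_hom[OF kc(1,1) cl(1) Phi_obj[OF kc(2,3) Bu]] cl assms(1) Phi_one_obj[OF cl(1) Phi_obj[OF kc(2,3) Bu]]
    by (simp add: m_def)
  have hm': "m' \<in> Hom (C ?z) (\<Phi>o k (b \<otimes> u) (\<Phi>o k (c \<otimes> u) (B (c \<otimes> u)))) (B (c \<otimes> u))"
    using nu_hom[OF kc(1,1) cl(1) B_obj[OF cuP(1)]] cl assms(1) Phi_one_obj[OF cl(1) B_obj[OF cuP(1)]]
    by (simp add: m'_def)
  have hp: "p \<in> Hom (C ?z) (\<Phi>o k (b \<otimes> u) (\<Phi>o b u (B u))) (\<Phi>o c u (B u))"
    using nu_hom[OF kc(1) assms(2) kc(3) Bu] cl(4) by (simp add: p_def c_def[symmetric])
  have hg: "g \<in> Hom (C (b \<otimes> u)) (\<Phi>o b u (B u)) (B (b \<otimes> u))"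
    using glued_map_hom assms by (simp add: g_def)
  have hf: "f \<in> Hom (C ?z) (\<Phi>o k (b \<otimes> u) (B (b \<otimes> u))) (B ?z)"
    using glued_map_hom[of k "b \<otimes> u"] assms kc(1) cl(4) by (simp add: f_def)
  have hh: "h \<in> Hom (C (b \<otimes> u)) (\<Phi>o k ?z (B ?z)) (B (b \<otimes> u))"
    using glued_map_hom[of k ?z] cuP kc(1) cl(3) by (simp add: h_def)
  have he: "e \<in> Hom (C ?z) (\<Phi>o c u (B u)) (B ?z)"
    using glued_map_hom[of c u] cuP kc assms by (simp add: e_def)
  have bu: "b \<otimes> u \<in> carrier W" using assms by simp
  have pF: "?F x \<in> Hom (C ?z) (\<Phi>o k (b \<otimes> u) A) (\<Phi>o k (b \<otimes> u) A')"
    if "x \<in> Hom (C (b \<otimes> u)) A A'" for x A A'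
    using Phi_hom[OF kc(1) bu that] cl(4) by simp
  have pG: "?G e \<in> Hom (C (b \<otimes> u)) (\<Phi>o k ?z (\<Phi>o c u (B u))) (\<Phi>o k ?z (B ?z))"
    using Phi_hom[OF kc(1) cl(1) he] cl(3) by simp
  have fac: "g \<cdot>[b \<otimes> u] n = h \<cdot>[b \<otimes> u] ?G e"
    using glued_map_factor[OF kc(1,2) assms(3) cuP(2) len] cl(3)
    by (simp add: g_def n_def h_def e_def kc(4)[symmetric])
  \<comment> \<open>crossing the panel and coming back is the identity up to \<open>\<nu>\<close>\<close>
  have loc: "f \<cdot>[?z] ?F h = m'"
  proof -
    obtain j where j: "j \<in> S - {k}" "parabolic (S - {j}) #> ?z \<subseteq> P"
      using panel_vertex[OF assms(1) cuP] by blast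
    have kj: "k \<in> parabolic (S - {j})" using j assms(1) by (auto intro: parabolic_gens)
    have "f = \<beta> k (b \<otimes> u)" "h = \<beta> k ?z"
      using glued_map_local local_pair_gen assms cuP by (auto simp: f_def h_def)
    then have "f \<cdot>[?z] ?F h = \<beta> \<one> ?z \<cdot>[?z] m'"
      using beta_assoc[of j ?z k k] j kj cl assms(1) by (simp add: m'_def)
    then show ?thesis using id_left[OF cl(1) hm'] beta_one[OF cuP(1)] by simp
  qed
  have nat: "m' \<cdot>[?z] ?F (?G e) = e \<cdot>[?z] m"
    using nu_natural[OF kc(1,1) cl(1) he] cl assms(1) Phi_one_arr[OF cl(1), of e] he
    by (simp add: m_def m'_def Hom_def)
  have "\<nu> \<one> c u (B u) = Ident (C ?z) (\<Phi>o c u (B u))"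
    using nu_one_left[OF kc(2,3) Bu] .
  then have assoc: "p \<cdot>[?z] ?F n = m"
    using nu_associative[OF kc(1,1,2,3) Bu] cl assms(1) id_left[OF cl(1) hm]
    by (simp add: p_def n_def m_def kc(4)[symmetric])
  have "(f \<cdot>[?z] ?F g) \<cdot>[?z] ?F n = f \<cdot>[?z] ?F (g \<cdot>[b \<otimes> u] n)"
    using comp_assoc[OF cl(1) pF[OF hn] pF[OF hg] hf] Phi_comp[OF kc(1) bu hn hg] cl(4) by simp
  also have "\<dots> = (f \<cdot>[?z] ?F h) \<cdot>[?z] ?F (?G e)"
    using comp_assoc[OF cl(1) pF[OF pG] pF[OF hh] hf] Phi_comp[OF kc(1) bu pG hh] cl(4) fac by simp
  also have "\<dots> = (e \<cdot>[?z] p) \<cdot>[?z] ?F n"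
    using comp_assoc[OF cl(1) pF[OF hn] hp he] loc nat assoc by simp
  finally have eq: "(f \<cdot>[?z] ?F g) \<cdot>[?z] ?F n = (e \<cdot>[?z] p) \<cdot>[?z] ?F n" .
  have "is_iso (C (b \<otimes> u)) n"
    using nu_is_iso[OF kc(1-3) Bu len] cl(3) by (simp add: n_def)
  then have "is_iso (C ?z) (?F n)"
    using functor_iso[OF Phi_functor[OF kc(1) bu]] hn cl(4) by simp
  then have "f \<cdot>[?z] ?F g = e \<cdot>[?z] p"
    using category.iso_cancel_right[OF cat[OF cl(1)] _ pF[OF hn] comp_hom[OF cl(1) pF[OF hg] hf]
        comp_hom[OF cl(1) hp he] eq] by simp
  then show ?thesis using cl(4) by (simp add: f_def g_def e_def p_def c_def[symmetric])
qed

lemma glued_map_assoc: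
  assumes "a \<in> carrier W" "b \<in> carrier W" "u \<in> P" "b \<otimes> u \<in> P" "a \<otimes> (b \<otimes> u) \<in> P"
  shows "glued_map a (b \<otimes> u) \<cdot>[a \<otimes> (b \<otimes> u)] \<Phi>a a (b \<otimes> u) (glued_map b u) =
    glued_map (a \<otimes> b) u \<cdot>[a \<otimes> (b \<otimes> u)] \<nu> a b u (B u)"
  using assms(1,5)
proof (induction "len a" arbitrary: a)
  case 0
  then have a: "a = \<one>" using len_eq_0 by simp
  have bu: "b \<otimes> u \<in> carrier W" using assms by simp
  have h: "glued_map b u \<in> Hom (C (b \<otimes> u)) (\<Phi>o b u (B u)) (B (b \<otimes> u))"
    using glued_map_hom assms by simp
  show ?case
    using a bu assms h id_left[OF bu h] id_right[OF bu h] nu_one_left[of b u "B u"]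
      glued_map_one[of "b \<otimes> u"] Phi_one_arr[OF bu, of "glued_map b u"]
    by (simp add: B_obj Hom_def)
next
  case (Suc n)
  then obtain k c where k: "k \<in> S" "c \<in> carrier W" "a = k \<otimes> c" "len a = Suc (len c)"
    using peel[of a] by (metis Zero_not_Suc len_one)
  have len: "len (k \<otimes> c) = len k + len c" using k len_gen by simp
  have kc: "k \<in> carrier W" "u \<in> carrier W" "b \<otimes> u \<in> carrier W" "c \<otimes> (b \<otimes> u) \<in> carrier W" using k assms by auto
  define z where "z = k \<otimes> (c \<otimes> (b \<otimes> u))"
  have z: "z \<in> carrier W" "k \<otimes> c \<otimes> (b \<otimes> u) = z" "z \<in> P" "k \<otimes> c \<otimes> b \<otimes> u = z"
    using k kc assms Suc.prems by (auto simp: z_def m_assoc)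
  have cbu: "c \<otimes> (b \<otimes> u) \<in> P"
    using half_space_convex[of "b \<otimes> u" k c] k kc assms z len by simp
  have Bu: "B u \<in> Obj (C u)" using assms by (simp add: B_obj)
  have hL: "glued_map (k \<otimes> (c \<otimes> b)) u \<in> Hom (C z) (\<Phi>o (k \<otimes> (c \<otimes> b)) u (B u)) (B z)"
    using glued_map_hom[of "k \<otimes> (c \<otimes> b)" u] k z assms kc by (simp add: m_assoc z_def)
  have hL': "glued_map (c \<otimes> b) u \<in>
      Hom (C (c \<otimes> (b \<otimes> u))) (\<Phi>o (c \<otimes> b) u (B u)) (B (c \<otimes> (b \<otimes> u)))"
    using glued_map_hom[of "c \<otimes> b" u] k cbu assms kc by (simp add: m_assoc)
  have hR: "glued_map (k \<otimes> c) (b \<otimes> u) \<in> Hom (C z) (\<Phi>o (k \<otimes> c) (b \<otimes> u) (B (b \<otimes> u))) (B z)"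
    using glued_map_hom[of "k \<otimes> c" "b \<otimes> u"] z k kc assms by simp
  have hR': "glued_map c (b \<otimes> u) \<in>
      Hom (C (c \<otimes> (b \<otimes> u))) (\<Phi>o c (b \<otimes> u) (B (b \<otimes> u))) (B (c \<otimes> (b \<otimes> u)))"
    using glued_map_hom[of c "b \<otimes> u"] k cbu assms by simp
  have hq: "glued_map k (c \<otimes> (b \<otimes> u)) \<in> Hom (C z) (\<Phi>o k (c \<otimes> (b \<otimes> u)) (B (c \<otimes> (b \<otimes> u)))) (B z)"
    using glued_map_hom[of k "c \<otimes> (b \<otimes> u)"] z k kc cbu by (simp add: z_def)
  have "glued_map (k \<otimes> (c \<otimes> b)) u \<cdot>[z] \<nu> (k \<otimes> c) b u (B u) =
      glued_map (k \<otimes> c) (b \<otimes> u) \<cdot>[z] \<Phi>a (k \<otimes> c) (b \<otimes> u) (glued_map b u)"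
  proof (rule factor_through_generator[OF kc(1) k(2) assms(2) kc(2) Bu len z_def hL hL' hR hR' _ hq])
    show "glued_map b u \<in> Hom (C (b \<otimes> u)) (\<Phi>o b u (B u)) (B (b \<otimes> u))"
      using glued_map_hom assms by simp
    show "glued_map (k \<otimes> (c \<otimes> b)) u \<cdot>[z] \<nu> k (c \<otimes> b) u (B u) =
        glued_map k (c \<otimes> (b \<otimes> u)) \<cdot>[z] \<Phi>a k (c \<otimes> (b \<otimes> u)) (glued_map (c \<otimes> b) u)"
      using glued_map_assoc_gen[of k "c \<otimes> b" u] k kc assms cbu z by (simp add: z_def m_assoc)
    show "glued_map (k \<otimes> c) (b \<otimes> u) \<cdot>[z] \<nu> k c (b \<otimes> u) (B (b \<otimes> u)) =
        glued_map k (c \<otimes> (b \<otimes> u)) \<cdot>[z] \<Phi>a k (c \<otimes> (b \<otimes> u)) (glued_map c (b \<otimes> u))"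
      using glued_map_factor[OF kc(1) k(2) assms(4) _ len] z by (simp add: z_def)
    show "glued_map (c \<otimes> b) u \<cdot>[c \<otimes> (b \<otimes> u)] \<nu> c b u (B u) =
        glued_map c (b \<otimes> u) \<cdot>[c \<otimes> (b \<otimes> u)] \<Phi>a c (b \<otimes> u) (glued_map b u)"
      using Suc.hyps(1)[of c] Suc.hyps(2) k cbu by simp
  qed
  then show ?case using k kc assms z by (simp add: m_assoc)
qed

lemma glued_object:
  "(restrict B P, restrict (\<lambda>(w, u). glued_map w u) (glue_pairs W P)) \<in> glue_objs W C \<Phi> \<nu> P"
proof -
  have "glued_map w (w' \<otimes> u) \<cdot>[w \<otimes> w' \<otimes> u] \<Phi>a w (w' \<otimes> u) (glued_map w' u) =
     glued_map (w \<otimes> w') u \<cdot>[w \<otimes> w' \<otimes> u] \<nu> w w' u (B u)"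
    if "w \<in> carrier W" "w' \<in> carrier W" "u \<in> P" "w' \<otimes> u \<in> P" "w \<otimes> w' \<otimes> u \<in> P" for w w' u
    using glued_map_assoc[of w w' u] that by (simp add: m_assoc)
  then show ?thesis
    by (auto simp: glue_objs_def glue_pairs_def B_obj glued_map_hom glued_map_one m_assoc[symmetric])
qed

end

section \<open>Glued objects, products of categories and sections\<close>

lemma restrict_eqI: "f \<in> extensional I \<Longrightarrow> (\<And>i. i \<in> I \<Longrightarrow> g i = f i) \<Longrightarrow> restrict g I = f"
  by (rule extensionalityI[of _ I]) auto

lemma is_functorI:
  assumes "category C" "category D"
    and "\<And>A. A \<in> Obj C \<Longrightarrow> omap F A \<in> Obj D"
    and "\<And>f A B. f \<in> Hom C A B \<Longrightarrow> amap F f \<in> Hom D (omap F A) (omap F B)"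
    and "\<And>A. A \<in> Obj C \<Longrightarrow> amap F (Ident C A) = Ident D (omap F A)"
    and "\<And>f g A B E. f \<in> Hom C A B \<Longrightarrow> g \<in> Hom C B E \<Longrightarrow>
      amap F (Comp C g f) = Comp D (amap F g) (amap F f)"
  shows "is_functor C D F"
  using assms by (simp add: is_functor_def) (simp add: Hom_def)

lemma comp_functor:
  assumes "is_functor C D F" "is_functor D E G"
  shows "is_functor C E (comp_func G F)"
proof (rule is_functorI)
  show "category C" "category E" using assms by (auto simp: is_functor_def)
qed (use assms in \<open>auto simp: comp_func_def functor_Obj functor_Ident functor_Comp[OF assms(1)]
    functor_Comp[OF assms(2) functor_Hom[OF assms(1)] functor_Hom[OF assms(1)]]
    intro: functor_Hom\<close>)

lemma id_functor: "category C \<Longrightarrow> is_functor C C id_func"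
  by (rule is_functorI) (auto simp: id_func_def)

text \<open>
  The quasi-inverse \<open>G\<close> sends \<open>Y\<close> to a chosen \<open>X Y\<close> with an isomorphism \<open>e Y\<close> from \<open>F (X Y)\<close> to \<open>Y\<close>.
  All equations between arrows into \<open>X Y\<close> can be tested after applying \<open>F\<close> and composing with \<open>e Y\<close>.
\<close>

lemma fully_faithful_essentially_surjective_equivalence:
  assumes F: "is_functor C D F"
    and full: "\<And>A B g. A \<in> Obj C \<Longrightarrow> B \<in> Obj C \<Longrightarrow> g \<in> Hom D (omap F A) (omap F B) \<Longrightarrow>
      \<exists>f \<in> Hom C A B. amap F f = g"
    and faithful: "\<And>A B f f'. f \<in> Hom C A B \<Longrightarrow> f' \<in> Hom C A B \<Longrightarrow> amap F f = amap F f' \<Longrightarrow> f = f'"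
    and surj: "\<And>Y. Y \<in> Obj D \<Longrightarrow> \<exists>X \<in> Obj C. \<exists>e \<in> Hom D (omap F X) Y. is_iso D e"
  shows "is_equivalence C D F"
proof -
  interpret C: category C using F by (simp add: is_functor_def)
  interpret D: category D using F by (simp add: is_functor_def)
  obtain X e where X: "\<And>Y. Y \<in> Obj D \<Longrightarrow> X Y \<in> Obj C"
    and e: "\<And>Y. Y \<in> Obj D \<Longrightarrow> e Y \<in> Hom D (omap F (X Y)) Y" "\<And>Y. Y \<in> Obj D \<Longrightarrow> is_iso D (e Y)"
    using surj by metis
  \<comment> \<open>an arrow \<open>g\<close> lifts to the unique \<open>f\<close> with \<open>e f = g e\<close>\<close>
  have lift: "\<exists>f \<in> Hom C (X Y) (X Z). Comp D (e Z) (amap F f) = Comp D g (e Y)"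
    if g: "g \<in> Hom D Y Z" for Y Z g
  proof -
    have YZ: "Y \<in> Obj D" "Z \<in> Obj D" using D.Hom_Obj[OF g] by auto
    obtain i where i: "i \<in> Hom D Z (omap F (X Z))" "Comp D (e Z) i = Ident D Z"
      using D.is_isoE[OF e(2)[OF YZ(2)] e(1)[OF YZ(2)]] by metis
    have ge: "Comp D g (e Y) \<in> Hom D (omap F (X Y)) Z" using D.Comp_closed[OF e(1)[OF YZ(1)] g] .
    obtain f where f: "f \<in> Hom C (X Y) (X Z)" "amap F f = Comp D i (Comp D g (e Y))"
      using full[OF X[OF YZ(1)] X[OF YZ(2)] D.Comp_closed[OF ge i(1)]] by auto
    have "Comp D (e Z) (amap F f) = Comp D g (e Y)"
      using D.Comp_assoc[OF ge i(1) e(1)[OF YZ(2)]] i(2) D.Ident_left[OF ge] by (simp add: f)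
    then show ?thesis using f by blast
  qed
  define G where "G = \<lparr>omap = X, amap = (\<lambda>g. SOME f. f \<in> Hom C (X (Dom D g)) (X (Cod D g)) \<and>
    Comp D (e (Cod D g)) (amap F f) = Comp D g (e (Dom D g)))\<rparr>"
  have G: "amap G g \<in> Hom C (X Y) (X Z)" "Comp D (e Z) (amap F (amap G g)) = Comp D g (e Y)"
    if g: "g \<in> Hom D Y Z" for Y Z g
  proof -
    have "\<exists>f. f \<in> Hom C (X (Dom D g)) (X (Cod D g)) \<and>
      Comp D (e (Cod D g)) (amap F f) = Comp D g (e (Dom D g))"
      using lift[OF g] g by (auto simp: Hom_def)
    from someI_ex[OF this] g
    show "amap G g \<in> Hom C (X Y) (X Z)" "Comp D (e Z) (amap F (amap G g)) = Comp D g (e Y)"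
      by (auto simp: G_def Hom_def)
  qed
  have unique: "f = f'"
    if "f \<in> Hom C A (X Z)" "f' \<in> Hom C A (X Z)" "Z \<in> Obj D"
      "Comp D (e Z) (amap F f) = Comp D (e Z) (amap F f')" for f f' A Z
    using D.iso_cancel_left[OF e(2) e(1) functor_Hom[OF F that(1)] functor_Hom[OF F that(2)]] that faithful
    by blast
  have GF: "is_functor D C G"
    unfolding is_functor_def
  proof (intro conjI ballI impI)
    fix Y assume Y: "Y \<in> Obj D"
    then show "omap G Y \<in> Obj C" using X by (simp add: G_def)
    have i: "Ident D Y \<in> Hom D Y Y" using D.Ident_closed Y .
    have XI: "Ident C (X Y) \<in> Hom C (X Y) (X Y)" using C.Ident_closed X Y by simp
    have "Comp D (e Y) (amap F (Ident C (X Y))) = Comp D (e Y) (amap F (amap G (Ident D Y)))"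
      using G(2)[OF i] functor_Ident[OF F X[OF Y]] D.Ident_left[OF e(1)[OF Y]] D.Ident_right[OF e(1)[OF Y]]
      by simp
    then show "amap G (Ident D Y) = Ident C (omap G Y)"
      using unique[OF G(1)[OF i] XI Y] by (simp add: G_def)
  next
    fix Y Z g assume "Y \<in> Obj D" "Z \<in> Obj D" "g \<in> Hom D Y Z"
    then show "amap G g \<in> Hom C (omap G Y) (omap G Z)" using G(1)[of g Y Z] by (simp add: G_def)
  next
    fix f g assume fg: "f \<in> Arr D" "g \<in> Arr D" "Dom D g = Cod D f"
    define Y Z V where "Y = Dom D f" and "Z = Cod D f" and "V = Cod D g"
    have h: "f \<in> Hom D Y Z" "g \<in> Hom D Z V" using fg by (auto simp: Hom_def Y_def Z_def V_def)
    have YZ: "Y \<in> Obj D" "Z \<in> Obj D" "V \<in> Obj D" using D.Hom_Obj h by blast+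
    note gf = D.Comp_closed[OF h]
    note GfG = C.Comp_closed[OF G(1)[OF h(1)] G(1)[OF h(2)]]
    have "Comp D (e V) (amap F (Comp C (amap G g) (amap G f))) = Comp D (Comp D g f) (e Y)"
      using functor_Comp[OF F G(1)[OF h(1)] G(1)[OF h(2)]]
        D.Comp_assoc[OF functor_Hom[OF F G(1)[OF h(1)]] functor_Hom[OF F G(1)[OF h(2)]] e(1)[OF YZ(3)]]
        D.Comp_assoc[OF functor_Hom[OF F G(1)[OF h(1)]] e(1)[OF YZ(2)] h(2)]
        D.Comp_assoc[OF e(1)[OF YZ(1)] h] G(2)[OF h(1)] G(2)[OF h(2)] by simp
    then show "amap G (Comp D g f) = Comp C (amap G g) (amap G f)"
      using unique[OF G(1)[OF gf] GfG YZ(3)] G(2)[OF gf] by simp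
  qed (use C.category_axioms D.category_axioms in auto)
  have "is_nat_trans D D (comp_func F G) id_func e"
    unfolding is_nat_trans_def
  proof (intro conjI ballI)
    show "is_functor D D (comp_func F G)" "is_functor D D id_func"
      using comp_functor[OF GF F] id_functor[OF D.category_axioms] .
    fix A assume "A \<in> Obj D"
    then show "e A \<in> Hom D (omap (comp_func F G) A) (omap id_func A)"
      using e by (simp add: comp_func_def id_func_def G_def)
  next
    fix f assume "f \<in> Arr D"
    then show "Comp D (e (Cod D f)) (amap (comp_func F G) f) = Comp D (amap id_func f) (e (Dom D f))"
      using G(2)[of f "Dom D f" "Cod D f"] by (simp add: comp_func_def id_func_def Hom_def)
  qed
  then have eps: "is_nat_iso D D (comp_func F G) id_func e" using e by (simp add: is_nat_iso_def)
  \<comment> \<open>the unit at \<open>A\<close> is the lift of the inverse of \<open>e (F A)\<close>; it is invertible since \<open>e (F A)\<close> lifts as well\<close>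
  have "\<exists>f \<in> Hom C A (X (omap F A)). Comp D (e (omap F A)) (amap F f) = Ident D (omap F A) \<and> is_iso C f"
    if A: "A \<in> Obj C" for A
  proof -
    have FA: "omap F A \<in> Obj D" using functor_Obj[OF F A] .
    obtain i where i: "i \<in> Hom D (omap F A) (omap F (X (omap F A)))"
      "Comp D i (e (omap F A)) = Ident D (omap F (X (omap F A)))"
      "Comp D (e (omap F A)) i = Ident D (omap F A)"
      using D.is_isoE[OF e(2)[OF FA] e(1)[OF FA]] by metis
    obtain f where f: "f \<in> Hom C A (X (omap F A))" "amap F f = i" using full[OF A X[OF FA] i(1)] by blast
    obtain f' where f': "f' \<in> Hom C (X (omap F A)) A" "amap F f' = e (omap F A)"
      using full[OF X[OF FA] A e(1)[OF FA]] by blast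
    have "Comp C f' f = Ident C A"
      using faithful[OF C.Comp_closed[OF f(1) f'(1)] C.Ident_closed[OF A]]
        functor_Comp[OF F f(1) f'(1)] functor_Ident[OF F A] f f' i by simp
    moreover have "Comp C f f' = Ident C (X (omap F A))"
      using faithful[OF C.Comp_closed[OF f'(1) f(1)] C.Ident_closed[OF X[OF FA]]]
        functor_Comp[OF F f'(1) f(1)] functor_Ident[OF F X[OF FA]] f f' i by simp
    ultimately have "is_iso C f" using C.is_isoI[OF f(1) f'(1)] by simp
    then show ?thesis using f i by auto
  qed
  then obtain \<eta> where \<eta>: "\<And>A. A \<in> Obj C \<Longrightarrow> \<eta> A \<in> Hom C A (X (omap F A))"
    "\<And>A. A \<in> Obj C \<Longrightarrow> Comp D (e (omap F A)) (amap F (\<eta> A)) = Ident D (omap F A)"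
    "\<And>A. A \<in> Obj C \<Longrightarrow> is_iso C (\<eta> A)" by metis
  have "is_nat_trans C C id_func (comp_func G F) \<eta>"
    unfolding is_nat_trans_def
  proof (intro conjI ballI)
    show "is_functor C C (comp_func G F)" "is_functor C C id_func"
      using comp_functor[OF F GF] id_functor[OF C.category_axioms] .
    fix A assume "A \<in> Obj C"
    then show "\<eta> A \<in> Hom C (omap id_func A) (omap (comp_func G F) A)"
      using \<eta> by (simp add: comp_func_def id_func_def G_def)
  next
    fix f assume "f \<in> Arr C"
    then obtain A B where f: "f \<in> Hom C A B" by (auto simp: Hom_def)
    have AB: "A \<in> Obj C" "B \<in> Obj C" "omap F A \<in> Obj D" "omap F B \<in> Obj D"
      using C.Hom_Obj[OF f] functor_Obj[OF F] by auto
    note Ff = functor_Hom[OF F f]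
    note FA = functor_Hom[OF F \<eta>(1)[OF AB(1)]] and FB = functor_Hom[OF F \<eta>(1)[OF AB(2)]]
    note FG = functor_Hom[OF F G(1)[OF Ff]]
    have "Comp D (e (omap F B)) (amap F (Comp C (\<eta> B) f)) = amap F f"
      using functor_Comp[OF F f \<eta>(1)[OF AB(2)]] D.Comp_assoc[OF Ff FB e(1)[OF AB(4)]] \<eta>(2)[OF AB(2)]
        D.Ident_left[OF Ff] by simp
    moreover have "Comp D (e (omap F B)) (amap F (Comp C (amap G (amap F f)) (\<eta> A))) = amap F f"
      using functor_Comp[OF F \<eta>(1)[OF AB(1)] G(1)[OF Ff]] D.Comp_assoc[OF FA FG e(1)[OF AB(4)]]
        D.Comp_assoc[OF FA e(1)[OF AB(3)] Ff] G(2)[OF Ff] \<eta>(2)[OF AB(1)] D.Ident_right[OF Ff] by simp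
    ultimately have "Comp C (\<eta> B) f = Comp C (amap G (amap F f)) (\<eta> A)"
      using unique[OF C.Comp_closed[OF f \<eta>(1)[OF AB(2)]] C.Comp_closed[OF \<eta>(1)[OF AB(1)] G(1)[OF Ff]] AB(4)]
      by simp
    then show "Comp C (\<eta> (Cod C f)) (amap id_func f) = Comp C (amap (comp_func G F) f) (\<eta> (Dom C f))"
      using f by (simp add: comp_func_def id_func_def Hom_def)
  qed
  then have eta: "is_nat_iso C C id_func (comp_func G F) \<eta>" using \<eta> by (simp add: is_nat_iso_def)
  show ?thesis unfolding is_equivalence_def using F GF eta eps by blast
qed

lemma Hom_sum_cat:
  assumes "A \<in> extensional I" "B \<in> extensional I"
  shows "Hom (sum_cat I C) A B = (\<Pi>\<^sub>E i \<in> I. Hom (C i) (A i) (B i))"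
proof -
  have "restrict X I = A \<longleftrightarrow> (\<forall>i \<in> I. X i = A i)" if "A \<in> extensional I" for A X
    using that by (auto simp: fun_eq_iff extensional_def)
  then show ?thesis using assms by (auto simp: Hom_def sum_cat_def PiE_iff extensional_arb[of _ I])
qed

lemma sum_cat_Hom_extensional:
  "f \<in> Hom (sum_cat I C) A B \<Longrightarrow> A \<in> extensional I \<and> B \<in> extensional I"
  by (auto simp: Hom_def sum_cat_def)

lemma Comp_sum_cat: "Comp (sum_cat I C) g f = (\<lambda>i \<in> I. Comp (C i) (g i) (f i))"
  by (simp add: sum_cat_def)

lemma category_sum_cat:
  assumes "\<And>i. i \<in> I \<Longrightarrow> category (C i)"
  shows "category (sum_cat I C)"
proof
  fix f assume "f \<in> Arr (sum_cat I C)"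
  then show "Dom (sum_cat I C) f \<in> Obj (sum_cat I C)" "Cod (sum_cat I C) f \<in> Obj (sum_cat I C)"
    using category.Dom_closed[OF assms] category.Cod_closed[OF assms] by (auto simp: sum_cat_def PiE_iff)
next
  fix A assume "A \<in> Obj (sum_cat I C)"
  then show "Ident (sum_cat I C) A \<in> Hom (sum_cat I C) A A"
    using category.Ident_closed[OF assms] Hom_sum_cat[of A I A C] by (auto simp: sum_cat_def PiE_iff)
next
  fix f g A B D assume fg: "f \<in> Hom (sum_cat I C) A B" "g \<in> Hom (sum_cat I C) B D"
  note e = sum_cat_Hom_extensional[OF fg(1)] sum_cat_Hom_extensional[OF fg(2)]
  show "Comp (sum_cat I C) g f \<in> Hom (sum_cat I C) A D"
    using fg e category.Comp_closed[OF assms] by (auto simp: Hom_sum_cat Comp_sum_cat PiE_iff)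
next
  fix f A B assume f: "f \<in> Hom (sum_cat I C) A B"
  note e = sum_cat_Hom_extensional[OF f]
  have "f \<in> (\<Pi>\<^sub>E i \<in> I. Hom (C i) (A i) (B i))" using f e by (simp add: Hom_sum_cat)
  then have fi: "f i \<in> Hom (C i) (A i) (B i)" if "i \<in> I" for i using that by blast
  have "f \<in> extensional I" using \<open>f \<in> (\<Pi>\<^sub>E i \<in> I. Hom (C i) (A i) (B i))\<close> by (simp add: PiE_iff)
  then show "Comp (sum_cat I C) (Ident (sum_cat I C) B) f = f"
    "Comp (sum_cat I C) f (Ident (sum_cat I C) A) = f"
    using category.Ident_left[OF assms fi] category.Ident_right[OF assms fi]
    by (auto simp: sum_cat_def intro!: restrict_eqI)
next
  fix f g h A B D E
  assume fgh: "f \<in> Hom (sum_cat I C) A B" "g \<in> Hom (sum_cat I C) B D" "h \<in> Hom (sum_cat I C) D E"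
  note e = sum_cat_Hom_extensional[OF fgh(1)] sum_cat_Hom_extensional[OF fgh(2)] sum_cat_Hom_extensional[OF fgh(3)]
  have "Comp (C i) (Comp (C i) (h i) (g i)) (f i) = Comp (C i) (h i) (Comp (C i) (g i) (f i))"
    if "i \<in> I" for i
    using category.Comp_assoc[OF assms[OF that], of "f i" "A i" "B i" "g i" "D i" "h i" "E i"] fgh e that
    by (auto simp: Hom_sum_cat PiE_iff)
  then show "Comp (sum_cat I C) (Comp (sum_cat I C) h g) f = Comp (sum_cat I C) h (Comp (sum_cat I C) g f)"
    by (auto simp: sum_cat_def)
qed

lemma projection_functor:
  assumes "\<And>i. i \<in> I \<Longrightarrow> category (C i)" "i \<in> I"
  shows "is_functor (sum_cat I C) (C i) \<lparr>omap = (\<lambda>A. A i), amap = (\<lambda>f. f i)\<rparr>"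
  using category_sum_cat[of I C] assms by (auto simp: is_functor_def sum_cat_def Hom_def)

lemma functor_to_sum_cat:
  assumes "category D" "\<And>i. i \<in> I \<Longrightarrow> is_functor D (C i) (F i)"
  shows "is_functor D (sum_cat I C) \<lparr>omap = (\<lambda>A. \<lambda>i \<in> I. omap (F i) A), amap = (\<lambda>f. \<lambda>i \<in> I. amap (F i) f)\<rparr>"
proof -
  have "category (sum_cat I C)" using assms by (intro category_sum_cat) (simp add: is_functor_def)
  moreover have "(\<lambda>i \<in> I. amap (F i) f) \<in> Hom (sum_cat I C) (\<lambda>i \<in> I. omap (F i) A) (\<lambda>i \<in> I. omap (F i) B)"
    if "f \<in> Hom D A B" for f A B
    using functor_Hom[OF assms(2) that] by (auto simp: Hom_sum_cat)
  moreover have "(\<lambda>i \<in> I. omap (F i) A) \<in> Obj (sum_cat I C)" if "A \<in> Obj D" for A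
    using functor_Obj[OF assms(2) that] by (auto simp: sum_cat_def)
  moreover have "(\<lambda>i \<in> I. amap (F i) (Ident D A)) = Ident (sum_cat I C) (\<lambda>i \<in> I. omap (F i) A)"
    if "A \<in> Obj D" for A
    using functor_Ident[OF assms(2) that] by (auto simp: sum_cat_def)
  moreover have "(\<lambda>i \<in> I. amap (F i) (Comp D g f)) =
      Comp (sum_cat I C) (\<lambda>i \<in> I. amap (F i) g) (\<lambda>i \<in> I. amap (F i) f)"
    if "f \<in> Arr D" "g \<in> Arr D" "Dom D g = Cod D f" for f g
    using functor_Comp[OF assms(2), of _ f "Dom D f" "Cod D f" g "Cod D g"] that
    by (auto simp: sum_cat_def Hom_def)
  ultimately show ?thesis using assms(1) by (simp add: is_functor_def)
qed

lemma sum_cat_isoI: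
  assumes "\<And>i. i \<in> I \<Longrightarrow> category (C i)" "f \<in> Hom (sum_cat I C) A B" "\<And>i. i \<in> I \<Longrightarrow> is_iso (C i) (f i)"
  shows "is_iso (sum_cat I C) f"
proof -
  note e = sum_cat_Hom_extensional[OF assms(2)]
  have f: "f i \<in> Hom (C i) (A i) (B i)" if "i \<in> I" for i
    using assms(2) e that by (auto simp: Hom_sum_cat)
  have "(\<lambda>i \<in> I. inv_arr (C i) (f i)) \<in> Hom (sum_cat I C) B A"
    using inv_arr(1)[OF assms(3) f] e by (auto simp: Hom_sum_cat)
  moreover have "Comp (sum_cat I C) (\<lambda>i \<in> I. inv_arr (C i) (f i)) f = Ident (sum_cat I C) A"
    "Comp (sum_cat I C) f (\<lambda>i \<in> I. inv_arr (C i) (f i)) = Ident (sum_cat I C) B"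
    using inv_arr(2,3)[OF assms(3) f] by (auto simp: sum_cat_def)
  ultimately show ?thesis
    using category.is_isoI[OF category_sum_cat assms(2)] assms(1) by blast
qed

lemma Hom_section_cat:
  "Hom (section_cat I D R) X Y = {(X, Y, f) | f. X \<in> section_objs I D R \<and> Y \<in> section_objs I D R \<and>
     f \<in> section_homs I D R X Y}"
  by (auto simp: Hom_def section_cat_def)

locale category_diagram =
  fixes I :: "'i set set" and D :: "'i set \<Rightarrow> ('o, 'm, 'z) cat_scheme"
    and R :: "'i set \<Rightarrow> 'i set \<Rightarrow> ('o, 'm, 'o, 'm) func"
  assumes D_cat: "J \<in> I \<Longrightarrow> category (D J)"
    and R_functor: "J \<in> I \<Longrightarrow> K \<in> I \<Longrightarrow> J \<subseteq> K \<Longrightarrow> is_functor (D J) (D K) (R J K)"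
begin

lemma section_objD:
  assumes "X \<in> section_objs I D R"
  shows "J \<in> I \<Longrightarrow> fst X J \<in> Obj (D J)"
    and "(J, K) \<in> incl_pairs I \<Longrightarrow> snd X (J, K) \<in> Hom (D K) (fst X K) (omap (R J K) (fst X J))"
    and "(J, K) \<in> incl_pairs I \<Longrightarrow> is_iso (D K) (snd X (J, K))"
  using assms by (fastforce simp: section_objs_def)+

lemma section_obj_cocycle:
  assumes "X \<in> section_objs I D R" "J \<in> I" "K \<in> I" "L \<in> I" "J \<subseteq> K" "K \<subseteq> L"
  shows "snd X (J, L) = Comp (D L) (amap (R K L) (snd X (J, K))) (snd X (K, L))"
proof -
  obtain A \<alpha> where X: "X = (A, \<alpha>)" by (cases X)
  have "\<forall>J \<in> I. \<forall>K \<in> I. \<forall>L \<in> I. J \<subseteq> K \<longrightarrow> K \<subseteq> L \<longrightarrow>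
      \<alpha> (J, L) = Comp (D L) (amap (R K L) (\<alpha> (J, K))) (\<alpha> (K, L))"
    using assms(1) unfolding section_objs_def X mem_Collect_eq prod.case by (elim conjE)
  then have "\<alpha> (J, L) = Comp (D L) (amap (R K L) (\<alpha> (J, K))) (\<alpha> (K, L))"
    using assms(2-6) by blast
  then show ?thesis by (simp add: X)
qed

lemma section_homD:
  assumes "f \<in> section_homs I D R X Y"
  shows "J \<in> I \<Longrightarrow> f J \<in> Hom (D J) (fst X J) (fst Y J)"
    and "(J, K) \<in> incl_pairs I \<Longrightarrow>
      Comp (D K) (snd Y (J, K)) (f K) = Comp (D K) (amap (R J K) (f J)) (snd X (J, K))"
  using assms by (auto simp: section_homs_def)

lemma section_homI:
  assumes "f \<in> extensional I" "\<And>J. J \<in> I \<Longrightarrow> f J \<in> Hom (D J) (fst X J) (fst Y J)"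
    "\<And>J K. (J, K) \<in> incl_pairs I \<Longrightarrow>
      Comp (D K) (snd Y (J, K)) (f K) = Comp (D K) (amap (R J K) (f J)) (snd X (J, K))"
  shows "f \<in> section_homs I D R X Y"
  using assms by (auto simp: section_homs_def PiE_iff)

lemma incl_pairsD: "(J, K) \<in> incl_pairs I \<Longrightarrow> J \<in> I \<and> K \<in> I \<and> J \<subseteq> K"
  by (simp add: incl_pairs_def)

lemma section_ident:
  assumes X: "X \<in> section_objs I D R"
  shows "(\<lambda>J \<in> I. Ident (D J) (fst X J)) \<in> section_homs I D R X X"
proof (rule section_homI)
  fix J K assume p: "(J, K) \<in> incl_pairs I"
  note q = incl_pairsD[OF p]
  interpret K: category "D K" using q D_cat by blast
  show "Comp (D K) (snd X (J, K)) ((\<lambda>J \<in> I. Ident (D J) (fst X J)) K) =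
      Comp (D K) (amap (R J K) ((\<lambda>J \<in> I. Ident (D J) (fst X J)) J)) (snd X (J, K))"
    using q K.Ident_left[OF section_objD(2)[OF X p]] K.Ident_right[OF section_objD(2)[OF X p]]
      functor_Ident[OF R_functor section_objD(1)[OF X]] by simp
qed (use section_objD[OF X] category.Ident_closed[OF D_cat] in auto)

lemma section_comp:
  assumes X: "X \<in> section_objs I D R" and Y: "Y \<in> section_objs I D R" and Z: "Z \<in> section_objs I D R"
    and f: "f \<in> section_homs I D R X Y" and g: "g \<in> section_homs I D R Y Z"
  shows "(\<lambda>J \<in> I. Comp (D J) (g J) (f J)) \<in> section_homs I D R X Z"
proof (rule section_homI)
  fix J K assume p: "(J, K) \<in> incl_pairs I"
  note q = incl_pairsD[OF p]
  interpret K: category "D K" using q D_cat by blast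
  have R: "is_functor (D J) (D K) (R J K)" using R_functor q by blast
  have fg: "f J \<in> Hom (D J) (fst X J) (fst Y J)" "g J \<in> Hom (D J) (fst Y J) (fst Z J)"
    "f K \<in> Hom (D K) (fst X K) (fst Y K)" "g K \<in> Hom (D K) (fst Y K) (fst Z K)"
    using q section_homD(1) f g by auto
  have "Comp (D K) (snd Z (J, K)) (Comp (D K) (g K) (f K)) =
      Comp (D K) (amap (R J K) (g J)) (Comp (D K) (snd Y (J, K)) (f K))"
    using K.Comp_assoc[OF fg(3,4) section_objD(2)[OF Z p]] section_homD(2)[OF g p]
      K.Comp_assoc[OF fg(3) section_objD(2)[OF Y p] functor_Hom[OF R fg(2)]] by simp
  also have "\<dots> = Comp (D K) (amap (R J K) (Comp (D J) (g J) (f J))) (snd X (J, K))"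
    using section_homD(2)[OF f p] functor_Comp[OF R fg(1,2)]
      K.Comp_assoc[OF section_objD(2)[OF X p] functor_Hom[OF R fg(1)] functor_Hom[OF R fg(2)]] by simp
  finally show "Comp (D K) (snd Z (J, K)) ((\<lambda>J \<in> I. Comp (D J) (g J) (f J)) K) =
      Comp (D K) (amap (R J K) ((\<lambda>J \<in> I. Comp (D J) (g J) (f J)) J)) (snd X (J, K))"
    using q by simp
qed (use category.Comp_closed[OF D_cat section_homD(1)[OF f] section_homD(1)[OF g]] in auto)

lemma category_section_cat: "category (section_cat I D R)"
proof
  fix F assume "F \<in> Arr (section_cat I D R)"
  then show "Dom (section_cat I D R) F \<in> Obj (section_cat I D R)"
    "Cod (section_cat I D R) F \<in> Obj (section_cat I D R)"
    by (auto simp: section_cat_def)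
next
  fix X assume "X \<in> Obj (section_cat I D R)"
  then have X: "X \<in> section_objs I D R" by (simp add: section_cat_def)
  have "Ident (section_cat I D R) X = (X, X, \<lambda>J \<in> I. Ident (D J) (fst X J))"
    by (simp add: section_cat_def)
  then show "Ident (section_cat I D R) X \<in> Hom (section_cat I D R) X X"
    using section_ident[OF X] X by (simp add: Hom_section_cat)
next
  fix F G X Y Z assume "F \<in> Hom (section_cat I D R) X Y" "G \<in> Hom (section_cat I D R) Y Z"
  then show "Comp (section_cat I D R) G F \<in> Hom (section_cat I D R) X Z"
    by (auto simp: Hom_section_cat) (auto simp: section_cat_def intro: section_comp)
next
  fix F X Y assume "F \<in> Hom (section_cat I D R) X Y"
  then obtain f where f: "F = (X, Y, f)" "f \<in> section_homs I D R X Y" by (auto simp: Hom_section_cat)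
  have "f \<in> extensional I" using f(2) by (simp add: section_homs_def PiE_iff)
  then have "(\<lambda>J \<in> I. Comp (D J) (Ident (D J) (fst Y J)) (f J)) = f"
    "(\<lambda>J \<in> I. Comp (D J) (f J) (Ident (D J) (fst X J))) = f"
    using category.Ident_left[OF D_cat section_homD(1)[OF f(2)]]
      category.Ident_right[OF D_cat section_homD(1)[OF f(2)]]
    by (auto intro!: restrict_eqI)
  then show "Comp (section_cat I D R) (Ident (section_cat I D R) Y) F = F"
    "Comp (section_cat I D R) F (Ident (section_cat I D R) X) = F"
    using f(1) by (auto simp: section_cat_def cong: restrict_cong)
next
  fix F G H X Y Z V
  assume "F \<in> Hom (section_cat I D R) X Y" "G \<in> Hom (section_cat I D R) Y Z" "H \<in> Hom (section_cat I D R) Z V"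
  then obtain f g h where fgh: "F = (X, Y, f)" "G = (Y, Z, g)" "H = (Z, V, h)"
    and s: "f \<in> section_homs I D R X Y" "g \<in> section_homs I D R Y Z" "h \<in> section_homs I D R Z V"
    by (auto simp: Hom_section_cat)
  have "Comp (D J) (Comp (D J) (h J) (g J)) (f J) = Comp (D J) (h J) (Comp (D J) (g J) (f J))"
    if "J \<in> I" for J
    using category.Comp_assoc[OF D_cat[OF that] section_homD(1)[OF s(1) that] section_homD(1)[OF s(2) that]
      section_homD(1)[OF s(3) that]] .
  then show "Comp (section_cat I D R) (Comp (section_cat I D R) H G) F =
      Comp (section_cat I D R) H (Comp (section_cat I D R) G F)"
    by (auto simp: fgh section_cat_def)
qed

lemma section_cat_isoI:
  assumes X: "X \<in> section_objs I D R" and Y: "Y \<in> section_objs I D R"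
    and f: "f \<in> section_homs I D R X Y" and iso: "\<And>J. J \<in> I \<Longrightarrow> is_iso (D J) (f J)"
  shows "is_iso (section_cat I D R) (X, Y, f)"
proof -
  define g where "g = (\<lambda>J \<in> I. inv_arr (D J) (f J))"
  have inv: "g J \<in> Hom (D J) (fst Y J) (fst X J)" "Comp (D J) (g J) (f J) = Ident (D J) (fst X J)"
    "Comp (D J) (f J) (g J) = Ident (D J) (fst Y J)" if "J \<in> I" for J
    using inv_arr[OF iso[OF that] section_homD(1)[OF f that]] that by (simp_all add: g_def)
  have "g \<in> section_homs I D R Y X"
  proof (rule section_homI)
    fix J K assume p: "(J, K) \<in> incl_pairs I"
    note q = incl_pairsD[OF p]
    then have J: "J \<in> I" and KI: "K \<in> I" by auto
    interpret K: category "D K" using q D_cat by blast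
    have R: "is_functor (D J) (D K) (R J K)" using R_functor q by blast
    note fJ = section_homD(1)[OF f J] and fK = section_homD(1)[OF f KI]
    note RfJ = functor_Hom[OF R fJ] and RgJ = functor_Hom[OF R inv(1)[OF J]]
    note sX = section_objD(2)[OF X p] and sY = section_objD(2)[OF Y p]
    have RX: "omap (R J K) (fst X J) \<in> Obj (D K)" using K.Hom_Obj[OF sX] by blast
    have "Comp (D K) (amap (R J K) (g J)) (snd Y (J, K)) =
        Comp (D K) (amap (R J K) (g J)) (Comp (D K) (Comp (D K) (snd Y (J, K)) (f K)) (g K))"
      using K.Comp_assoc[OF inv(1)[OF KI] fK sY] inv(3)[OF KI] K.Ident_right[OF sY] by simp
    also have "\<dots> = Comp (D K) (Comp (D K) (amap (R J K) (g J)) (amap (R J K) (f J)))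
        (Comp (D K) (snd X (J, K)) (g K))"
      using section_homD(2)[OF f p] K.Comp_assoc[OF inv(1)[OF KI] sX RfJ]
        K.Comp_assoc[OF K.Comp_closed[OF inv(1)[OF KI] sX] RfJ RgJ] by simp
    also have "\<dots> = Comp (D K) (snd X (J, K)) (g K)"
      using functor_Comp[OF R fJ inv(1)[OF J]] inv(2)[OF J] functor_Ident[OF R section_objD(1)[OF X J]]
        K.Ident_left[OF K.Comp_closed[OF inv(1)[OF KI] sX]] by simp
    finally show "Comp (D K) (snd X (J, K)) (g K) = Comp (D K) (amap (R J K) (g J)) (snd Y (J, K))" by simp
  qed (use inv in \<open>auto simp: g_def\<close>)
  then have "(Y, X, g) \<in> Hom (section_cat I D R) Y X" "(X, Y, f) \<in> Hom (section_cat I D R) X Y"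
    using X Y f by (auto simp: Hom_section_cat)
  moreover have "Comp (section_cat I D R) (Y, X, g) (X, Y, f) = Ident (section_cat I D R) X"
    "Comp (section_cat I D R) (X, Y, f) (Y, X, g) = Ident (section_cat I D R) Y"
    using inv by (auto simp: section_cat_def)
  ultimately show ?thesis using category.is_isoI[OF category_section_cat] by blast
qed

end

context coxeter_gluing
begin

abbreviation glue :: "'w set \<Rightarrow> _" where "glue \<equiv> glue_cat W C \<Phi> \<nu>"

lemma glue_pairsD: "(w, u) \<in> glue_pairs W E \<Longrightarrow> w \<in> carrier W \<and> u \<in> E \<and> w \<otimes> u \<in> E"
  by (simp add: glue_pairs_def)

lemma Hom_glue_cat:
  "Hom (glue E) X Y = {(X, Y, f) | f. X \<in> glue_objs W C \<Phi> \<nu> E \<and> Y \<in> glue_objs W C \<Phi> \<nu> E \<and>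
     f \<in> glue_homs W C \<Phi> E X Y}"
  by (auto simp: Hom_def glue_cat_def)

lemma glue_objD:
  assumes "X \<in> glue_objs W C \<Phi> \<nu> E"
  shows "u \<in> E \<Longrightarrow> fst X u \<in> Obj (C u)"
    and "(w, u) \<in> glue_pairs W E \<Longrightarrow>
      snd X (w, u) \<in> Hom (C (w \<otimes> u)) (\<Phi>o w u (fst X u)) (fst X (w \<otimes> u))"
    and "u \<in> E \<Longrightarrow> snd X (\<one>, u) = Ident (C u) (fst X u)"
  using assms by (fastforce simp: glue_objs_def)+

lemma glue_obj_assoc:
  assumes "X \<in> glue_objs W C \<Phi> \<nu> E" "w \<in> carrier W" "w' \<in> carrier W" "u \<in> carrier W"
    "u \<in> E" "w' \<otimes> u \<in> E" "w \<otimes> (w' \<otimes> u) \<in> E"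
  shows "snd X (w, w' \<otimes> u) \<cdot>[w \<otimes> (w' \<otimes> u)] \<Phi>a w (w' \<otimes> u) (snd X (w', u)) =
    snd X (w \<otimes> w', u) \<cdot>[w \<otimes> (w' \<otimes> u)] \<nu> w w' u (fst X u)"
proof -
  have e: "w \<otimes> (w' \<otimes> u) = w \<otimes> w' \<otimes> u" using assms by (simp add: m_assoc)
  show ?thesis using assms unfolding e by (auto simp: glue_objs_def)
qed

lemma glue_homD:
  assumes "f \<in> glue_homs W C \<Phi> E X Y"
  shows "u \<in> E \<Longrightarrow> f u \<in> Hom (C u) (fst X u) (fst Y u)"
    and "(w, u) \<in> glue_pairs W E \<Longrightarrow>
      f (w \<otimes> u) \<cdot>[w \<otimes> u] snd X (w, u) = snd Y (w, u) \<cdot>[w \<otimes> u] \<Phi>a w u (f u)"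
  using assms by (auto simp: glue_homs_def)

lemma glue_homI:
  assumes "f \<in> extensional E" "\<And>u. u \<in> E \<Longrightarrow> f u \<in> Hom (C u) (fst X u) (fst Y u)"
    "\<And>w u. (w, u) \<in> glue_pairs W E \<Longrightarrow>
      f (w \<otimes> u) \<cdot>[w \<otimes> u] snd X (w, u) = snd Y (w, u) \<cdot>[w \<otimes> u] \<Phi>a w u (f u)"
  shows "f \<in> glue_homs W C \<Phi> E X Y"
  using assms by (auto simp: glue_homs_def PiE_iff)

lemma glue_ident:
  assumes E: "E \<subseteq> carrier W" and X: "X \<in> glue_objs W C \<Phi> \<nu> E"
  shows "(\<lambda>u \<in> E. Ident (C u) (fst X u)) \<in> glue_homs W C \<Phi> E X X"
proof (rule glue_homI)
  fix w u assume p: "(w, u) \<in> glue_pairs W E"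
  note q = glue_pairsD[OF p]
  have c: "w \<in> carrier W" "u \<in> carrier W" "w \<otimes> u \<in> carrier W" using q E by auto
  show "(\<lambda>u \<in> E. Ident (C u) (fst X u)) (w \<otimes> u) \<cdot>[w \<otimes> u] snd X (w, u) =
      snd X (w, u) \<cdot>[w \<otimes> u] \<Phi>a w u ((\<lambda>u \<in> E. Ident (C u) (fst X u)) u)"
    using q id_left[OF c(3) glue_objD(2)[OF X p]] id_right[OF c(3) glue_objD(2)[OF X p]]
      Phi_ident[OF c(1,2) glue_objD(1)[OF X]] by simp
qed (use glue_objD[OF X] id_hom E in auto)

lemma glue_comp:
  assumes E: "E \<subseteq> carrier W"
    and X: "X \<in> glue_objs W C \<Phi> \<nu> E" and Y: "Y \<in> glue_objs W C \<Phi> \<nu> E" and Z: "Z \<in> glue_objs W C \<Phi> \<nu> E"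
    and f: "f \<in> glue_homs W C \<Phi> E X Y" and g: "g \<in> glue_homs W C \<Phi> E Y Z"
  shows "(\<lambda>u \<in> E. g u \<cdot>[u] f u) \<in> glue_homs W C \<Phi> E X Z"
proof (rule glue_homI)
  fix w u assume p: "(w, u) \<in> glue_pairs W E"
  note q = glue_pairsD[OF p]
  have c: "w \<in> carrier W" "u \<in> carrier W" "w \<otimes> u \<in> carrier W" using q E by auto
  have fg: "f u \<in> Hom (C u) (fst X u) (fst Y u)" "g u \<in> Hom (C u) (fst Y u) (fst Z u)"
    "f (w \<otimes> u) \<in> Hom (C (w \<otimes> u)) (fst X (w \<otimes> u)) (fst Y (w \<otimes> u))"
    "g (w \<otimes> u) \<in> Hom (C (w \<otimes> u)) (fst Y (w \<otimes> u)) (fst Z (w \<otimes> u))"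
    using q glue_homD(1) f g by auto
  note Pf = Phi_hom[OF c(1,2) fg(1)] and Pg = Phi_hom[OF c(1,2) fg(2)]
  have "(g (w \<otimes> u) \<cdot>[w \<otimes> u] f (w \<otimes> u)) \<cdot>[w \<otimes> u] snd X (w, u) =
      (snd Z (w, u) \<cdot>[w \<otimes> u] \<Phi>a w u (g u)) \<cdot>[w \<otimes> u] \<Phi>a w u (f u)"
    using comp_assoc[OF c(3) glue_objD(2)[OF X p] fg(3,4)] glue_homD(2)[OF f p]
      comp_assoc[OF c(3) Pf glue_objD(2)[OF Y p] fg(4)] glue_homD(2)[OF g p] by simp
  also have "\<dots> = snd Z (w, u) \<cdot>[w \<otimes> u] \<Phi>a w u (g u \<cdot>[u] f u)"
    using comp_assoc[OF c(3) Pf Pg glue_objD(2)[OF Z p]] Phi_comp[OF c(1,2) fg(1,2)] by simp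
  finally show "(\<lambda>u \<in> E. g u \<cdot>[u] f u) (w \<otimes> u) \<cdot>[w \<otimes> u] snd X (w, u) =
      snd Z (w, u) \<cdot>[w \<otimes> u] \<Phi>a w u ((\<lambda>u \<in> E. g u \<cdot>[u] f u) u)"
    using q by simp
qed (use comp_hom[OF _ glue_homD(1)[OF f] glue_homD(1)[OF g]] E in auto)

lemma category_glue_cat:
  assumes E: "E \<subseteq> carrier W"
  shows "category (glue E)"
proof
  have cE: "u \<in> carrier W" if "u \<in> E" for u using that E by blast
  {
    fix F assume "F \<in> Arr (glue E)"
    then show "Dom (glue E) F \<in> Obj (glue E)" "Cod (glue E) F \<in> Obj (glue E)"
      by (auto simp: glue_cat_def)
  next
    fix X assume "X \<in> Obj (glue E)"
    then have X: "X \<in> glue_objs W C \<Phi> \<nu> E" by (simp add: glue_cat_def)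
    have "Ident (glue E) X = (X, X, \<lambda>u \<in> E. Ident (C u) (fst X u))" by (simp add: glue_cat_def)
    then show "Ident (glue E) X \<in> Hom (glue E) X X"
      using glue_ident[OF E X] X by (simp add: Hom_glue_cat)
  next
    fix F G X Y Z assume "F \<in> Hom (glue E) X Y" "G \<in> Hom (glue E) Y Z"
    then show "Comp (glue E) G F \<in> Hom (glue E) X Z"
      by (auto simp: Hom_glue_cat) (auto simp: glue_cat_def intro: glue_comp[OF E])
  next
    fix F X Y assume "F \<in> Hom (glue E) X Y"
    then obtain f where f: "F = (X, Y, f)" "f \<in> glue_homs W C \<Phi> E X Y" by (auto simp: Hom_glue_cat)
    have "f \<in> extensional E" using f(2) by (simp add: glue_homs_def PiE_iff)
    then have "(\<lambda>u \<in> E. Ident (C u) (fst Y u) \<cdot>[u] f u) = f"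
      "(\<lambda>u \<in> E. f u \<cdot>[u] Ident (C u) (fst X u)) = f"
      using id_left[OF cE glue_homD(1)[OF f(2)]] id_right[OF cE glue_homD(1)[OF f(2)]]
      by (auto intro!: restrict_eqI)
    then show "Comp (glue E) (Ident (glue E) Y) F = F" "Comp (glue E) F (Ident (glue E) X) = F"
      using f(1) by (auto simp: glue_cat_def cong: restrict_cong)
  next
    fix F G H X Y Z V
    assume "F \<in> Hom (glue E) X Y" "G \<in> Hom (glue E) Y Z" "H \<in> Hom (glue E) Z V"
    then obtain f g h where fgh: "F = (X, Y, f)" "G = (Y, Z, g)" "H = (Z, V, h)"
      and s: "f \<in> glue_homs W C \<Phi> E X Y" "g \<in> glue_homs W C \<Phi> E Y Z" "h \<in> glue_homs W C \<Phi> E Z V"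
      by (auto simp: Hom_glue_cat)
    have "(h u \<cdot>[u] g u) \<cdot>[u] f u = h u \<cdot>[u] (g u \<cdot>[u] f u)" if "u \<in> E" for u
      using comp_assoc[OF cE[OF that] glue_homD(1)[OF s(1) that] glue_homD(1)[OF s(2) that]
        glue_homD(1)[OF s(3) that]] .
    then show "Comp (glue E) (Comp (glue E) H G) F = Comp (glue E) H (Comp (glue E) G F)"
      by (auto simp: fgh glue_cat_def)
  }
qed

text \<open>
  Components of isomorphisms of glued objects are isomorphisms because evaluation is a functor.
\<close>

lemma evaluation_functor:
  assumes "E \<subseteq> carrier W" "u \<in> E"
  shows "is_functor (glue E) (C u) \<lparr>omap = (\<lambda>X. fst X u), amap = (\<lambda>F. snd (snd F) u)\<rparr>"
proof -
  have "u \<in> carrier W" using assms by blast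
  then show ?thesis
    using category_glue_cat[OF assms(1)] cat assms(2) glue_objD(1) glue_homD(1)
    by (auto simp: is_functor_def Hom_glue_cat) (auto simp: glue_cat_def)
qed

lemma glue_cat_isoI:
  assumes E: "E \<subseteq> carrier W"
    and X: "X \<in> glue_objs W C \<Phi> \<nu> E" and Y: "Y \<in> glue_objs W C \<Phi> \<nu> E"
    and f: "f \<in> glue_homs W C \<Phi> E X Y" and iso: "\<And>u. u \<in> E \<Longrightarrow> is_iso (C u) (f u)"
  shows "is_iso (glue E) (X, Y, f)"
proof -
  define g where "g = (\<lambda>u \<in> E. inv_arr (C u) (f u))"
  have inv: "g u \<in> Hom (C u) (fst Y u) (fst X u)" "g u \<cdot>[u] f u = Ident (C u) (fst X u)"
    "f u \<cdot>[u] g u = Ident (C u) (fst Y u)" if "u \<in> E" for u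
    using inv_arr[OF iso[OF that] glue_homD(1)[OF f that]] that by (simp_all add: g_def)
  have "g \<in> glue_homs W C \<Phi> E Y X"
  proof (rule glue_homI)
    fix w u assume p: "(w, u) \<in> glue_pairs W E"
    have u: "u \<in> E" and wu: "w \<otimes> u \<in> E" using glue_pairsD[OF p] by auto
    have c: "w \<in> carrier W" "u \<in> carrier W" "w \<otimes> u \<in> carrier W" using glue_pairsD[OF p] E by auto
    note fu = glue_homD(1)[OF f u] and fwu = glue_homD(1)[OF f wu]
    note Pf = Phi_hom[OF c(1,2) fu] and Pg = Phi_hom[OF c(1,2) inv(1)[OF u]]
    note sX = glue_objD(2)[OF X p] and sY = glue_objD(2)[OF Y p]
    have "g (w \<otimes> u) \<cdot>[w \<otimes> u] snd Y (w, u) =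
        g (w \<otimes> u) \<cdot>[w \<otimes> u] ((snd Y (w, u) \<cdot>[w \<otimes> u] \<Phi>a w u (f u)) \<cdot>[w \<otimes> u] \<Phi>a w u (g u))"
      using comp_assoc[OF c(3) Pg Pf sY] Phi_comp[OF c(1,2) inv(1)[OF u] fu] inv(3)[OF u]
        Phi_ident[OF c(1,2) glue_objD(1)[OF Y u]] id_right[OF c(3) sY] by simp
    also have "\<dots> = (g (w \<otimes> u) \<cdot>[w \<otimes> u] f (w \<otimes> u)) \<cdot>[w \<otimes> u] (snd X (w, u) \<cdot>[w \<otimes> u] \<Phi>a w u (g u))"
      using glue_homD(2)[OF f p] comp_assoc[OF c(3) Pg sX fwu]
        comp_assoc[OF c(3) comp_hom[OF c(3) Pg sX] fwu inv(1)[OF wu]] by simp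
    also have "\<dots> = snd X (w, u) \<cdot>[w \<otimes> u] \<Phi>a w u (g u)"
      using inv(2)[OF wu] id_left[OF c(3) comp_hom[OF c(3) Pg sX]] by simp
    finally show "g (w \<otimes> u) \<cdot>[w \<otimes> u] snd Y (w, u) = snd X (w, u) \<cdot>[w \<otimes> u] \<Phi>a w u (g u)" .
  qed (use inv in \<open>auto simp: g_def\<close>)
  then have "(Y, X, g) \<in> Hom (glue E) Y X" "(X, Y, f) \<in> Hom (glue E) X Y"
    using X Y f by (auto simp: Hom_glue_cat)
  moreover have "Comp (glue E) (Y, X, g) (X, Y, f) = Ident (glue E) X"
    "Comp (glue E) (X, Y, f) (Y, X, g) = Ident (glue E) Y"
    using inv by (auto simp: glue_cat_def)
  ultimately show ?thesis using category.is_isoI[OF category_glue_cat[OF E]] by blast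
qed

lemma glue_objI:
  assumes "E \<subseteq> carrier W" "A \<in> extensional E" "\<alpha> \<in> extensional (glue_pairs W E)"
    and "\<And>u. u \<in> E \<Longrightarrow> A u \<in> Obj (C u)"
    and "\<And>w u. (w, u) \<in> glue_pairs W E \<Longrightarrow> \<alpha> (w, u) \<in> Hom (C (w \<otimes> u)) (\<Phi>o w u (A u)) (A (w \<otimes> u))"
    and "\<And>u. u \<in> E \<Longrightarrow> \<alpha> (\<one>, u) = Ident (C u) (A u)"
    and "\<And>w w' u. w \<in> carrier W \<Longrightarrow> w' \<in> carrier W \<Longrightarrow> u \<in> E \<Longrightarrow> w' \<otimes> u \<in> E \<Longrightarrow> w \<otimes> (w' \<otimes> u) \<in> E \<Longrightarrow>
      \<alpha> (w, w' \<otimes> u) \<cdot>[w \<otimes> (w' \<otimes> u)] \<Phi>a w (w' \<otimes> u) (\<alpha> (w', u)) =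
      \<alpha> (w \<otimes> w', u) \<cdot>[w \<otimes> (w' \<otimes> u)] \<nu> w w' u (A u)"
  shows "(A, \<alpha>) \<in> glue_objs W C \<Phi> \<nu> E"
proof -
  have "w \<otimes> w' \<otimes> u = w \<otimes> (w' \<otimes> u)" if "w \<in> carrier W" "w' \<in> carrier W" "u \<in> E" for w w' u
    using that assms(1) by (auto simp: m_assoc)
  then show ?thesis using assms(2-) by (auto simp: glue_objs_def PiE_iff)
qed

lemma restriction_obj:
  assumes "E' \<subseteq> carrier W" "E \<subseteq> E'" "X \<in> glue_objs W C \<Phi> \<nu> E'"
  shows "glue_restr_obj W E X \<in> glue_objs W C \<Phi> \<nu> E"
proof -
  have E: "E \<subseteq> carrier W" using assms by blast
  have gp: "(w, u) \<in> glue_pairs W E'" if "(w, u) \<in> glue_pairs W E" for w u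
    using that assms(2) by (auto simp: glue_pairs_def)
  show ?thesis
    unfolding glue_restr_obj_def
  proof (rule glue_objI[OF E])
    fix w u assume "(w, u) \<in> glue_pairs W E"
    then show "restrict (snd X) (glue_pairs W E) (w, u) \<in>
        Hom (C (w \<otimes> u)) (\<Phi>o w u (restrict (fst X) E u)) (restrict (fst X) E (w \<otimes> u))"
      using glue_objD(2)[OF assms(3) gp] glue_pairsD by auto
  next
    fix w w' u assume a: "w \<in> carrier W" "w' \<in> carrier W" "u \<in> E" "w' \<otimes> u \<in> E" "w \<otimes> (w' \<otimes> u) \<in> E"
    moreover have "u \<in> carrier W" using a E by blast
    ultimately show "restrict (snd X) (glue_pairs W E) (w, w' \<otimes> u) \<cdot>[w \<otimes> (w' \<otimes> u)]
        \<Phi>a w (w' \<otimes> u) (restrict (snd X) (glue_pairs W E) (w', u)) =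
      restrict (snd X) (glue_pairs W E) (w \<otimes> w', u) \<cdot>[w \<otimes> (w' \<otimes> u)] \<nu> w w' u (restrict (fst X) E u)"
      using glue_obj_assoc[OF assms(3) a(1,2), of u] assms(2) by (auto simp: glue_pairs_def m_assoc)
  next
    fix u assume u: "u \<in> E"
    then have "\<one> \<otimes> u = u" using E by auto
    then show "restrict (snd X) (glue_pairs W E) (\<one>, u) = Ident (C u) (restrict (fst X) E u)"
      using u glue_objD(3)[OF assms(3)] assms(2) by (auto simp: glue_pairs_def)
  qed (use glue_objD(1)[OF assms(3)] assms(2) in auto)
qed

lemma restriction_hom:
  assumes "E \<subseteq> E'" "f \<in> glue_homs W C \<Phi> E' X Y"
  shows "restrict f E \<in> glue_homs W C \<Phi> E (glue_restr_obj W E X) (glue_restr_obj W E Y)"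
proof (rule glue_homI)
  fix w u assume p: "(w, u) \<in> glue_pairs W E"
  then have "(w, u) \<in> glue_pairs W E'" using assms(1) by (auto simp: glue_pairs_def)
  then show "restrict f E (w \<otimes> u) \<cdot>[w \<otimes> u] snd (glue_restr_obj W E X) (w, u) =
      snd (glue_restr_obj W E Y) (w, u) \<cdot>[w \<otimes> u] \<Phi>a w u (restrict f E u)"
    using glue_homD(2)[OF assms(2)] p glue_pairsD[OF p] by (simp add: glue_restr_obj_def)
qed (use glue_homD(1)[OF assms(2)] assms(1) in \<open>auto simp: glue_restr_obj_def\<close>)

lemma restriction_functor:
  assumes "E' \<subseteq> carrier W" "E \<subseteq> E'"
  shows "is_functor (glue E') (glue E) (glue_restr W E)"
proof (rule is_functorI)
  show "category (glue E')" "category (glue E)" using assms by (auto intro!: category_glue_cat)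
  show "omap (glue_restr W E) X \<in> Obj (glue E)" if "X \<in> Obj (glue E')" for X
    using restriction_obj[OF assms] that by (simp add: glue_restr_def glue_cat_def)
  show "amap (glue_restr W E) F \<in> Hom (glue E) (omap (glue_restr W E) X) (omap (glue_restr W E) Y)"
    if "F \<in> Hom (glue E') X Y" for F X Y
    using that by (auto simp: glue_restr_def Hom_glue_cat
      intro: restriction_obj[OF assms] restriction_hom[OF assms(2)])
  show "amap (glue_restr W E) (Ident (glue E') X) = Ident (glue E) (omap (glue_restr W E) X)" for X
    using assms(2) by (auto simp: glue_restr_def glue_cat_def glue_restr_obj_def Int_absorb1 intro!: restrict_ext)
  show "amap (glue_restr W E) (Comp (glue E') G F) =
      Comp (glue E) (amap (glue_restr W E) G) (amap (glue_restr W E) F)"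
    if "F \<in> Hom (glue E') X Y" "G \<in> Hom (glue E') Y Z" for F G X Y Z
    using that assms(2) by (auto simp: Hom_glue_cat)
      (auto simp: glue_restr_def glue_cat_def Int_absorb1 intro!: restrict_ext)
qed

lemma restriction_restriction:
  fixes X :: "('w, 'o, 'm) glue_obj"
  assumes "E \<subseteq> E'"
  shows "glue_restr_obj W E (glue_restr_obj W E' X) = glue_restr_obj W E X"
proof -
  have "glue_pairs W E \<subseteq> glue_pairs W E'" using assms by (auto simp: glue_pairs_def)
  then show ?thesis using assms by (simp add: glue_restr_obj_def Int_absorb1)
qed

end

section \<open>Descent along interior faces\<close>

context glued_half_space
begin

text \<open>
  The types of the interior vertices of the chamber \<open>u\<close>.
\<close>

definition vertices :: "'w \<Rightarrow> 'w set" where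
  "vertices u = {j \<in> S. parabolic (S - {j}) #> u \<subseteq> P}"

text \<open>
  The face of \<open>u\<close> with vertices of the types in \<open>J\<close> is interior.
\<close>

definition flag :: "'w set \<Rightarrow> 'w \<Rightarrow> bool" where
  "flag J u \<longleftrightarrow> u \<in> carrier W \<and> J \<noteq> {} \<and> J \<subseteq> vertices u"

lemma flag_sub: "flag K u \<Longrightarrow> J \<subseteq> K \<Longrightarrow> J \<noteq> {} \<Longrightarrow> flag J u"
  by (auto simp: flag_def)

lemma flagD: "flag J u \<Longrightarrow> u \<in> carrier W \<and> u \<in> P \<and> J \<subseteq> S \<and> J \<noteq> {} \<and> J \<subseteq> vertices u"
  using coset_base by (fastforce simp: flag_def vertices_def)

lemma flag_vertices: "u \<in> P \<Longrightarrow> flag (vertices u) u"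
  using chamber_vertex[of u] by (auto simp: flag_def vertices_def)

lemma flag_shift:
  assumes "flag J u" "w \<in> parabolic (S - J)"
  shows "flag J (w \<otimes> u)" and "w \<in> carrier W" and "w \<otimes> u \<in> P"
proof -
  have w: "w \<in> parabolic (S - {j})" if "j \<in> J" for j
    using assms(2) parabolic_mono[of "S - J" "S - {j}"] that by blast
  have wc: "w \<in> carrier W" using parabolic_closed[of "S - J" w] assms(2) by blast
  have "parabolic (S - {j}) #> (w \<otimes> u) \<subseteq> P" if "j \<in> J" for j
    using coset_shift[of "S - {j}" w u] w[OF that] assms(1) that by (auto simp: flag_def vertices_def)
  then show "flag J (w \<otimes> u)" using wc assms(1) by (auto simp: flag_def vertices_def)
  then show "w \<otimes> u \<in> P" using flagD by blast
  show "w \<in> carrier W" by (rule wc)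
qed

lemma local_pair_iff_flag: "local_pair w u \<longleftrightarrow> (\<exists>j. flag {j} u \<and> w \<in> parabolic (S - {j}))"
  by (auto simp: local_pair_def flag_def vertices_def)

end

text \<open>
  A cocartesian section written in components: \<open>N J u\<close> and \<open>M J w u\<close> are the objects and structure maps
  of the glued object on the star of the interior face \<open>J\<close> of \<open>u\<close>, and \<open>t J K u\<close> is the comparison from
  the larger face \<open>K\<close> to the smaller face \<open>J\<close>.
\<close>

locale component_data = glued_half_space W S s C \<Phi> \<nu>
  for W :: "('w, 'z) monoid_scheme" (structure) and S s
    and C :: "'w \<Rightarrow> ('o, 'm, 'y) abcat_scheme" and \<Phi> \<nu> +
  fixes N :: "'w set \<Rightarrow> 'w \<Rightarrow> 'o" and M :: "'w set \<Rightarrow> 'w \<Rightarrow> 'w \<Rightarrow> 'm"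
    and t :: "'w set \<Rightarrow> 'w set \<Rightarrow> 'w \<Rightarrow> 'm"
  assumes N_obj: "flag J u \<Longrightarrow> N J u \<in> Obj (C u)"
    and M_hom: "flag J u \<Longrightarrow> w \<in> parabolic (S - J) \<Longrightarrow>
      M J w u \<in> Hom (C (w \<otimes> u)) (\<Phi>o w u (N J u)) (N J (w \<otimes> u))"
    and M_one: "flag J u \<Longrightarrow> M J \<one> u = Ident (C u) (N J u)"
    and M_assoc: "flag J u \<Longrightarrow> w \<in> parabolic (S - J) \<Longrightarrow> w' \<in> parabolic (S - J) \<Longrightarrow>
      M J w (w' \<otimes> u) \<cdot>[w \<otimes> (w' \<otimes> u)] \<Phi>a w (w' \<otimes> u) (M J w' u) =
      M J (w \<otimes> w') u \<cdot>[w \<otimes> (w' \<otimes> u)] \<nu> w w' u (N J u)"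
    and t_hom: "flag K u \<Longrightarrow> J \<subseteq> K \<Longrightarrow> J \<noteq> {} \<Longrightarrow> t J K u \<in> Hom (C u) (N K u) (N J u)"
    and t_iso: "flag K u \<Longrightarrow> J \<subseteq> K \<Longrightarrow> J \<noteq> {} \<Longrightarrow> is_iso (C u) (t J K u)"
    and t_cocycle: "flag L u \<Longrightarrow> K \<subseteq> L \<Longrightarrow> J \<subseteq> K \<Longrightarrow> J \<noteq> {} \<Longrightarrow>
      t J L u = t J K u \<cdot>[u] t K L u"
    and t_M: "flag K u \<Longrightarrow> J \<subseteq> K \<Longrightarrow> J \<noteq> {} \<Longrightarrow> w \<in> parabolic (S - K) \<Longrightarrow>
      t J K (w \<otimes> u) \<cdot>[w \<otimes> u] M K w u = M J w u \<cdot>[w \<otimes> u] \<Phi>a w u (t J K u)"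
begin

text \<open>
  The largest interior face of \<open>u\<close> is a canonical place to read off the object at \<open>u\<close>; \<open>T J u\<close> compares it
  with the reading at any other interior face.
\<close>

definition B :: "'w \<Rightarrow> 'o" where "B u = N (vertices u) u"

definition T :: "'w set \<Rightarrow> 'w \<Rightarrow> 'm" where "T J u = t J (vertices u) u"

definition transported :: "'w set \<Rightarrow> 'w \<Rightarrow> 'w \<Rightarrow> 'm" where
  "transported J w u = inv_arr (C (w \<otimes> u)) (T J (w \<otimes> u)) \<cdot>[w \<otimes> u] (M J w u \<cdot>[w \<otimes> u] \<Phi>a w u (T J u))"

lemma B_in_Obj: "u \<in> P \<Longrightarrow> B u \<in> Obj (C u)"
  using N_obj[OF flag_vertices] by (simp add: B_def)

lemma T_hom: "flag J u \<Longrightarrow> T J u \<in> Hom (C u) (B u) (N J u)"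
  using t_hom[OF flag_vertices] flagD by (simp add: B_def T_def)

lemma T_iso: "flag J u \<Longrightarrow> is_iso (C u) (T J u)"
  using t_iso[OF flag_vertices] flagD by (simp add: T_def)

lemma T_sub:
  assumes "flag K u" "J \<subseteq> K" "J \<noteq> {}"
  shows "T J u = t J K u \<cdot>[u] T K u"
  using t_cocycle[OF flag_vertices _ assms(2,3), of u] flagD[OF assms(1)] by (simp add: T_def)

lemma transported_props:
  assumes "flag J u" "w \<in> parabolic (S - J)"
  shows "transported J w u \<in> Hom (C (w \<otimes> u)) (\<Phi>o w u (B u)) (B (w \<otimes> u))"
    and "T J (w \<otimes> u) \<cdot>[w \<otimes> u] transported J w u = M J w u \<cdot>[w \<otimes> u] \<Phi>a w u (T J u)"
proof -
  note s = flag_shift[OF assms] and d = flagD[OF assms(1)]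
  have c: "u \<in> carrier W" "w \<otimes> u \<in> carrier W" using s d by auto
  have MT: "M J w u \<cdot>[w \<otimes> u] \<Phi>a w u (T J u) \<in> Hom (C (w \<otimes> u)) (\<Phi>o w u (B u)) (N J (w \<otimes> u))"
    using comp_hom[OF c(2) Phi_hom[OF s(2) c(1) T_hom[OF assms(1)]] M_hom[OF assms]] .
  note i = inv_arr[OF T_iso[OF s(1)] T_hom[OF s(1)]]
  show "transported J w u \<in> Hom (C (w \<otimes> u)) (\<Phi>o w u (B u)) (B (w \<otimes> u))"
    using comp_hom[OF c(2) MT i(1)] by (simp add: transported_def)
  show "T J (w \<otimes> u) \<cdot>[w \<otimes> u] transported J w u = M J w u \<cdot>[w \<otimes> u] \<Phi>a w u (T J u)"
    using comp_assoc[OF c(2) MT i(1) T_hom[OF s(1)]] i(3) id_left[OF c(2) MT] by (simp add: transported_def)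
qed

lemma T_cancel:
  assumes "flag J u" "f \<in> Hom (C u) A (B u)" "g \<in> Hom (C u) A (B u)" "T J u \<cdot>[u] f = T J u \<cdot>[u] g"
  shows "f = g"
  using category.iso_cancel_left[OF cat T_iso[OF assms(1)] T_hom[OF assms(1)] assms(2-4)] flagD[OF assms(1)]
  by blast

text \<open>
  The cocycle condition turns \<open>T J\<close> into \<open>T K\<close> followed by a comparison of faces, and comparisons commute
  with structure maps.
\<close>

lemma transported_sub:
  assumes K: "flag K u" and J: "J \<subseteq> K" "J \<noteq> {}" and w: "w \<in> parabolic (S - K)"
  shows "transported J w u = transported K w u"
proof -
  have fJ: "flag J u" using flag_sub assms by blast
  have wJ: "w \<in> parabolic (S - J)" using w parabolic_mono[of "S - K" "S - J"] J by blast
  note sK = flag_shift[OF K w] and sJ = flag_shift[OF fJ wJ]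
  have c: "w \<in> carrier W" "u \<in> carrier W" "w \<otimes> u \<in> carrier W" using sK flagD[OF K] by auto
  have "T J (w \<otimes> u) \<cdot>[w \<otimes> u] transported K w u =
      t J K (w \<otimes> u) \<cdot>[w \<otimes> u] (M K w u \<cdot>[w \<otimes> u] \<Phi>a w u (T K u))"
    using T_sub[OF sK(1) J] transported_props(2)[OF K w]
      comp_assoc[OF c(3) transported_props(1)[OF K w] T_hom[OF sK(1)] t_hom[OF sK(1) J]] by simp
  also have "\<dots> = M J w u \<cdot>[w \<otimes> u] (\<Phi>a w u (t J K u) \<cdot>[w \<otimes> u] \<Phi>a w u (T K u))"
    using t_M[OF K J w]
      comp_assoc[OF c(3) Phi_hom[OF c(1,2) T_hom[OF K]] M_hom[OF K w] t_hom[OF sK(1) J]]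
      comp_assoc[OF c(3) Phi_hom[OF c(1,2) T_hom[OF K]] Phi_hom[OF c(1,2) t_hom[OF K J]] M_hom[OF fJ wJ]]
    by simp
  also have "\<dots> = T J (w \<otimes> u) \<cdot>[w \<otimes> u] transported J w u"
    using transported_props(2)[OF fJ wJ] T_sub[OF K J] Phi_comp[OF c(1,2) T_hom[OF K] t_hom[OF K J]] by simp
  finally show ?thesis using T_cancel[OF sJ(1) transported_props(1)[OF fJ wJ] transported_props(1)[OF K w]] by simp
qed

text \<open>
  Two interior vertices of \<open>u\<close> that are both vertices of \<open>w u\<close> span an interior edge with the same
  property, and both maps agree with the one transported from that edge.
\<close>

lemma transported_vertex_independent:
  assumes "flag {i} u" "flag {j} u" "w \<in> parabolic (S - {i})" "w \<in> parabolic (S - {j})"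
  shows "transported {i} w u = transported {j} w u"
proof -
  have f: "flag {i, j} u" using assms by (auto simp: flag_def)
  have "w \<in> parabolic (S - {i, j})"
    using parabolic_Inter[of "{i, j}" w] assms flagD[OF assms(1)] flagD[OF assms(2)]
      parabolic_closed[of "S - {i}" w] by auto
  then show ?thesis using transported_sub[OF f, of "{i}" w] transported_sub[OF f, of "{j}" w] by simp
qed

definition \<beta> :: "'w \<Rightarrow> 'w \<Rightarrow> 'm" where
  "\<beta> w u = transported {SOME j. flag {j} u \<and> w \<in> parabolic (S - {j})} w u"

text \<open>
  The vertex chosen in the definition of \<open>\<beta>\<close> does not matter, and a face may be replaced by any of its
  vertices.
\<close>

lemma beta_eq_transported:
  assumes "flag J u" "w \<in> parabolic (S - J)"
  shows "\<beta> w u = transported J w u"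
proof -
  obtain j where j: "j \<in> J" using flagD[OF assms(1)] by blast
  then have f: "flag {j} u" using flag_sub[OF assms(1)] by blast
  have w: "w \<in> parabolic (S - {j})"
    using assms(2) parabolic_mono[of "S - J" "S - {j}"] j by blast
  from f w have "\<exists>j. flag {j} u \<and> w \<in> parabolic (S - {j})" by blast
  from someI_ex[OF this] have "\<beta> w u = transported {j} w u"
    unfolding \<beta>_def using transported_vertex_independent f w by blast
  also have "\<dots> = transported J w u" using transported_sub[OF assms(1) _ _ assms(2), of "{j}"] j by simp
  finally show ?thesis .
qed

lemma beta_props:
  assumes "flag J u" "w \<in> parabolic (S - J)"
  shows "\<beta> w u \<in> Hom (C (w \<otimes> u)) (\<Phi>o w u (B u)) (B (w \<otimes> u))"
    and "T J (w \<otimes> u) \<cdot>[w \<otimes> u] \<beta> w u = M J w u \<cdot>[w \<otimes> u] \<Phi>a w u (T J u)"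
  using transported_props[OF assms] beta_eq_transported[OF assms] by auto

sublocale local_gluing W S s C \<Phi> \<nu> B \<beta>
proof
  show "B u \<in> Obj (C u)" if "u \<in> P" for u using B_in_Obj that .
  show "\<beta> w u \<in> Hom (C (w \<otimes> u)) (\<Phi>o w u (B u)) (B (w \<otimes> u))" if "local_pair w u" for w u
    using that beta_props(1) by (auto simp: local_pair_iff_flag)
next
  fix u assume u: "u \<in> P"
  have one: "\<one> \<in> parabolic (S - vertices u)" by (rule generate.one)
  note f = flag_vertices[OF u]
  have c: "u \<in> carrier W" using u by simp
  have "T (vertices u) u \<cdot>[u] \<beta> \<one> u = T (vertices u) u \<cdot>[u] Ident (C u) (B u)"
    using beta_props(2)[OF f one] M_one[OF f] id_left[OF c T_hom[OF f]] id_right[OF c T_hom[OF f]]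
      Phi_one_arr[OF c, of "T (vertices u) u"] T_hom[OF f] c by (simp add: Hom_def)
  then show "\<beta> \<one> u = Ident (C u) (B u)"
    using T_cancel[OF f _ id_hom[OF c B_in_Obj[OF u]]] beta_props(1)[OF f one] c
      Phi_one_obj[OF c B_in_Obj[OF u]] by simp
next
  fix j u w w'
  assume j: "j \<in> S" "u \<in> carrier W" "parabolic (S - {j}) #> u \<subseteq> P"
    and w: "w \<in> parabolic (S - {j})" "w' \<in> parabolic (S - {j})"
  have f: "flag {j} u" using j by (simp add: flag_def vertices_def)
  note f' = flag_shift[OF f w(2)]
  note f'' = flag_shift[OF f'(1) w(1)]
  have ww: "w \<otimes> w' \<in> parabolic (S - {j})" using parabolic_mult w by blast
  have c: "w \<in> carrier W" "w' \<in> carrier W" "w' \<otimes> u \<in> carrier W" "w \<otimes> (w' \<otimes> u) \<in> carrier W"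
    "w \<otimes> w' \<in> carrier W" "w \<otimes> w' \<otimes> u = w \<otimes> (w' \<otimes> u)"
    using f'(2) f''(2) j(2) by (auto simp: m_assoc)
  define z where "z = w \<otimes> (w' \<otimes> u)"
  define \<tau> where "\<tau> = T {j} u"
  have z: "z \<in> carrier W" using c by (simp add: z_def)
  have uP: "u \<in> P" "w' \<otimes> u \<in> P" using flagD f f' by auto
  note Bu = B_in_Obj[OF uP(1)]
  have b1: "\<beta> w (w' \<otimes> u) \<in> Hom (C z) (\<Phi>o w (w' \<otimes> u) (B (w' \<otimes> u))) (B z)"
    and e1: "T {j} z \<cdot>[z] \<beta> w (w' \<otimes> u) = M {j} w (w' \<otimes> u) \<cdot>[z] \<Phi>a w (w' \<otimes> u) (T {j} (w' \<otimes> u))"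
    using beta_props[OF f'(1) w(1)] by (simp_all add: z_def)
  note b2 = beta_props(1)[OF f w(2)] and e2 = beta_props(2)[OF f w(2)]
  have b3: "\<beta> (w \<otimes> w') u \<in> Hom (C z) (\<Phi>o (w \<otimes> w') u (B u)) (B z)"
    and e3: "T {j} z \<cdot>[z] \<beta> (w \<otimes> w') u = M {j} (w \<otimes> w') u \<cdot>[z] \<Phi>a (w \<otimes> w') u \<tau>"
    using beta_props[OF f ww] c(6) by (simp_all add: z_def \<tau>_def)
  have tz: "T {j} z \<in> Hom (C z) (B z) (N {j} z)" using T_hom[OF f''(1)] by (simp add: z_def)
  have t1: "T {j} (w' \<otimes> u) \<in> Hom (C (w' \<otimes> u)) (B (w' \<otimes> u)) (N {j} (w' \<otimes> u))" using T_hom[OF f'(1)] .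
  have t0: "\<tau> \<in> Hom (C u) (B u) (N {j} u)" using T_hom[OF f] by (simp add: \<tau>_def)
  have m1: "M {j} w (w' \<otimes> u) \<in> Hom (C z) (\<Phi>o w (w' \<otimes> u) (N {j} (w' \<otimes> u))) (N {j} z)"
    using M_hom[OF f'(1) w(1)] by (simp add: z_def)
  note m2 = M_hom[OF f w(2)]
  have m3: "M {j} (w \<otimes> w') u \<in> Hom (C z) (\<Phi>o (w \<otimes> w') u (N {j} u)) (N {j} z)"
    using M_hom[OF f ww] c(6) by (simp add: z_def)
  have n: "\<nu> w w' u A \<in> Hom (C z) (\<Phi>o w (w' \<otimes> u) (\<Phi>o w' u A)) (\<Phi>o (w \<otimes> w') u A)"
    if "A \<in> Obj (C u)" for A using nu_hom[OF c(1,2) j(2) that] by (simp add: z_def)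
  have pF: "\<Phi>a w (w' \<otimes> u) x \<in> Hom (C z) (\<Phi>o w (w' \<otimes> u) A) (\<Phi>o w (w' \<otimes> u) A')"
    if "x \<in> Hom (C (w' \<otimes> u)) A A'" for x A A' using Phi_hom[OF c(1,3) that] by (simp add: z_def)
  have p2: "\<Phi>a w' u \<tau> \<in> Hom (C (w' \<otimes> u)) (\<Phi>o w' u (B u)) (\<Phi>o w' u (N {j} u))"
    using Phi_hom[OF c(2) j(2) t0] .
  have p3: "\<Phi>a (w \<otimes> w') u \<tau> \<in> Hom (C z) (\<Phi>o (w \<otimes> w') u (B u)) (\<Phi>o (w \<otimes> w') u (N {j} u))"
    using Phi_hom[OF c(5) j(2) t0] c(6) by (simp add: z_def)
  note Nu = N_obj[OF f]
  \<comment> \<open>associativity is transported from the star of the vertex \<open>j\<close> and then \<open>T {j} z\<close> is cancelled\<close>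
  have "T {j} z \<cdot>[z] (\<beta> w (w' \<otimes> u) \<cdot>[z] \<Phi>a w (w' \<otimes> u) (\<beta> w' u)) =
      M {j} w (w' \<otimes> u) \<cdot>[z] \<Phi>a w (w' \<otimes> u) (T {j} (w' \<otimes> u) \<cdot>[w' \<otimes> u] \<beta> w' u)"
    using comp_assoc[OF z pF[OF b2] b1 tz] e1 comp_assoc[OF z pF[OF b2] pF[OF t1] m1]
      Phi_comp[OF c(1,3) b2 t1] by (simp add: z_def[symmetric])
  also have "\<dots> = (M {j} w (w' \<otimes> u) \<cdot>[z] \<Phi>a w (w' \<otimes> u) (M {j} w' u)) \<cdot>[z] \<Phi>a w (w' \<otimes> u) (\<Phi>a w' u \<tau>)"
    using e2 comp_assoc[OF z pF[OF p2] pF[OF m2] m1] Phi_comp[OF c(1,3) p2 m2]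
    by (simp add: z_def[symmetric] \<tau>_def)
  also have "\<dots> = M {j} (w \<otimes> w') u \<cdot>[z] (\<nu> w w' u (N {j} u) \<cdot>[z] \<Phi>a w (w' \<otimes> u) (\<Phi>a w' u \<tau>))"
    using M_assoc[OF f w] comp_assoc[OF z pF[OF p2] n[OF Nu] m3] by (simp add: z_def[symmetric])
  also have "\<dots> = (M {j} (w \<otimes> w') u \<cdot>[z] \<Phi>a (w \<otimes> w') u \<tau>) \<cdot>[z] \<nu> w w' u (B u)"
    using nu_natural[OF c(1,2) j(2) t0] comp_assoc[OF z n[OF Bu] p3 m3] by (simp add: z_def[symmetric])
  also have "\<dots> = T {j} z \<cdot>[z] (\<beta> (w \<otimes> w') u \<cdot>[z] \<nu> w w' u (B u))"
    using e3 comp_assoc[OF z n[OF Bu] b3 tz] by simp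
  finally have "\<beta> w (w' \<otimes> u) \<cdot>[z] \<Phi>a w (w' \<otimes> u) (\<beta> w' u) = \<beta> (w \<otimes> w') u \<cdot>[z] \<nu> w w' u (B u)"
    using T_cancel[of "{j}" z, OF _ comp_hom[OF z pF[OF b2] b1] comp_hom[OF z n[OF Bu] b3]] f''(1)
    by (simp add: z_def)
  then show "\<beta> w (w' \<otimes> u) \<cdot>[w \<otimes> (w' \<otimes> u)] \<Phi>a w (w' \<otimes> u) (\<beta> w' u) =
      \<beta> (w \<otimes> w') u \<cdot>[w \<otimes> (w' \<otimes> u)] \<nu> w w' u (B u)" by (simp add: z_def)
qed

lemma glued_object_exists:
  "\<exists>X \<in> glue_objs W C \<Phi> \<nu> P. (\<forall>u \<in> P. fst X u = B u) \<and>
    (\<forall>J u w. flag J u \<longrightarrow> w \<in> parabolic (S - J) \<longrightarrow>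
      T J (w \<otimes> u) \<cdot>[w \<otimes> u] snd X (w, u) = M J w u \<cdot>[w \<otimes> u] \<Phi>a w u (T J u))"
proof (rule bexI[OF _ glued_object], intro conjI ballI allI impI)
  fix J u w assume a: "flag J u" "w \<in> parabolic (S - J)"
  obtain j where j: "j \<in> J" using flagD[OF a(1)] by blast
  then have "local_pair w u"
    using flag_sub[OF a(1), of "{j}"] a(2) parabolic_mono[of "S - J" "S - {j}"]
    by (auto simp: local_pair_iff_flag)
  then show "T J (w \<otimes> u) \<cdot>[w \<otimes> u] snd (restrict B P, \<lambda>(w, u)\<in>glue_pairs W P. glued_map w u) (w, u) =
      M J w u \<cdot>[w \<otimes> u] \<Phi>a w u (T J u)"
    using glued_map_local beta_props(2)[OF a] local_pairD[of w u] by (simp add: glue_pairs_def)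
qed simp

end

section \<open>The restriction functor\<close>

lemma sum_cat_Hom_component: "f \<in> Hom (sum_cat I C) A B \<Longrightarrow> i \<in> I \<Longrightarrow> f i \<in> Hom (C i) (A i) (B i)"
  by (auto simp: sum_cat_def Hom_def PiE_iff)

context coxeter_gluing
begin

lemma glue_cat_Comp_component:
  "u \<in> E \<Longrightarrow> snd (snd (Comp (glue E) G F)) u = snd (snd G) u \<cdot>[u] snd (snd F) u"
  by (cases G; cases F) (simp add: glue_cat_def)

lemma fst_restriction:
  fixes X :: "('w, 'o, 'm) glue_obj"
  shows "u \<in> E \<Longrightarrow> fst (glue_restr_obj W E X) u = fst X u"
  by (simp add: glue_restr_obj_def)

lemma snd_restriction:
  fixes X :: "('w, 'o, 'm) glue_obj"
  shows "(w, u) \<in> glue_pairs W E \<Longrightarrow> snd (glue_restr_obj W E X) (w, u) = snd X (w, u)"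
  by (simp add: glue_restr_obj_def)

lemma amap_restriction_component:
  fixes F :: "('w, 'o, 'm) glue_arr"
  shows "u \<in> E \<Longrightarrow> snd (snd (amap (glue_restr W E) F)) u = snd (snd F) u"
  by (cases F) (simp add: glue_restr_def)

end

context glued_half_space
begin

text \<open>
  Each structure map is determined by those of the letters of a reduced word, because \<open>\<nu>\<close> is invertible
  along it; so compatibility propagates along the gallery.
\<close>

lemma glue_homs_from_generators:
  assumes X: "X \<in> glue_objs W C \<Phi> \<nu> P" and Y: "Y \<in> glue_objs W C \<Phi> \<nu> P" and ext: "f \<in> extensional P"
    and f: "\<And>u. u \<in> P \<Longrightarrow> f u \<in> Hom (C u) (fst X u) (fst Y u)"
    and gen: "\<And>k u. k \<in> S \<Longrightarrow> u \<in> P \<Longrightarrow> k \<otimes> u \<in> P \<Longrightarrow>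
      f (k \<otimes> u) \<cdot>[k \<otimes> u] snd X (k, u) = snd Y (k, u) \<cdot>[k \<otimes> u] \<Phi>a k u (f u)"
  shows "f \<in> glue_homs W C \<Phi> P X Y"
proof (rule glue_homI[OF ext f])
  fix w u assume "(w, u) \<in> glue_pairs W P"
  then have "w \<in> carrier W" "u \<in> P" "w \<otimes> u \<in> P" by (auto simp: glue_pairs_def)
  then show "f (w \<otimes> u) \<cdot>[w \<otimes> u] snd X (w, u) = snd Y (w, u) \<cdot>[w \<otimes> u] \<Phi>a w u (f u)"
  proof (induction "len w" arbitrary: w)
    case 0
    then have "w = \<one>" using len_eq_0 by simp
    moreover have u: "u \<in> carrier W" using 0 by simp
    ultimately show ?case
      using glue_objD(3)[OF X] glue_objD(3)[OF Y] f[OF 0(3)] id_left[OF u f[OF 0(3)]]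
        id_right[OF u f[OF 0(3)]] Phi_one_arr[OF u, of "f u"] 0(3) by (simp add: Hom_def)
  next
    case (Suc n)
    then obtain k c where k: "k \<in> S" "c \<in> carrier W" "w = k \<otimes> c" "len w = Suc (len c)"
      using peel[of w] by (metis Zero_not_Suc len_one)
    have u: "u \<in> carrier W" "k \<in> carrier W" using Suc.prems k by auto
    have len: "len (k \<otimes> c) = len k + len c" using k len_gen by simp
    define x z where "x = c \<otimes> u" and "z = k \<otimes> (c \<otimes> u)"
    have wz: "w \<otimes> u = z" using k u by (simp add: z_def m_assoc)
    have xP: "x \<in> P" using half_space_convex[of u k c] Suc.prems k u len by (simp add: x_def)
    have zP: "z \<in> P" using Suc.prems wz by simp
    have cl: "x \<in> carrier W" "z \<in> carrier W" "k \<otimes> x = z" "k \<otimes> c \<otimes> u = z"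
      using xP zP wz k by (simp_all add: x_def z_def)
    have pr: "(k, x) \<in> glue_pairs W P" "(c, u) \<in> glue_pairs W P" "(w, u) \<in> glue_pairs W P"
      using xP zP cl wz k Suc.prems u by (auto simp: glue_pairs_def x_def)
    have wc: "w \<in> carrier W" using Suc.prems by simp
    have x1: "snd X (k, x) \<in> Hom (C z) (\<Phi>o k x (fst X x)) (fst X z)"
      and y1: "snd Y (k, x) \<in> Hom (C z) (\<Phi>o k x (fst Y x)) (fst Y z)"
      using glue_objD(2)[OF X pr(1)] glue_objD(2)[OF Y pr(1)] cl(3) by simp_all
    have x2: "snd X (c, u) \<in> Hom (C x) (\<Phi>o c u (fst X u)) (fst X x)"
      and y2: "snd Y (c, u) \<in> Hom (C x) (\<Phi>o c u (fst Y u)) (fst Y x)"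
      using glue_objD(2)[OF X pr(2)] glue_objD(2)[OF Y pr(2)] by (simp_all add: x_def)
    have x3: "snd X (w, u) \<in> Hom (C z) (\<Phi>o w u (fst X u)) (fst X z)"
      and y3: "snd Y (w, u) \<in> Hom (C z) (\<Phi>o w u (fst Y u)) (fst Y z)"
      using glue_objD(2)[OF X pr(3)] glue_objD(2)[OF Y pr(3)] wz by simp_all
    have n: "\<nu> k c u A \<in> Hom (C z) (\<Phi>o k x (\<Phi>o c u A)) (\<Phi>o w u A)" if "A \<in> Obj (C u)" for A
      using nu_hom[OF u(2) k(2) u(1) that] by (simp add: z_def x_def k(3)[symmetric])
    have aX: "snd X (k, x) \<cdot>[z] \<Phi>a k x (snd X (c, u)) = snd X (w, u) \<cdot>[z] \<nu> k c u (fst X u)"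
      and aY: "snd Y (k, x) \<cdot>[z] \<Phi>a k x (snd Y (c, u)) = snd Y (w, u) \<cdot>[z] \<nu> k c u (fst Y u)"
      using glue_obj_assoc[OF X u(2) k(2) u(1)] glue_obj_assoc[OF Y u(2) k(2) u(1)] xP zP Suc.prems
      by (simp_all add: x_def z_def k(3)[symmetric])
    have g1: "f z \<cdot>[z] snd X (k, x) = snd Y (k, x) \<cdot>[z] \<Phi>a k x (f x)"
      using gen[OF k(1) xP] zP cl(3) by simp
    have IH: "f x \<cdot>[x] snd X (c, u) = snd Y (c, u) \<cdot>[x] \<Phi>a c u (f u)"
      using Suc.hyps(1)[of c] Suc.hyps(2) k Suc.prems xP by (simp add: x_def)
    have Xu: "fst X u \<in> Obj (C u)" "fst Y u \<in> Obj (C u)" using glue_objD(1) X Y Suc.prems by auto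
    have fu: "f u \<in> Hom (C u) (fst X u) (fst Y u)" and fx: "f x \<in> Hom (C x) (fst X x) (fst Y x)"
      and fz: "f z \<in> Hom (C z) (fst X z) (fst Y z)" using f Suc.prems xP zP by auto
    have pk: "\<Phi>a k x y \<in> Hom (C z) (\<Phi>o k x A) (\<Phi>o k x A')" if "y \<in> Hom (C x) A A'" for y A A'
      using Phi_hom[OF u(2) cl(1) that] cl(3) by simp
    have pc: "\<Phi>a c u (f u) \<in> Hom (C x) (\<Phi>o c u (fst X u)) (\<Phi>o c u (fst Y u))"
      using Phi_hom[OF k(2) u(1) fu] by (simp add: x_def)
    have pw: "\<Phi>a w u (f u) \<in> Hom (C z) (\<Phi>o w u (fst X u)) (\<Phi>o w u (fst Y u))"
      using Phi_hom[OF wc u(1) fu] wz by simp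
    have nat: "\<nu> k c u (fst Y u) \<cdot>[z] \<Phi>a k x (\<Phi>a c u (f u)) = \<Phi>a w u (f u) \<cdot>[z] \<nu> k c u (fst X u)"
      using nu_natural[OF u(2) k(2) u(1) fu] by (simp add: x_def z_def k(3)[symmetric])
    have "(f z \<cdot>[z] snd X (w, u)) \<cdot>[z] \<nu> k c u (fst X u) =
        (f z \<cdot>[z] snd X (k, x)) \<cdot>[z] \<Phi>a k x (snd X (c, u))"
      using comp_assoc[OF cl(2) n[OF Xu(1)] x3 fz] comp_assoc[OF cl(2) pk[OF x2] x1 fz] aX by simp
    also have "\<dots> = snd Y (k, x) \<cdot>[z] \<Phi>a k x (f x \<cdot>[x] snd X (c, u))"
      using g1 comp_assoc[OF cl(2) pk[OF x2] pk[OF fx] y1] Phi_comp[OF u(2) cl(1) x2 fx] cl(3) by simp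
    also have "\<dots> = (snd Y (k, x) \<cdot>[z] \<Phi>a k x (snd Y (c, u))) \<cdot>[z] \<Phi>a k x (\<Phi>a c u (f u))"
      using IH comp_assoc[OF cl(2) pk[OF pc] pk[OF y2] y1] cl(3)
        Phi_comp[OF u(2) cl(1) pc y2] by simp
    also have "\<dots> = (snd Y (w, u) \<cdot>[z] \<Phi>a w u (f u)) \<cdot>[z] \<nu> k c u (fst X u)"
      using aY nat comp_assoc[OF cl(2) pk[OF pc] n[OF Xu(2)] y3] comp_assoc[OF cl(2) n[OF Xu(1)] pw y3] by simp
    finally have "f z \<cdot>[z] snd X (w, u) = snd Y (w, u) \<cdot>[z] \<Phi>a w u (f u)"
      using nu_cancel[OF u(2) k(2) u(1) Xu(1) len,
          of "f z \<cdot>[z] snd X (w, u)" "fst Y z" "snd Y (w, u) \<cdot>[z] \<Phi>a w u (f u)"]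
        comp_hom[OF cl(2) x3 fz] comp_hom[OF cl(2) pw y3]
      by (simp add: z_def[symmetric] k(3)[symmetric])
    then show ?case by (simp add: wz)
  qed
qed

abbreviation coset :: "'w set \<Rightarrow> 'w \<Rightarrow> 'w set" where "coset J u \<equiv> parabolic (S - J) #> u"

abbreviation "index \<equiv> nonempty_subsets S"

abbreviation "cat_on J \<equiv> C_sub W S C \<Phi> \<nu> P J"

abbreviation "restr_on J K \<equiv> restr_JK W S P J K"

lemma flag_index: "flag J u \<Longrightarrow> J \<in> index"
  using flagD by (auto simp: nonempty_subsets_def)

lemma adm_cosets_iff: "J \<in> index \<Longrightarrow> E \<in> adm_cosets W S P J \<longleftrightarrow> (\<exists>u. flag J u \<and> E = coset J u)"
  by (auto simp: adm_cosets_def flag_def vertices_def nonempty_subsets_def)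

lemma adm_cosetE:
  assumes "J \<in> index" "E \<in> adm_cosets W S P J"
  obtains u where "flag J u" "E = coset J u"
  using assms by (auto simp: adm_cosets_iff)

lemma flag_adm: "flag J u \<Longrightarrow> coset J u \<in> adm_cosets W S P J"
  using adm_cosets_iff[OF flag_index] by auto

lemma mem_coset: "u \<in> carrier W \<Longrightarrow> u \<in> coset J u"
  unfolding r_coset_def using generate.one[of W "S - J"] by force

lemma coset_member:
  assumes "flag J u" "v \<in> coset J u"
  shows "flag J v" "coset J v = coset J u"
proof -
  obtain w where w: "w \<in> parabolic (S - J)" "v = w \<otimes> u" using assms(2) by (auto simp: r_coset_def)
  then show "flag J v" "coset J v = coset J u"
    using flag_shift[OF assms(1)] coset_shift[of "S - J" w u] flagD[OF assms(1)] by auto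
qed

lemma coset_in_P: "flag J u \<Longrightarrow> coset J u \<subseteq> P"
  using coset_member flagD by blast

lemma coset_carrier: "flag J u \<Longrightarrow> coset J u \<subseteq> carrier W"
  using coset_in_P P_closed by blast

lemma coset_antimono: "J \<subseteq> K \<Longrightarrow> coset K u \<subseteq> coset J u"
  using parabolic_mono[of "S - K" "S - J"] by (auto simp: r_coset_def)

lemma coset_pairs:
  assumes "flag J u" "w \<in> parabolic (S - J)"
  shows "(w, u) \<in> glue_pairs W (coset J u)"
  using flag_shift[OF assms] mem_coset[of u J] flagD[OF assms(1)] assms(2)
  by (auto simp: glue_pairs_def r_coset_def)

lemma coset_pairsD:
  assumes "flag J u" "(w, v) \<in> glue_pairs W (coset J u)"
  shows "flag J v" "coset J v = coset J u" "w \<in> parabolic (S - J)"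
proof -
  have v: "v \<in> coset J u" "w \<otimes> v \<in> coset J u" "w \<in> carrier W" using assms(2) by (auto simp: glue_pairs_def)
  show f: "flag J v" and c: "coset J v = coset J u" using coset_member[OF assms(1) v(1)] by auto
  have "w \<otimes> v \<in> coset J v" using v c by simp
  then obtain x where x: "x \<in> parabolic (S - J)" "w \<otimes> v = x \<otimes> v" by (auto simp: r_coset_def)
  moreover have "x \<in> carrier W" "v \<in> carrier W"
    using parabolic_closed[of "S - J" x] x(1) flagD[OF f] by auto
  ultimately show "w \<in> parabolic (S - J)" using v(3) by simp
qed

lemma coset_product:
  assumes "J \<subseteq> K" "K \<subseteq> S" "u \<in> carrier W"
  shows "parabolic (S - J) <#> coset K u = coset J u"
proof
  have s: "subgroup (parabolic (S - J)) W" by (rule parabolic_subgroup) auto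
  show "parabolic (S - J) <#> coset K u \<subseteq> coset J u"
  proof
    fix y assume "y \<in> parabolic (S - J) <#> coset K u"
    then obtain a b where ab: "a \<in> parabolic (S - J)" "b \<in> parabolic (S - K)" "y = a \<otimes> (b \<otimes> u)"
      by (auto simp: set_mult_def r_coset_def)
    have b: "b \<in> parabolic (S - J)" using ab(2) parabolic_mono[of "S - K" "S - J"] assms(1) by blast
    then have "y = (a \<otimes> b) \<otimes> u" using ab assms(3) subgroup.mem_carrier[OF s] by (simp add: m_assoc)
    then show "y \<in> coset J u" using subgroup.m_closed[OF s ab(1) b] by (auto simp: r_coset_def)
  qed
  show "coset J u \<subseteq> parabolic (S - J) <#> coset K u"
  proof
    fix y assume "y \<in> coset J u"
    then obtain h where "h \<in> parabolic (S - J)" "y = h \<otimes> u" by (auto simp: r_coset_def)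
    then show "y \<in> parabolic (S - J) <#> coset K u"
      using mem_coset[OF assms(3), of K] by (auto simp: set_mult_def)
  qed
qed

lemma restr_on_obj:
  fixes A :: "'w set \<Rightarrow> ('w, 'o, 'm) glue_obj"
  assumes "flag K u" "J \<subseteq> K"
  shows "omap (restr_on J K) A (coset K u) = glue_restr_obj W (coset K u) (A (coset J u))"
  using assms flagD[OF assms(1)] coset_product[OF assms(2)] flag_adm
  by (simp add: restr_JK_def glue_restr_def)

lemma restr_on_arr:
  fixes f :: "'w set \<Rightarrow> ('w, 'o, 'm) glue_arr"
  assumes "flag K u" "J \<subseteq> K"
  shows "amap (restr_on J K) f (coset K u) = amap (glue_restr W (coset K u)) (f (coset J u))"
  using assms flagD[OF assms(1)] coset_product[OF assms(2)] flag_adm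
  by (simp add: restr_JK_def)

lemma adm_carrier: "J \<in> index \<Longrightarrow> E \<in> adm_cosets W S P J \<Longrightarrow> E \<subseteq> carrier W"
  using coset_carrier by (auto elim!: adm_cosetE)

lemma P_sub_carrier: "P \<subseteq> carrier W"
  using P_closed by blast

lemma category_cat_on: "J \<in> index \<Longrightarrow> category (cat_on J)"
  unfolding C_sub_def using adm_carrier by (intro category_sum_cat category_glue_cat)

lemma restr_on_functor:
  assumes J: "J \<in> index" and K: "K \<in> index" and JK: "J \<subseteq> K"
  shows "is_functor (cat_on J) (cat_on K) (restr_on J K)"
proof -
  define F :: "'w set \<Rightarrow> ('w set \<Rightarrow> ('w, 'o, 'm) glue_obj, 'w set \<Rightarrow> ('w, 'o, 'm) glue_arr,
      ('w, 'o, 'm) glue_obj, ('w, 'o, 'm) glue_arr) func"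
    where "F E = comp_func (glue_restr W E)
      \<lparr>omap = (\<lambda>A. A (parabolic (S - J) <#> E)), amap = (\<lambda>f. f (parabolic (S - J) <#> E))\<rparr>" for E
  have "is_functor (cat_on J) (glue E) (F E)" if E: "E \<in> adm_cosets W S P K" for E
  proof -
    obtain u where u: "flag K u" "E = coset K u" by (rule adm_cosetE[OF K E])
    have fJ: "flag J u" using flag_sub[OF u(1) JK] J by (auto simp: nonempty_subsets_def)
    have e: "parabolic (S - J) <#> E = coset J u" using coset_product[OF JK] flagD[OF u(1)] u(2) by simp
    have "is_functor (cat_on J) (glue (coset J u)) \<lparr>omap = (\<lambda>A. A (coset J u)), amap = (\<lambda>f. f (coset J u))\<rparr>"
      unfolding C_sub_def using category_glue_cat[OF adm_carrier[OF J]] flag_adm[OF fJ]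
      by (intro projection_functor)
    then show ?thesis unfolding F_def e
      using comp_functor restriction_functor[OF coset_carrier[OF fJ], of E] coset_antimono[OF JK] u(2) by blast
  qed
  from functor_to_sum_cat[OF category_cat_on[OF J] this]
  show ?thesis by (simp add: C_sub_def[of _ _ _ _ _ _ K] F_def comp_func_def restr_JK_def)
qed

sublocale diagram: category_diagram index cat_on restr_on
  by (rule category_diagram.intro[OF category_cat_on restr_on_functor])

abbreviation "total_cat \<equiv> C_tot W S C \<Phi> \<nu> P"

abbreviation "tot_obj \<equiv> restr_tot_obj W S C \<Phi> \<nu> P"

abbreviation "tot \<equiv> restr_tot W S C \<Phi> \<nu> P"

lemma restr_J_functor:
  assumes "J \<in> index"
  shows "is_functor (glue P) (cat_on J) (restr_J W S P J)"
proof -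
  have "is_functor (glue P) (glue E) (glue_restr W E)" if E: "E \<in> adm_cosets W S P J" for E
  proof -
    obtain u where u: "flag J u" "E = coset J u" by (rule adm_cosetE[OF assms E])
    show ?thesis using restriction_functor[OF P_sub_carrier coset_in_P[OF u(1)]] u(2) by simp
  qed
  from functor_to_sum_cat[OF category_glue_cat[OF P_sub_carrier] this]
  show ?thesis by (simp add: C_sub_def restr_J_def)
qed

lemma restr_J_restr_on:
  fixes X :: "('w, 'o, 'm) glue_obj" and F :: "('w, 'o, 'm) glue_arr"
  assumes "J \<in> index" "K \<in> index" "J \<subseteq> K"
  shows "omap (restr_on J K) (omap (restr_J W S P J) X) = omap (restr_J W S P K) X"
    and "amap (restr_on J K) (amap (restr_J W S P J) F) = amap (restr_J W S P K) F"
proof -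
  have k: "parabolic (S - J) <#> E \<in> adm_cosets W S P J" "E \<subseteq> parabolic (S - J) <#> E"
    if E: "E \<in> adm_cosets W S P K" for E
  proof -
    obtain u where u: "flag K u" "E = coset K u" by (rule adm_cosetE[OF assms(2) E])
    have "flag J u" using flag_sub[OF u(1)] assms by (auto simp: nonempty_subsets_def)
    moreover have "parabolic (S - J) <#> E = coset J u" using coset_product[OF assms(3)] flagD[OF u(1)] u(2) by simp
    ultimately show "parabolic (S - J) <#> E \<in> adm_cosets W S P J" "E \<subseteq> parabolic (S - J) <#> E"
      using flag_adm coset_antimono[OF assms(3)] u(2) by auto
  qed
  show "omap (restr_on J K) (omap (restr_J W S P J) X) = omap (restr_J W S P K) X"
    using k by (auto simp: restr_JK_def restr_J_def glue_restr_def restriction_restriction intro!: restrict_ext)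
  show "amap (restr_on J K) (amap (restr_J W S P J) F) = amap (restr_J W S P K) F"
    using k by (cases F)
      (auto simp: restr_JK_def restr_J_def glue_restr_def restriction_restriction Int_absorb1 intro!: restrict_ext)
qed

lemma fst_tot_obj: "J \<in> index \<Longrightarrow> fst (tot_obj X) J = omap (restr_J W S P J) X"
  by (simp add: restr_tot_obj_def)

lemma snd_tot_obj: "(J, K) \<in> incl_pairs index \<Longrightarrow>
    snd (tot_obj X) (J, K) = Ident (cat_on K) (omap (restr_J W S P K) X)"
  by (simp add: restr_tot_obj_def)

lemma tot_obj_section:
  assumes X: "X \<in> glue_objs W C \<Phi> \<nu> P"
  shows "tot_obj X \<in> section_objs index cat_on restr_on"
proof -
  have X': "X \<in> Obj (glue P)" using X by (simp add: glue_cat_def)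
  have o: "omap (restr_J W S P J) X \<in> Obj (cat_on J)" if "J \<in> index" for J
    using functor_Obj[OF restr_J_functor[OF that] X'] .
  have i: "Ident (cat_on K) (omap (restr_J W S P K) X) \<in>
      Hom (cat_on K) (omap (restr_J W S P K) X) (omap (restr_J W S P K) X)"
    if "K \<in> index" for K using category.Ident_closed[OF category_cat_on o] that by blast
  have iso: "is_iso (cat_on K) (Ident (cat_on K) (omap (restr_J W S P K) X))" if "K \<in> index" for K
    using category.is_iso_Ident[OF category_cat_on o] that by blast
  have coc: "Ident (cat_on L) (omap (restr_J W S P L) X) =
      Comp (cat_on L) (amap (restr_on K L) (Ident (cat_on K) (omap (restr_J W S P K) X)))
        (Ident (cat_on L) (omap (restr_J W S P L) X))"
    if "K \<in> index" "L \<in> index" "K \<subseteq> L" for K L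
    using functor_Ident[OF restr_on_functor[OF that] o[OF that(1)]] restr_J_restr_on(1)[OF that]
      category.Ident_left[OF category_cat_on[OF that(2)] i[OF that(2)]] by simp
  show ?thesis
    unfolding section_objs_def restr_tot_obj_def using o i iso coc restr_J_restr_on(1)
    by (auto simp: incl_pairs_def PiE_iff)
qed

lemma amap_tot:
  "amap tot (X, Y, f) = (tot_obj X, tot_obj Y, \<lambda>J \<in> index. amap (restr_J W S P J) (X, Y, f))"
  by (simp add: restr_tot_def)

lemma tot_functor: "is_functor (glue P) total_cat tot"
proof (rule is_functorI)
  show "category (glue P)" using category_glue_cat[OF P_sub_carrier] .
  show "category total_cat" using diagram.category_section_cat by (simp add: C_tot_def)
  show "omap tot X \<in> Obj total_cat" if "X \<in> Obj (glue P)" for X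
    using that tot_obj_section by (simp add: glue_cat_def restr_tot_def C_tot_def section_cat_def)
next
  fix F X Y assume F: "F \<in> Hom (glue P) X Y"
  then obtain f where f: "F = (X, Y, f)" "X \<in> glue_objs W C \<Phi> \<nu> P" "Y \<in> glue_objs W C \<Phi> \<nu> P"
    by (auto simp: Hom_glue_cat)
  have h: "amap (restr_J W S P J) F \<in> Hom (cat_on J) (omap (restr_J W S P J) X) (omap (restr_J W S P J) Y)"
    if "J \<in> index" for J using functor_Hom[OF restr_J_functor[OF that] F] .
  have "(\<lambda>J \<in> index. amap (restr_J W S P J) F) \<in> section_homs index cat_on restr_on (tot_obj X) (tot_obj Y)"
  proof (rule diagram.section_homI)
    fix J K assume p: "(J, K) \<in> incl_pairs index"
    have q: "J \<in> index" "K \<in> index" "J \<subseteq> K" using diagram.incl_pairsD[OF p] by auto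
    show "Comp (cat_on K) (snd (tot_obj Y) (J, K)) ((\<lambda>J \<in> index. amap (restr_J W S P J) F) K) =
      Comp (cat_on K) (amap (restr_on J K) ((\<lambda>J \<in> index. amap (restr_J W S P J) F) J)) (snd (tot_obj X) (J, K))"
      using snd_tot_obj[OF p] restr_J_restr_on(2)[OF q] q
        category.Ident_left[OF category_cat_on[OF q(2)] h[OF q(2)]]
        category.Ident_right[OF category_cat_on[OF q(2)] h[OF q(2)]] by simp
  qed (use h in \<open>auto simp: fst_tot_obj\<close>)
  then show "amap tot F \<in> Hom total_cat (omap tot X) (omap tot Y)"
    using f tot_obj_section by (simp add: restr_tot_def C_tot_def Hom_section_cat)
next
  fix X assume "X \<in> Obj (glue P)"
  then have "amap (restr_J W S P J) (Ident (glue P) X) = Ident (cat_on J) (omap (restr_J W S P J) X)"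
    if "J \<in> index" for J using functor_Ident[OF restr_J_functor[OF that]] by blast
  moreover obtain i where "Ident (glue P) X = (X, X, i)" by (simp add: glue_cat_def)
  moreover have "omap tot X = tot_obj X" by (simp add: restr_tot_def)
  ultimately show "amap tot (Ident (glue P) X) = Ident total_cat (omap tot X)"
    by (simp add: amap_tot C_tot_def section_cat_def fst_tot_obj cong: restrict_cong)
next
  fix F G X Y Z assume F: "F \<in> Hom (glue P) X Y" and G: "G \<in> Hom (glue P) Y Z"
  obtain f g where fg: "F = (X, Y, f)" "G = (Y, Z, g)" using F G by (auto simp: Hom_glue_cat)
  obtain k where k: "Comp (glue P) G F = (X, Z, k)" using fg by (simp add: glue_cat_def)
  have "amap (restr_J W S P J) (X, Z, k) =
      Comp (cat_on J) (amap (restr_J W S P J) (Y, Z, g)) (amap (restr_J W S P J) (X, Y, f))"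
    if "J \<in> index" for J
    using functor_Comp[OF restr_J_functor[OF that] F G] by (simp add: fg[symmetric] k[symmetric])
  then have "amap tot (X, Z, k) = Comp total_cat (amap tot (Y, Z, g)) (amap tot (X, Y, f))"
    by (simp add: amap_tot C_tot_def section_cat_def cong: restrict_cong)
  then show "amap tot (Comp (glue P) G F) = Comp total_cat (amap tot G) (amap tot F)"
    by (simp add: fg[symmetric] k[symmetric])
qed

text \<open>
  Each chamber lies in the star of some interior face, so no component of an arrow is lost.
\<close>

lemma tot_faithful:
  assumes "F \<in> Hom (glue P) X Y" "F' \<in> Hom (glue P) X Y" "amap tot F = amap tot F'"
  shows "F = F'"
proof -
  obtain f f' where f: "F = (X, Y, f)" "f \<in> glue_homs W C \<Phi> P X Y"
    "F' = (X, Y, f')" "f' \<in> glue_homs W C \<Phi> P X Y"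
    using assms(1,2) by (auto simp: Hom_glue_cat)
  have "f u = f' u" if u: "u \<in> P" for u
  proof -
    let ?J = "vertices u" and ?E = "coset (vertices u) u"
    have fl: "flag ?J u" using flag_vertices[OF u] .
    have eq: "(\<lambda>J \<in> index. amap (restr_J W S P J) F) = (\<lambda>J \<in> index. amap (restr_J W S P J) F')"
      using assms(3) f by (simp add: restr_tot_def)
    have "amap (restr_J W S P ?J) F = amap (restr_J W S P ?J) F'"
      using fun_cong[OF eq, of ?J] flag_index[OF fl] by simp
    then have "amap (restr_J W S P ?J) F ?E = amap (restr_J W S P ?J) F' ?E" by simp
    then have "amap (glue_restr W ?E) F = amap (glue_restr W ?E) F'"
      using flag_adm[OF fl] by (simp add: restr_J_def)
    then show "f u = f' u"
      using amap_restriction_component[of u ?E F] amap_restriction_component[of u ?E F'] mem_coset[of u ?J] u f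
      by simp
  qed
  then have "f = f'" using f(2,4) by (intro extensionalityI[of _ P]) (auto simp: glue_homs_def PiE_iff)
  then show ?thesis using f by simp
qed

text \<open>
  The component at \<open>u\<close> is read off on the largest interior face of \<open>u\<close>.  Compatibility of the given arrow
  with the identifications makes all other readings equal to it, and two adjacent chambers share an
  interior vertex, on whose star the given arrow commutes with the structure map.
\<close>

lemma tot_full:
  assumes X: "X \<in> glue_objs W C \<Phi> \<nu> P" and Y: "Y \<in> glue_objs W C \<Phi> \<nu> P"
    and g: "g \<in> Hom total_cat (omap tot X) (omap tot Y)"
  shows "\<exists>F \<in> Hom (glue P) X Y. amap tot F = g"
proof -
  obtain h where h: "g = (tot_obj X, tot_obj Y, h)" "h \<in> section_homs index cat_on restr_on (tot_obj X) (tot_obj Y)"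
    using g by (auto simp: C_tot_def Hom_section_cat restr_tot_def)
  have hJ: "h J \<in> Hom (cat_on J) (omap (restr_J W S P J) X) (omap (restr_J W S P J) Y)" if "J \<in> index" for J
    using diagram.section_homD(1)[OF h(2) that] that by (simp add: fst_tot_obj)
  \<comment> \<open>the given arrow over the star of the face \<open>J\<close> of \<open>u\<close>\<close>
  define \<phi> where "\<phi> J u = snd (snd (h J (coset J u)))" for J u
  have hE: "h J (coset J u) = (glue_restr_obj W (coset J u) X, glue_restr_obj W (coset J u) Y, \<phi> J u)"
    "\<phi> J u \<in> glue_homs W C \<Phi> (coset J u) (glue_restr_obj W (coset J u) X) (glue_restr_obj W (coset J u) Y)"
    if fl: "flag J u" for J u
  proof -
    have "h J (coset J u) \<in> Hom (glue (coset J u)) (glue_restr_obj W (coset J u) X) (glue_restr_obj W (coset J u) Y)"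
      using sum_cat_Hom_component[OF hJ[OF flag_index[OF fl], unfolded C_sub_def] flag_adm[OF fl]] flag_adm[OF fl]
      by (simp add: restr_J_def glue_restr_def)
    then show "h J (coset J u) = (glue_restr_obj W (coset J u) X, glue_restr_obj W (coset J u) Y, \<phi> J u)"
      "\<phi> J u \<in> glue_homs W C \<Phi> (coset J u) (glue_restr_obj W (coset J u) X) (glue_restr_obj W (coset J u) Y)"
      by (auto simp: Hom_glue_cat \<phi>_def)
  qed
  \<comment> \<open>the identifications in \<open>tot_obj\<close> are identities, so the readings at \<open>J\<close> and \<open>K\<close> are equal\<close>
  have compat: "\<phi> K u u = \<phi> J u u" if fl: "flag K u" and JK: "J \<subseteq> K" "J \<noteq> {}" for J K u
  proof -
    have q: "J \<in> index" "K \<in> index" using flag_index flag_sub[OF fl JK] fl by auto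
    then have p: "(J, K) \<in> incl_pairs index" using JK by (simp add: incl_pairs_def)
    have "amap (restr_on J K) (h J) \<in> Hom (cat_on K) (omap (restr_J W S P K) X) (omap (restr_J W S P K) Y)"
      using functor_Hom[OF restr_on_functor[OF q JK(1)] hJ[OF q(1)]] restr_J_restr_on(1)[OF q JK(1)] by simp
    then have "h K = amap (restr_on J K) (h J)"
      using diagram.section_homD(2)[OF h(2) p] snd_tot_obj[OF p]
        category.Ident_left[OF category_cat_on[OF q(2)] hJ[OF q(2)]]
        category.Ident_right[OF category_cat_on[OF q(2)]] by simp
    then have "h K (coset K u) = amap (glue_restr W (coset K u)) (h J (coset J u))"
      using restr_on_arr[OF fl JK(1), of "h J"] by simp
    then show ?thesis
      using amap_restriction_component[of u "coset K u" "h J (coset J u)"] mem_coset[of u K] flagD[OF fl]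
      by (simp add: \<phi>_def)
  qed
  define f where "f = (\<lambda>u \<in> P. \<phi> (vertices u) u u)"
  have f: "\<phi> J u v = f v" if "flag J u" "v \<in> coset J u" for J u v
  proof -
    note c = coset_member[OF that]
    have "\<phi> J u v = \<phi> J v v" using c(2) by (simp add: \<phi>_def)
    also have "\<dots> = f v"
      using compat[OF flag_vertices, of v J] flagD[OF c(1)] by (simp add: f_def)
    finally show ?thesis .
  qed
  have fh: "f u \<in> Hom (C u) (fst X u) (fst Y u)" if u: "u \<in> P" for u
  proof -
    note fl = flag_vertices[OF u]
    have "u \<in> coset (vertices u) u" using mem_coset u by simp
    then show ?thesis
      using glue_homD(1)[OF hE(2)[OF fl], of u] f[OF fl, of u] by (simp add: fst_restriction)
  qed
  have "f \<in> glue_homs W C \<Phi> P X Y"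
  proof (rule glue_homs_from_generators[OF X Y _ fh])
    fix k u assume k: "k \<in> S" "u \<in> P" "k \<otimes> u \<in> P"
    then obtain j where fl: "flag {j} u" and kj: "k \<in> parabolic (S - {j})"
      using local_pair_gen[OF k] by (auto simp: local_pair_iff_flag)
    note p = coset_pairs[OF fl kj]
    have m: "u \<in> coset {j} u" "k \<otimes> u \<in> coset {j} u" using p by (auto simp: glue_pairs_def)
    show "f (k \<otimes> u) \<cdot>[k \<otimes> u] snd X (k, u) = snd Y (k, u) \<cdot>[k \<otimes> u] \<Phi>a k u (f u)"
      using glue_homD(2)[OF hE(2)[OF fl] p] f[OF fl m(1)] f[OF fl m(2)] snd_restriction[OF p] by simp
  qed (unfold f_def, rule restrict_extensional)
  then have F: "(X, Y, f) \<in> Hom (glue P) X Y" using X Y by (simp add: Hom_glue_cat)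
  have "amap (restr_J W S P J) (X, Y, f) = h J" if J: "J \<in> index" for J
  proof -
    have "h J \<in> extensional (adm_cosets W S P J)"
      using hJ[OF J] by (auto simp: C_sub_def Hom_def sum_cat_def PiE_iff)
    moreover have "amap (glue_restr W E) (X, Y, f) = h J E" if E: "E \<in> adm_cosets W S P J" for E
    proof -
      obtain u where u: "flag J u" "E = coset J u" by (rule adm_cosetE[OF J E])
      have "\<phi> J u \<in> extensional E" using hE(2)[OF u(1)] u(2) by (simp add: glue_homs_def PiE_iff)
      then have "restrict f E = \<phi> J u" using f[OF u(1)] u(2) by (intro restrict_eqI) auto
      then show ?thesis using hE(1)[OF u(1)] u(2) by (simp add: glue_restr_def)
    qed
    ultimately show ?thesis by (simp add: restr_J_def restrict_eqI)
  qed
  moreover have "h \<in> extensional index" using h(2) by (simp add: section_homs_def PiE_iff)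
  ultimately have "(\<lambda>J \<in> index. amap (restr_J W S P J) (X, Y, f)) = h" by (intro restrict_eqI) auto
  then have "amap tot (X, Y, f) = g" using h(1) by (simp add: restr_tot_def)
  then show ?thesis using F by blast
qed

text \<open>
  The section is rewritten in components, the glued object comes from \<open>glued_object_exists\<close>, and the
  comparisons \<open>T J\<close> with the largest interior face form the isomorphism to the given section.
\<close>

lemma tot_essentially_surjective:
  assumes Y: "Y \<in> section_objs index cat_on restr_on"
  shows "\<exists>X \<in> glue_objs W C \<Phi> \<nu> P. \<exists>e \<in> Hom total_cat (omap tot X) Y. is_iso total_cat e"
proof -
  define N where "N J u = fst (fst Y J (coset J u)) u" for J u
  define M where "M J w u = snd (fst Y J (coset J u)) (w, u)" for J w u
  define t where "t J K u = snd (snd (snd Y (J, K) (coset K u))) u" for J K u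
  have A: "fst Y J (coset J u) \<in> glue_objs W C \<Phi> \<nu> (coset J u)" if fl: "flag J u" for J u
    using diagram.section_objD(1)[OF Y flag_index[OF fl]] flag_adm[OF fl]
    by (auto simp: C_sub_def sum_cat_def glue_cat_def PiE_iff)
  have p: "(J, K) \<in> incl_pairs index" if "flag K u" "J \<subseteq> K" "J \<noteq> {}" for J K u
    using flag_index[OF that(1)] flag_index[OF flag_sub[OF that]] that by (simp add: incl_pairs_def)
  have a: "snd Y (J, K) (coset K u) \<in>
      Hom (glue (coset K u)) (fst Y K (coset K u)) (glue_restr_obj W (coset K u) (fst Y J (coset J u)))"
    if "flag K u" "J \<subseteq> K" "J \<noteq> {}" for J K u
    using sum_cat_Hom_component[OF diagram.section_objD(2)[OF Y p[OF that], unfolded C_sub_def] flag_adm[OF that(1)]]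
      restr_on_obj[OF that(1,2)] by simp
  have shift: "coset J (w \<otimes> u) = coset J u" if "flag J u" "w \<in> parabolic (S - J)" for J w u
    using coset_shift[of "S - J" w u] flagD[OF that(1)] that(2) by simp
  interpret component_data W S s C \<Phi> \<nu> N M t
  proof
    fix J u assume fl: "flag J u"
    have u: "u \<in> coset J u" using mem_coset flagD[OF fl] by blast
    show "N J u \<in> Obj (C u)" using glue_objD(1)[OF A[OF fl] u] by (simp add: N_def)
    show "M J \<one> u = Ident (C u) (N J u)" using glue_objD(3)[OF A[OF fl] u] by (simp add: N_def M_def)
    fix w assume w: "w \<in> parabolic (S - J)"
    show "M J w u \<in> Hom (C (w \<otimes> u)) (\<Phi>o w u (N J u)) (N J (w \<otimes> u))"
      using glue_objD(2)[OF A[OF fl] coset_pairs[OF fl w]] shift[OF fl w] by (simp add: N_def M_def)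
    fix w' assume w': "w' \<in> parabolic (S - J)"
    note s' = flag_shift[OF fl w']
    note s'' = flag_shift[OF s'(1) w]
    have m: "w' \<otimes> u \<in> coset J u" "w \<otimes> (w' \<otimes> u) \<in> coset J u"
      using coset_pairs[OF fl w'] coset_pairs[OF s'(1) w] shift[OF fl w'] by (auto simp: glue_pairs_def)
    show "M J w (w' \<otimes> u) \<cdot>[w \<otimes> (w' \<otimes> u)] \<Phi>a w (w' \<otimes> u) (M J w' u) =
        M J (w \<otimes> w') u \<cdot>[w \<otimes> (w' \<otimes> u)] \<nu> w w' u (N J u)"
      using glue_obj_assoc[OF A[OF fl] s''(2) s'(2) _ u m] flagD[OF fl] shift[OF fl w']
      by (simp add: N_def M_def)
  next
    fix J K u assume fl: "flag K u" and JK: "J \<subseteq> K" "J \<noteq> {}"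
    let ?E = "coset K u"
    have u: "u \<in> ?E" using mem_coset flagD[OF fl] by blast
    have ev: "is_functor (glue ?E) (C u) \<lparr>omap = (\<lambda>X. fst X u), amap = (\<lambda>F. snd (snd F) u)\<rparr>"
      using evaluation_functor[OF coset_carrier[OF fl] u] .
    show "t J K u \<in> Hom (C u) (N K u) (N J u)"
      using functor_Hom[OF ev a[OF fl JK]] u by (simp add: t_def N_def fst_restriction)
    have "is_iso (sum_cat (adm_cosets W S P K) glue) (snd Y (J, K))"
      using diagram.section_objD(3)[OF Y p[OF fl JK]] by (simp add: C_sub_def)
    then have "is_iso (glue ?E) (snd Y (J, K) ?E)"
      using functor_iso[OF projection_functor[OF category_glue_cat[OF adm_carrier[OF flag_index[OF fl]]] flag_adm[OF fl]]]
        diagram.section_objD(2)[OF Y p[OF fl JK], unfolded C_sub_def] by fastforce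
    then show "is_iso (C u) (t J K u)"
      using functor_iso[OF ev _ a[OF fl JK]] by (simp add: t_def)
    fix w assume w: "w \<in> parabolic (S - K)"
    have "snd (snd (snd Y (J, K) ?E)) \<in>
        glue_homs W C \<Phi> ?E (fst Y K ?E) (glue_restr_obj W ?E (fst Y J (coset J u)))"
      using a[OF fl JK] by (auto simp: Hom_glue_cat)
    from glue_homD(2)[OF this coset_pairs[OF fl w]]
    show "t J K (w \<otimes> u) \<cdot>[w \<otimes> u] M K w u = M J w u \<cdot>[w \<otimes> u] \<Phi>a w u (t J K u)"
      using shift[OF fl w] snd_restriction[OF coset_pairs[OF fl w]] by (simp add: t_def M_def)
  next
    fix J K L u assume fl: "flag L u" and KL: "K \<subseteq> L" and JK: "J \<subseteq> K" "J \<noteq> {}"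
    have K: "K \<noteq> {}" using JK by blast
    have fK: "flag K u" using flag_sub[OF fl KL K] .
    note i = flag_index[OF flag_sub[OF fK JK]] flag_index[OF fK] flag_index[OF fl]
    have "snd Y (J, L) = Comp (cat_on L) (amap (restr_on K L) (snd Y (J, K))) (snd Y (K, L))"
      using diagram.section_obj_cocycle[OF Y i JK(1) KL] .
    then have "snd Y (J, L) (coset L u) = Comp (glue (coset L u))
        (amap (glue_restr W (coset L u)) (snd Y (J, K) (coset K u))) (snd Y (K, L) (coset L u))"
      using flag_adm[OF fl] restr_on_arr[OF fl KL, of "snd Y (J, K)"] by (simp add: C_sub_def Comp_sum_cat)
    moreover have "u \<in> coset L u" using mem_coset flagD[OF fl] by blast
    ultimately show "t J L u = t J K u \<cdot>[u] t K L u"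
      by (simp add: t_def glue_cat_Comp_component amap_restriction_component)
  qed
  obtain X where X: "X \<in> glue_objs W C \<Phi> \<nu> P" and XB: "\<And>u. u \<in> P \<Longrightarrow> fst X u = B u"
    and XT: "\<And>J u w. flag J u \<Longrightarrow> w \<in> parabolic (S - J) \<Longrightarrow>
      T J (w \<otimes> u) \<cdot>[w \<otimes> u] snd X (w, u) = M J w u \<cdot>[w \<otimes> u] \<Phi>a w u (T J u)"
    using glued_object_exists by blast
  define e where "e = (\<lambda>J \<in> index. \<lambda>E \<in> adm_cosets W S P J.
    (glue_restr_obj W E X, fst Y J E, \<lambda>v \<in> E. T J v))"
  have eE: "e J (coset J u) = (glue_restr_obj W (coset J u) X, fst Y J (coset J u), \<lambda>v \<in> coset J u. T J v)"
    if "flag J u" for J u using flag_index[OF that] flag_adm[OF that] by (simp add: e_def)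
  have gh: "(\<lambda>v \<in> coset J u. T J v) \<in>
      glue_homs W C \<Phi> (coset J u) (glue_restr_obj W (coset J u) X) (fst Y J (coset J u))"
    if fl: "flag J u" for J u
  proof (rule glue_homI)
    fix v assume v: "v \<in> coset J u"
    note c = coset_member[OF fl v]
    show "(\<lambda>v \<in> coset J u. T J v) v \<in> Hom (C v) (fst (glue_restr_obj W (coset J u) X) v) (fst (fst Y J (coset J u)) v)"
      using v T_hom[OF c(1)] XB[of v] flagD[OF c(1)] c(2) by (simp add: fst_restriction N_def)
  next
    fix w v assume q: "(w, v) \<in> glue_pairs W (coset J u)"
    note c = coset_pairsD[OF fl q]
    show "(\<lambda>v \<in> coset J u. T J v) (w \<otimes> v) \<cdot>[w \<otimes> v] snd (glue_restr_obj W (coset J u) X) (w, v) =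
        snd (fst Y J (coset J u)) (w, v) \<cdot>[w \<otimes> v] \<Phi>a w v ((\<lambda>v \<in> coset J u. T J v) v)"
      using XT[OF c(1,3)] snd_restriction[OF q] q c(2) by (simp add: M_def glue_pairs_def)
  qed simp
  have eH: "e J \<in> Hom (cat_on J) (omap (restr_J W S P J) X) (fst Y J)" if J: "J \<in> index" for J
  proof -
    have ext: "fst Y J \<in> extensional (adm_cosets W S P J)"
      using diagram.section_objD(1)[OF Y J] by (auto simp: C_sub_def sum_cat_def PiE_iff)
    have "e J E \<in> Hom (glue E) (glue_restr_obj W E X) (fst Y J E)" if E: "E \<in> adm_cosets W S P J" for E
    proof -
      obtain u where u: "flag J u" "E = coset J u" by (rule adm_cosetE[OF J E])
      show ?thesis
        using eE[OF u(1)] gh[OF u(1)] A[OF u(1)] restriction_obj[OF P_sub_carrier coset_in_P[OF u(1)] X] u(2)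
        by (simp add: Hom_glue_cat)
    qed
    moreover have "e J \<in> extensional (adm_cosets W S P J)" using J by (simp add: e_def)
    ultimately show ?thesis
      unfolding C_sub_def using ext
      by (subst Hom_sum_cat) (auto simp: restr_J_def glue_restr_def PiE_iff)
  qed
  have "e \<in> section_homs index cat_on restr_on (tot_obj X) Y"
  proof (rule diagram.section_homI)
    fix J assume "J \<in> index"
    then show "e J \<in> Hom (cat_on J) (fst (tot_obj X) J) (fst Y J)" using eH by (simp add: fst_tot_obj)
  next
    fix J K assume q: "(J, K) \<in> incl_pairs index"
    then have JK: "J \<in> index" "K \<in> index" "J \<subseteq> K" "J \<noteq> {}"
      by (auto simp: incl_pairs_def nonempty_subsets_def)
    note Re = functor_Hom[OF restr_on_functor[OF JK(1-3)] eH[OF JK(1)]]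
    have "Comp (cat_on K) (amap (restr_on J K) (e J)) (snd (tot_obj X) (J, K)) = amap (restr_on J K) (e J)"
      using category.Ident_right[OF category_cat_on[OF JK(2)] Re] snd_tot_obj[OF q]
        restr_J_restr_on(1)[OF JK(1-3)] by simp
    moreover have "Comp (cat_on K) (snd Y (J, K)) (e K) = amap (restr_on J K) (e J)"
    proof -
      have "Comp (glue E) (snd Y (J, K) E) (e K E) = amap (restr_on J K) (e J) E"
        if E: "E \<in> adm_cosets W S P K" for E
      proof -
        obtain u where u: "flag K u" "E = coset K u" by (rule adm_cosetE[OF JK(2) E])
        have fJ: "flag J u" using flag_sub[OF u(1) JK(3,4)] .
        obtain y where y: "snd Y (J, K) E = (fst Y K E, glue_restr_obj W E (fst Y J (coset J u)), y)"
          using a[OF u(1) JK(3,4)] u(2) by (auto simp: Hom_glue_cat)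
        have "y v \<cdot>[v] T K v = T J v" if v: "v \<in> E" for v
        proof -
          have c: "flag K v" "coset K v = E" using coset_member[OF u(1)] v u(2) by auto
          have "y v = t J K v" using y c(2) by (simp add: t_def)
          then show ?thesis using T_sub[OF c(1) JK(3,4)] by simp
        qed
        moreover have "E \<subseteq> coset J u" using coset_antimono[OF JK(3)] u(2) by simp
        ultimately show ?thesis
          using y eE[OF u(1)] eE[OF fJ] restr_on_arr[OF u(1) JK(3), of "e J"] u(2)
            restriction_restriction[of E "coset J u" X]
          by (auto simp: glue_cat_def glue_restr_def Int_absorb1 intro!: restrict_ext)
      qed
      then show ?thesis
        by (auto simp: C_sub_def Comp_sum_cat restr_JK_def intro!: restrict_ext)
    qed
    ultimately show "Comp (cat_on K) (snd Y (J, K)) (e K) =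
        Comp (cat_on K) (amap (restr_on J K) (e J)) (snd (tot_obj X) (J, K))" by simp
  qed (simp add: e_def)
  moreover have "is_iso (cat_on J) (e J)" if J: "J \<in> index" for J
  proof -
    have "is_iso (glue E) (e J E)" if E: "E \<in> adm_cosets W S P J" for E
    proof -
      obtain u where u: "flag J u" "E = coset J u" by (rule adm_cosetE[OF J E])
      have "is_iso (C v) (T J v)" if "v \<in> coset J u" for v using T_iso coset_member[OF u(1) that] by blast
      then show ?thesis
        using glue_cat_isoI[OF coset_carrier[OF u(1)] restriction_obj[OF P_sub_carrier coset_in_P[OF u(1)] X]
            A[OF u(1)] gh[OF u(1)]] eE[OF u(1)] u(2) by simp
    qed
    then show ?thesis
      using sum_cat_isoI[OF category_glue_cat[OF adm_carrier[OF J]] eH[OF J, unfolded C_sub_def]]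
      by (simp add: C_sub_def)
  qed
  ultimately have "(tot_obj X, Y, e) \<in> Hom total_cat (omap tot X) Y" "is_iso total_cat (tot_obj X, Y, e)"
    using diagram.section_cat_isoI[OF tot_obj_section[OF X] Y] tot_obj_section[OF X] Y
    by (auto simp: C_tot_def Hom_section_cat restr_tot_def)
  then show ?thesis using X by blast
qed

lemma tot_equivalence: "is_equivalence (glue P) total_cat tot"
proof (rule fully_faithful_essentially_surjective_equivalence[OF tot_functor])
  show "\<exists>F \<in> Hom (glue P) X Y. amap tot F = g"
    if "X \<in> Obj (glue P)" "Y \<in> Obj (glue P)" "g \<in> Hom total_cat (omap tot X) (omap tot Y)" for X Y g
    using tot_full that by (simp add: glue_cat_def)
  show "F = F'" if "F \<in> Hom (glue P) X Y" "F' \<in> Hom (glue P) X Y" "amap tot F = amap tot F'" for X Y F F'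
    using tot_faithful that .
  show "\<exists>X \<in> Obj (glue P). \<exists>e \<in> Hom total_cat (omap tot X) Y. is_iso total_cat e" if "Y \<in> Obj total_cat" for Y
    using tot_essentially_surjective that by (simp add: glue_cat_def C_tot_def section_cat_def)
qed

end

theorem theorem7p7p1:
  fixes W :: "('w, 'z) monoid_scheme" and S :: "'w set"
    and C :: "'w \<Rightarrow> ('o, 'm, 'y) abcat_scheme"
    and \<Phi> :: "'w \<Rightarrow> 'w \<Rightarrow> ('o, 'm, 'o, 'm) func"
    and \<nu> :: "'w \<Rightarrow> 'w \<Rightarrow> 'w \<Rightarrow> 'o \<Rightarrow> 'm"
    and s :: 'w
  assumes "coxeter_system W S"
    and "finite (carrier W)"
    and "\<And>w. w \<in> carrier W \<Longrightarrow> abelian_category (C w)"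
    and "gluing_data W S C \<Phi> \<nu>"
    and "s \<in> S"
  shows "is_equivalence
    (glue_cat W C \<Phi> \<nu> (non_descent_set W S s))
    (C_tot W S C \<Phi> \<nu> (non_descent_set W S s))
    (restr_tot W S C \<Phi> \<nu> (non_descent_set W S s))"
proof -
  interpret coxeter_system W S by (rule assms(1))
  interpret gluing_data W S C \<Phi> \<nu> by (rule assms(4))
  interpret glued_half_space W S s C \<Phi> \<nu>
    using assms(2,5) by unfold_locales
  show ?thesis using tot_equivalence by (simp add: P_def)
qed

end
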